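(* Let $\mathcal K$ be a 2-category and $\mathcal L$ a bicategory over the 2-category of monads, with a faithful quasi 2-functor $\underline{\mathcal U}:\mathcal L\to\mathrm{Mnd}(\mathcal K)$ and a quasi 2-functor $\underline{\mathcal F}:\mathcal L\to\mathrm{Mnd}(\mathcal K)$ that factors through $\underline{\mathcal U}$. Suppose given, for composable 1-cells $\overline B\xrightarrow{\overline X}\overline B'\xrightarrow{\overline Y}\overline B''$ of $\mathcal L$, natural isomorphisms $s_{Y,X}:\mathcal T_Y\circ\mathcal T_X\to\mathcal T_{YX}$, natural also in $\overline X,\overline Y$, satisfying the coherence conditions in the context, and let $s_0$ be the identity. Then the following defines a pseudofunctor $\mathcal T:\mathcal L\to\mathrm{Cat}$: on 0-cells $\overline B\mapsto{}_B\mathcal K$; on 1-cells $\overline X\mapsto\mathcal T_X:{}_B\mathcal K\to{}_{B'}\mathcal K$, $M\mapsto XM$, $f\mapsto X\times f$, where $XM$ is a left $B'$-module via $(X\times\nu_M)(\psi_{B,X}\times M)$; on 2-cells $\overline\zeta\mapsto\mathcal T_\zeta$, $\mathcal T_\zeta(M)=\zeta\times M$. Moreover, fixing a 0-cell $\overline B$ of $\mathcal L$ and putting $\mathcal C=\mathcal L(\overline B,\overline B)$, this yields the action of categories $\mathcal C\times{}_B\mathcal K\to{}_B\mathcal K$, $(\overline X,M)\mapsto XM$, with $XM$ a left $B$-module via $(X\times\nu_M)(\psi_{B,X}\times M)$ and with identity unity-action isomorphism; when the associativity isomorphisms $s_{Y,X}(M):Y(XM)\to(YX)M$ satisfy $s_{Y,X}(M)=(Y\times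 X\times\nu_M)(s_{Y,X}(B)\times M)(Y\times X\times\eta_B\times M)$, this action is the one characterized by the existence of an invertible normalized 2-cocycle on the $(X,\psi_{B,X})$ in $\mathrm{EM}^M(\mathcal K)$.
   Context: Conventions: 1-cells of $\mathcal K$ are composed by juxtaposition, $\times$ is horizontal and $\circ$ (or juxtaposition) vertical composition of 2-cells; a 1-cell in a formula stands for its identity 2-cell. ${}_B\mathcal K$ is the category of left $B$-modules $M:\mathcal D\to\mathcal A$ (any 0-cell $\mathcal D$; action $\nu_M:BM\to M$) and left $B$-linear 2-cells, for a monad $B:\mathcal A\to\mathcal A$. $\mathrm{Mnd}(\mathcal K)$: 0-cells monads $(\mathcal A,B)$; 1-cells $(X,\psi):(\mathcal A,B)\to(\mathcal A',B')$ with $X:\mathcal A\to\mathcal A'$, $\psi:B'X\to XB$, $\psi(\mu_{B'}\times X)=(X\times\mu_B)(\psi\times B)(B'\times\psi)$, $\psi(\eta_{B'}\times X)=X\times\eta_B$; 2-cells $\zeta:X\to Y$ with $(\zeta\times B)\psi=\psi'(B'\times\zeta)$; composition $(Y,\psi')(X,\psi)=(YX,(Y\times\psi)(\psi'\times X))$. A bicategory over the 2-category of monads is a bicategory $\mathcal L$ with a faithful quasi 2-functor $\underline{\mathcal U}:\mathcal L\to\mathrm{Mnd}(\mathcal K)$ and a quasi 2-functor $\underline{\mathcal F}:\mathcal L\to\mathrm{Mnd}(\mathcal K)$ factoring through $\underline{\mathcal U}$. "Quasi" means that the monoidal coherence axiom (compatibility with associativity constraints) is not required; "faithful" means that each functor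 on hom-categories is faithful. Notation: $\underline{\mathcal U}(\overline B)=\underline{\mathcal F}(\overline B)=B$ on 0-cells, $\underline{\mathcal U}(\overline X)=(X,\tau_{B,X})$ and $\underline{\mathcal F}(\overline X)=(X,\psi_{B,X})$ on 1-cells (same underlying 1-cell $X$), $\underline{\mathcal U}(\overline\zeta)=\underline{\mathcal F}(\overline\zeta)=\zeta$ on 2-cells. The unit constraints of $\mathcal L$ are taken to be identities; the associativity constraint of $\mathcal L$ has underlying 2-cell $\alpha_{Z,Y,X}:(ZY)X\to Z(YX)$. Coherence conditions on $s$: $s_{Y,X}(M):Y(XM)\to(YX)M$ are isomorphisms of left $B''$-modules, natural in $M$, $\overline X$, $\overline Y$, with $(\alpha_{Z,Y,X}\times M)\circ s_{ZY,X}(M)\circ s_{Z,Y}(XM)=s_{Z,YX}(M)\circ(Z\times s_{Y,X}(M))$ and $s_{\mathrm{Id},X}(M)=\mathrm{id}_{XM}=s_{X,\mathrm{Id}}(M)$. 2-cocycle in $\mathrm{EM}^M(\mathcal K)$ (the Eilenberg–Moore 2-category for monads, whose 2-cells $(X,\psi)\to(Y,\psi')$ are 2-cells $\zeta:X\to YB$ with $(Y\times\mu_B)(\zeta\times B)\psi=(Y\times\mu_B)(\psi'\times B)(B\times\zeta)$): here it means a family $\bar\rho_{X,Y}:XY\to XYB$ ($\overline X,\overline Y\in\mathcal C$), natural in $\overline X,\overline Y$, such that, with $\psi_{B,XY}=(X\times\psi_{B,Y})(\psi_{B,X}\times Y)$: $(XY\times\mu_B)(\bar\rho_{X,Y}\times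 B)\psi_{B,XY}=(XY\times\mu_B)(\psi_{B,XY}\times B)(B\times\bar\rho_{X,Y})$; $(\alpha\times\mu_B)(\bar\rho_{XY,Z}\times B)(XY\times\psi_{B,Z})(\bar\rho_{X,Y}\times Z)=(XYZ\times\mu_B)(\bar\rho_{X,YZ}\times B)(X\times\bar\rho_{Y,Z})$; invertible: there is $\bar\rho^{-1}_{X,Y}$ with $(XY\times\mu_B)(\bar\rho^{-1}_{X,Y}\times B)\bar\rho_{X,Y}=XY\times\eta_B=(XY\times\mu_B)(\bar\rho_{X,Y}\times B)\bar\rho^{-1}_{X,Y}$; normalized: $\bar\rho_{X,\mathrm{Id}}=X\times\eta_B=\bar\rho_{\mathrm{Id},X}$. The correspondence is $s_{X,Y}(M)=(XY\times\nu_M)(\bar\rho_{X,Y}\times M)$. *)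

theory Defs
  imports "HOL-Library.FuncSet"
begin

section \<open>Categories, functors, natural transformations\<close>

record ('o, 'a) cat =
  Ob :: "'o set"
  Ar :: "'a set"
  Dom :: "'a \<Rightarrow> 'o"
  Cod :: "'a \<Rightarrow> 'o"
  Id :: "'o \<Rightarrow> 'a"
  Cmp :: "'a \<Rightarrow> 'a \<Rightarrow> 'a"  (infixr "\<odot>\<index>" 70)

locale category =
  fixes C :: "('o, 'a) cat" (structure)
  assumes Dom_Cod: "f \<in> Ar C \<Longrightarrow> Dom C f \<in> Ob C \<and> Cod C f \<in> Ob C"
    and Id: "a \<in> Ob C \<Longrightarrow> Id C a \<in> Ar C \<and> Dom C (Id C a) = a \<and> Cod C (Id C a) = a"
    and Cmp: "\<lbrakk>f \<in> Ar C; g \<in> Ar C; Cod C f = Dom C g\<rbrakk> \<Longrightarrow>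
        g \<odot> f \<in> Ar C \<and> Dom C (g \<odot> f) = Dom C f \<and> Cod C (g \<odot> f) = Cod C g"
    and Cmp_Id: "f \<in> Ar C \<Longrightarrow> f \<odot> Id C (Dom C f) = f \<and> Id C (Cod C f) \<odot> f = f"
    and Cmp_assoc: "\<lbrakk>f \<in> Ar C; g \<in> Ar C; h \<in> Ar C; Cod C f = Dom C g; Cod C g = Dom C h\<rbrakk> \<Longrightarrow>
        (h \<odot> g) \<odot> f = h \<odot> (g \<odot> f)"

definition is_iso :: "('o, 'a) cat \<Rightarrow> 'a \<Rightarrow> bool" where
  "is_iso C f \<longleftrightarrow> f \<in> Ar C \<and>
     (\<exists>g \<in> Ar C. Dom C g = Cod C f \<and> Cod C g = Dom C f \<and>
        g \<odot>\<^bsub>C\<^esub> f = Id C (Dom C f) \<and> f \<odot>\<^bsub>C\<^esub> g = Id C (Cod C f))"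

definition prod_cat :: "('o, 'a) cat \<Rightarrow> ('p, 'b) cat \<Rightarrow> ('o \<times> 'p, 'a \<times> 'b) cat" where
  "prod_cat C D =
     \<lparr>Ob = Ob C \<times> Ob D, Ar = Ar C \<times> Ar D,
      Dom = map_prod (Dom C) (Dom D), Cod = map_prod (Cod C) (Cod D),
      Id = map_prod (Id C) (Id D),
      Cmp = (\<lambda>g f. (fst g \<odot>\<^bsub>C\<^esub> fst f, snd g \<odot>\<^bsub>D\<^esub> snd f))\<rparr>"

text \<open>Functors and natural transformations carry their (co)domains and are undefined off the
  carriers, so that equality of functors and of transformations is equality in HOL.\<close>

record ('o, 'a, 'p, 'b) cfun =
  fdom :: "('o, 'a) cat"
  fcod :: "('p, 'b) cat"
  fob :: "'o \<Rightarrow> 'p"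
  far :: "'a \<Rightarrow> 'b"

locale cat_functor =
  fixes F :: "('o, 'a, 'p, 'b) cfun"
  assumes categories: "category (fdom F)" "category (fcod F)"
    and fob: "fob F \<in> Ob (fdom F) \<rightarrow>\<^sub>E Ob (fcod F)"
    and far: "far F \<in> Ar (fdom F) \<rightarrow>\<^sub>E Ar (fcod F)"
    and far_Dom_Cod: "f \<in> Ar (fdom F) \<Longrightarrow>
        Dom (fcod F) (far F f) = fob F (Dom (fdom F) f) \<and>
        Cod (fcod F) (far F f) = fob F (Cod (fdom F) f)"
    and far_Id: "a \<in> Ob (fdom F) \<Longrightarrow> far F (Id (fdom F) a) = Id (fcod F) (fob F a)"
    and far_Cmp: "\<lbrakk>f \<in> Ar (fdom F); g \<in> Ar (fdom F); Cod (fdom F) f = Dom (fdom F) g\<rbrakk> \<Longrightarrow>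
        far F (g \<odot>\<^bsub>fdom F\<^esub> f) = far F g \<odot>\<^bsub>fcod F\<^esub> far F f"

record ('o, 'a, 'p, 'b) ntrans =
  ndom :: "('o, 'a, 'p, 'b) cfun"
  ncod :: "('o, 'a, 'p, 'b) cfun"
  ncmp :: "'o \<Rightarrow> 'b"

locale nat_trans =
  fixes \<theta> :: "('o, 'a, 'p, 'b) ntrans"
  assumes functors: "cat_functor (ndom \<theta>)" "cat_functor (ncod \<theta>)"
    and parallel: "fdom (ndom \<theta>) = fdom (ncod \<theta>)" "fcod (ndom \<theta>) = fcod (ncod \<theta>)"
    and ncmp: "ncmp \<theta> \<in> Ob (fdom (ndom \<theta>)) \<rightarrow>\<^sub>E Ar (fcod (ndom \<theta>))"
    and ncmp_Dom_Cod: "a \<in> Ob (fdom (ndom \<theta>)) \<Longrightarrow>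
        Dom (fcod (ndom \<theta>)) (ncmp \<theta> a) = fob (ndom \<theta>) a \<and>
        Cod (fcod (ndom \<theta>)) (ncmp \<theta> a) = fob (ncod \<theta>) a"
    and naturality: "f \<in> Ar (fdom (ndom \<theta>)) \<Longrightarrow>
        far (ncod \<theta>) f \<odot>\<^bsub>fcod (ndom \<theta>)\<^esub> ncmp \<theta> (Dom (fdom (ndom \<theta>)) f) =
        ncmp \<theta> (Cod (fdom (ndom \<theta>)) f) \<odot>\<^bsub>fcod (ndom \<theta>)\<^esub> far (ndom \<theta>) f"

section \<open>Bicategories and 2-categories\<close>

text \<open>Composition of 1-cells is written \<open>Y \<cdot> X\<close> (first \<open>X\<close>, then \<open>Y\<close>), vertical composition
  of 2-cells \<open>\<bullet>\<close>, horizontal composition \<open>\<star>\<close>.\<close>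

record ('o, 'm, 'c) bicat =
  C0 :: "'o set"
  C1 :: "'m set"
  C2 :: "'c set"
  src :: "'m \<Rightarrow> 'o"
  trg :: "'m \<Rightarrow> 'o"
  dom2 :: "'c \<Rightarrow> 'm"
  cod2 :: "'c \<Rightarrow> 'm"
  id1 :: "'o \<Rightarrow> 'm"
  comp1 :: "'m \<Rightarrow> 'm \<Rightarrow> 'm"  (infixr "\<cdot>\<index>" 80)
  id2 :: "'m \<Rightarrow> 'c"
  vcomp :: "'c \<Rightarrow> 'c \<Rightarrow> 'c"  (infixr "\<bullet>\<index>" 65)
  hcomp :: "'c \<Rightarrow> 'c \<Rightarrow> 'c"  (infixr "\<star>\<index>" 75)
  assoc :: "'m \<Rightarrow> 'm \<Rightarrow> 'm \<Rightarrow> 'c"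
  lunit :: "'m \<Rightarrow> 'c"
  runit :: "'m \<Rightarrow> 'c"

abbreviation lwhisker :: "('o, 'm, 'c) bicat \<Rightarrow> 'm \<Rightarrow> 'c \<Rightarrow> 'c"  (infixr "\<rhd>\<index>" 75) where
  "X \<rhd>\<^bsub>K\<^esub> \<zeta> \<equiv> id2 K X \<star>\<^bsub>K\<^esub> \<zeta>"

abbreviation rwhisker :: "('o, 'm, 'c) bicat \<Rightarrow> 'c \<Rightarrow> 'm \<Rightarrow> 'c"  (infixl "\<lhd>\<index>" 76) where
  "\<zeta> \<lhd>\<^bsub>K\<^esub> X \<equiv> \<zeta> \<star>\<^bsub>K\<^esub> id2 K X"

definition cell2 :: "('o, 'm, 'c) bicat \<Rightarrow> 'm \<Rightarrow> 'm \<Rightarrow> 'c set" where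
  "cell2 K X Y = {\<zeta> \<in> C2 K. dom2 K \<zeta> = X \<and> cod2 K \<zeta> = Y}"

definition hom_cat :: "('o, 'm, 'c) bicat \<Rightarrow> 'o \<Rightarrow> 'o \<Rightarrow> ('m, 'c) cat" where
  "hom_cat K A B =
     \<lparr>Ob = {X \<in> C1 K. src K X = A \<and> trg K X = B},
      Ar = {\<zeta> \<in> C2 K. src K (dom2 K \<zeta>) = A \<and> trg K (dom2 K \<zeta>) = B},
      Dom = dom2 K, Cod = cod2 K, Id = id2 K, Cmp = vcomp K\<rparr>"

definition iso2 :: "('o, 'm, 'c) bicat \<Rightarrow> 'c \<Rightarrow> bool" where
  "iso2 K \<zeta> \<longleftrightarrow> is_iso (hom_cat K (src K (dom2 K \<zeta>)) (trg K (dom2 K \<zeta>))) \<zeta>"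

locale bicategory =
  fixes K :: "('o, 'm, 'c) bicat" (structure)
  assumes src_trg: "X \<in> C1 K \<Longrightarrow> src K X \<in> C0 K \<and> trg K X \<in> C0 K"
    and dom_cod: "\<zeta> \<in> C2 K \<Longrightarrow> dom2 K \<zeta> \<in> C1 K \<and> cod2 K \<zeta> \<in> C1 K \<and>
        src K (dom2 K \<zeta>) = src K (cod2 K \<zeta>) \<and> trg K (dom2 K \<zeta>) = trg K (cod2 K \<zeta>)"
    and hom_category: "\<lbrakk>A \<in> C0 K; B \<in> C0 K\<rbrakk> \<Longrightarrow> category (hom_cat K A B)"
    and id1: "A \<in> C0 K \<Longrightarrow> id1 K A \<in> C1 K \<and> src K (id1 K A) = A \<and> trg K (id1 K A) = A"
    and comp1: "\<lbrakk>X \<in> C1 K; Y \<in> C1 K; trg K X = src K Y\<rbrakk> \<Longrightarrow>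
        Y \<cdot> X \<in> C1 K \<and> src K (Y \<cdot> X) = src K X \<and> trg K (Y \<cdot> X) = trg K Y"
    and hcomp: "\<lbrakk>\<zeta> \<in> C2 K; \<xi> \<in> C2 K; trg K (dom2 K \<zeta>) = src K (dom2 K \<xi>)\<rbrakk> \<Longrightarrow>
        \<xi> \<star> \<zeta> \<in> cell2 K (dom2 K \<xi> \<cdot> dom2 K \<zeta>) (cod2 K \<xi> \<cdot> cod2 K \<zeta>)"
    and hcomp_id2: "\<lbrakk>X \<in> C1 K; Y \<in> C1 K; trg K X = src K Y\<rbrakk> \<Longrightarrow>
        id2 K Y \<star> id2 K X = id2 K (Y \<cdot> X)"
    and interchange: "\<lbrakk>\<zeta> \<in> C2 K; \<zeta>' \<in> C2 K; \<xi> \<in> C2 K; \<xi>' \<in> C2 K;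
        cod2 K \<zeta> = dom2 K \<zeta>'; cod2 K \<xi> = dom2 K \<xi>'; trg K (dom2 K \<zeta>) = src K (dom2 K \<xi>)\<rbrakk> \<Longrightarrow>
        (\<xi>' \<bullet> \<xi>) \<star> (\<zeta>' \<bullet> \<zeta>) = (\<xi>' \<star> \<zeta>') \<bullet> (\<xi> \<star> \<zeta>)"
    and assoc: "\<lbrakk>X \<in> C1 K; Y \<in> C1 K; Z \<in> C1 K; trg K X = src K Y; trg K Y = src K Z\<rbrakk> \<Longrightarrow>
        assoc K Z Y X \<in> cell2 K ((Z \<cdot> Y) \<cdot> X) (Z \<cdot> (Y \<cdot> X)) \<and> iso2 K (assoc K Z Y X)"
    and assoc_natural: "\<lbrakk>\<zeta> \<in> C2 K; \<xi> \<in> C2 K; \<chi> \<in> C2 K;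
        trg K (dom2 K \<zeta>) = src K (dom2 K \<xi>); trg K (dom2 K \<xi>) = src K (dom2 K \<chi>)\<rbrakk> \<Longrightarrow>
        assoc K (cod2 K \<chi>) (cod2 K \<xi>) (cod2 K \<zeta>) \<bullet> ((\<chi> \<star> \<xi>) \<star> \<zeta>) =
        (\<chi> \<star> (\<xi> \<star> \<zeta>)) \<bullet> assoc K (dom2 K \<chi>) (dom2 K \<xi>) (dom2 K \<zeta>)"
    and lunit: "X \<in> C1 K \<Longrightarrow>
        lunit K X \<in> cell2 K (id1 K (trg K X) \<cdot> X) X \<and> iso2 K (lunit K X)"
    and lunit_natural: "\<zeta> \<in> C2 K \<Longrightarrow>
        lunit K (cod2 K \<zeta>) \<bullet> (id1 K (trg K (dom2 K \<zeta>)) \<rhd> \<zeta>) = \<zeta> \<bullet> lunit K (dom2 K \<zeta>)"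
    and runit: "X \<in> C1 K \<Longrightarrow>
        runit K X \<in> cell2 K (X \<cdot> id1 K (src K X)) X \<and> iso2 K (runit K X)"
    and runit_natural: "\<zeta> \<in> C2 K \<Longrightarrow>
        runit K (cod2 K \<zeta>) \<bullet> (\<zeta> \<lhd> id1 K (src K (dom2 K \<zeta>))) = \<zeta> \<bullet> runit K (dom2 K \<zeta>)"
    and pentagon: "\<lbrakk>X \<in> C1 K; Y \<in> C1 K; Z \<in> C1 K; W \<in> C1 K;
        trg K X = src K Y; trg K Y = src K Z; trg K Z = src K W\<rbrakk> \<Longrightarrow>
        assoc K W Z (Y \<cdot> X) \<bullet> assoc K (W \<cdot> Z) Y X =
        (W \<rhd> assoc K Z Y X) \<bullet> assoc K W (Z \<cdot> Y) X \<bullet> (assoc K W Z Y \<lhd> X)"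
    and triangle: "\<lbrakk>X \<in> C1 K; Y \<in> C1 K; trg K X = src K Y\<rbrakk> \<Longrightarrow>
        (Y \<rhd> lunit K X) \<bullet> assoc K Y (id1 K (src K Y)) X = runit K Y \<lhd> X"

text \<open>A 2-category is a bicategory with identity constraints; comparing (co)domains, this
  includes strict associativity and unitality of the composition of 1-cells.\<close>

definition unit_strict :: "('o, 'm, 'c) bicat \<Rightarrow> bool" where
  "unit_strict K \<longleftrightarrow> (\<forall>X \<in> C1 K. lunit K X = id2 K X \<and> runit K X = id2 K X)"

locale two_category = bicategory K for K :: "('o, 'm, 'c) bicat" (structure) +
  assumes assoc_strict: "\<lbrakk>X \<in> C1 K; Y \<in> C1 K; Z \<in> C1 K; trg K X = src K Y; trg K Y = src K Z\<rbrakk> \<Longrightarrow>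
        assoc K Z Y X = id2 K (Z \<cdot> (Y \<cdot> X))"
    and units_strict: "unit_strict K"

record ('o, 'm, 'c, 'p, 'n, 'd) bimap =
  map0 :: "'o \<Rightarrow> 'p"
  map1 :: "'m \<Rightarrow> 'n"
  map2 :: "'c \<Rightarrow> 'd"

text \<open>The part common to quasi 2-functors and pseudofunctors: functors on the hom-categories.\<close>

locale locally_functorial =
  fixes S :: "('o, 'm, 'c) bicat" and T :: "('p, 'n, 'd) bicat"
    and G :: "('o, 'm, 'c, 'p, 'n, 'd, 'z) bimap_scheme"
  assumes map0: "A \<in> C0 S \<Longrightarrow> map0 G A \<in> C0 T"
    and map1: "X \<in> C1 S \<Longrightarrow> map1 G X \<in> C1 T \<and>
        src T (map1 G X) = map0 G (src S X) \<and> trg T (map1 G X) = map0 G (trg S X)"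
    and map2: "\<zeta> \<in> C2 S \<Longrightarrow> map2 G \<zeta> \<in> cell2 T (map1 G (dom2 S \<zeta>)) (map1 G (cod2 S \<zeta>))"
    and map2_id2: "X \<in> C1 S \<Longrightarrow> map2 G (id2 S X) = id2 T (map1 G X)"
    and map2_vcomp: "\<lbrakk>\<zeta> \<in> C2 S; \<xi> \<in> C2 S; cod2 S \<zeta> = dom2 S \<xi>\<rbrakk> \<Longrightarrow>
        map2 G (\<xi> \<bullet>\<^bsub>S\<^esub> \<zeta>) = map2 G \<xi> \<bullet>\<^bsub>T\<^esub> map2 G \<zeta>"

text \<open>A quasi 2-functor preserves all compositions, identities and unit constraints strictly, as a
  2-functor does, but need not be compatible with the associativity constraints: the image of
  \<open>assoc S Z Y X\<close> is an arbitrary, not necessarily identity, 2-cell.\<close>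

locale quasi_2functor = locally_functorial S T G
  for S :: "('o, 'm, 'c) bicat" and T :: "('p, 'n, 'd) bicat"
    and G :: "('o, 'm, 'c, 'p, 'n, 'd) bimap" +
  assumes map1_id1: "A \<in> C0 S \<Longrightarrow> map1 G (id1 S A) = id1 T (map0 G A)"
    and map1_comp1: "\<lbrakk>X \<in> C1 S; Y \<in> C1 S; trg S X = src S Y\<rbrakk> \<Longrightarrow>
        map1 G (Y \<cdot>\<^bsub>S\<^esub> X) = map1 G Y \<cdot>\<^bsub>T\<^esub> map1 G X"
    and map2_hcomp: "\<lbrakk>\<zeta> \<in> C2 S; \<xi> \<in> C2 S; trg S (dom2 S \<zeta>) = src S (dom2 S \<xi>)\<rbrakk> \<Longrightarrow>
        map2 G (\<xi> \<star>\<^bsub>S\<^esub> \<zeta>) = map2 G \<xi> \<star>\<^bsub>T\<^esub> map2 G \<zeta>"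
    and map2_lunit: "X \<in> C1 S \<Longrightarrow> map2 G (lunit S X) = lunit T (map1 G X)"
    and map2_runit: "X \<in> C1 S \<Longrightarrow> map2 G (runit S X) = runit T (map1 G X)"

definition locally_faithful ::
  "('o, 'm, 'c) bicat \<Rightarrow> ('o, 'm, 'c, 'p, 'n, 'd) bimap \<Rightarrow> bool" where
  "locally_faithful S G \<longleftrightarrow>
     (\<forall>X \<in> C1 S. \<forall>Y \<in> C1 S. inj_on (map2 G) (cell2 S X Y))"

record ('o, 'm, 'c, 'p, 'n, 'd) pseudo = "('o, 'm, 'c, 'p, 'n, 'd) bimap" +
  pcomp :: "'m \<Rightarrow> 'm \<Rightarrow> 'd"
  punit :: "'o \<Rightarrow> 'd"

locale pseudofunctor = locally_functorial S T G + S: bicategory S + T: bicategory T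
  for S :: "('o, 'm, 'c) bicat" and T :: "('p, 'n, 'd) bicat"
    and G :: "('o, 'm, 'c, 'p, 'n, 'd) pseudo" +
  assumes pcomp: "\<lbrakk>X \<in> C1 S; Y \<in> C1 S; trg S X = src S Y\<rbrakk> \<Longrightarrow>
        pcomp G Y X \<in> cell2 T (map1 G Y \<cdot>\<^bsub>T\<^esub> map1 G X) (map1 G (Y \<cdot>\<^bsub>S\<^esub> X)) \<and>
        iso2 T (pcomp G Y X)"
    and pcomp_natural: "\<lbrakk>\<zeta> \<in> C2 S; \<xi> \<in> C2 S; trg S (dom2 S \<zeta>) = src S (dom2 S \<xi>)\<rbrakk> \<Longrightarrow>
        pcomp G (cod2 S \<xi>) (cod2 S \<zeta>) \<bullet>\<^bsub>T\<^esub> (map2 G \<xi> \<star>\<^bsub>T\<^esub> map2 G \<zeta>) =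
        map2 G (\<xi> \<star>\<^bsub>S\<^esub> \<zeta>) \<bullet>\<^bsub>T\<^esub> pcomp G (dom2 S \<xi>) (dom2 S \<zeta>)"
    and punit: "A \<in> C0 S \<Longrightarrow>
        punit G A \<in> cell2 T (id1 T (map0 G A)) (map1 G (id1 S A)) \<and> iso2 T (punit G A)"
    and pcomp_assoc: "\<lbrakk>X \<in> C1 S; Y \<in> C1 S; Z \<in> C1 S; trg S X = src S Y; trg S Y = src S Z\<rbrakk> \<Longrightarrow>
        map2 G (assoc S Z Y X) \<bullet>\<^bsub>T\<^esub> pcomp G (Z \<cdot>\<^bsub>S\<^esub> Y) X \<bullet>\<^bsub>T\<^esub> (pcomp G Z Y \<lhd>\<^bsub>T\<^esub> map1 G X) =
        pcomp G Z (Y \<cdot>\<^bsub>S\<^esub> X) \<bullet>\<^bsub>T\<^esub> (map1 G Z \<rhd>\<^bsub>T\<^esub> pcomp G Y X) \<bullet>\<^bsub>T\<^esub>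
          assoc T (map1 G Z) (map1 G Y) (map1 G X)"
    and pcomp_lunit: "X \<in> C1 S \<Longrightarrow>
        map2 G (lunit S X) \<bullet>\<^bsub>T\<^esub> pcomp G (id1 S (trg S X)) X \<bullet>\<^bsub>T\<^esub>
          (punit G (trg S X) \<lhd>\<^bsub>T\<^esub> map1 G X) = lunit T (map1 G X)"
    and pcomp_runit: "X \<in> C1 S \<Longrightarrow>
        map2 G (runit S X) \<bullet>\<^bsub>T\<^esub> pcomp G X (id1 S (src S X)) \<bullet>\<^bsub>T\<^esub>
          (map1 G X \<rhd>\<^bsub>T\<^esub> punit G (src S X)) = runit T (map1 G X)"

section \<open>The 2-category of categories\<close>

text \<open>HOL has no type of all categories; \<open>Cat\<close> consists of all categories whose objects and
  arrows are drawn from the types \<open>'o\<close> and \<open>'a\<close>.\<close>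

definition id_fun :: "('o, 'a) cat \<Rightarrow> ('o, 'a, 'o, 'a) cfun" where
  "id_fun C = \<lparr>fdom = C, fcod = C, fob = (\<lambda>a \<in> Ob C. a), far = (\<lambda>f \<in> Ar C. f)\<rparr>"

definition comp_fun ::
  "('p, 'b, 'q, 'e) cfun \<Rightarrow> ('o, 'a, 'p, 'b) cfun \<Rightarrow> ('o, 'a, 'q, 'e) cfun" where
  "comp_fun G F = \<lparr>fdom = fdom F, fcod = fcod G,
     fob = (\<lambda>a \<in> Ob (fdom F). fob G (fob F a)), far = (\<lambda>f \<in> Ar (fdom F). far G (far F f))\<rparr>"

definition id_nt :: "('o, 'a, 'p, 'b) cfun \<Rightarrow> ('o, 'a, 'p, 'b) ntrans" where
  "id_nt F = \<lparr>ndom = F, ncod = F, ncmp = (\<lambda>a \<in> Ob (fdom F). Id (fcod F) (fob F a))\<rparr>"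

definition vcomp_nt ::
  "('o, 'a, 'p, 'b) ntrans \<Rightarrow> ('o, 'a, 'p, 'b) ntrans \<Rightarrow> ('o, 'a, 'p, 'b) ntrans" where
  "vcomp_nt \<phi> \<theta> = \<lparr>ndom = ndom \<theta>, ncod = ncod \<phi>,
     ncmp = (\<lambda>a \<in> Ob (fdom (ndom \<theta>)). ncmp \<phi> a \<odot>\<^bsub>fcod (ndom \<theta>)\<^esub> ncmp \<theta> a)\<rparr>"

definition hcomp_nt ::
  "('p, 'b, 'q, 'e) ntrans \<Rightarrow> ('o, 'a, 'p, 'b) ntrans \<Rightarrow> ('o, 'a, 'q, 'e) ntrans" where
  "hcomp_nt \<phi> \<theta> =
     \<lparr>ndom = comp_fun (ndom \<phi>) (ndom \<theta>), ncod = comp_fun (ncod \<phi>) (ncod \<theta>),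
      ncmp = (\<lambda>a \<in> Ob (fdom (ndom \<theta>)).
        ncmp \<phi> (fob (ncod \<theta>) a) \<odot>\<^bsub>fcod (ndom \<phi>)\<^esub> far (ndom \<phi>) (ncmp \<theta> a))\<rparr>"

definition Cat ::
  "(('o, 'a) cat, ('o, 'a, 'o, 'a) cfun, ('o, 'a, 'o, 'a) ntrans) bicat" where
  "Cat = \<lparr>C0 = {C. category C}, C1 = {F. cat_functor F}, C2 = {\<theta>. nat_trans \<theta>},
     src = fdom, trg = fcod, dom2 = ndom, cod2 = ncod,
     id1 = id_fun, comp1 = comp_fun, id2 = id_nt, vcomp = vcomp_nt, hcomp = hcomp_nt,
     assoc = (\<lambda>H G F. id_nt (comp_fun H (comp_fun G F))), lunit = id_nt, runit = id_nt\<rparr>"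

section \<open>Monads in a 2-category\<close>

record ('o, 'm, 'c) mnd =
  mobj :: 'o
  mcar :: 'm
  mmul :: 'c
  mone :: 'c

locale monad_in =
  fixes K :: "('o, 'm, 'c) bicat" (structure) and B :: "('o, 'm, 'c) mnd"
  assumes mobj: "mobj B \<in> C0 K"
    and mcar: "mcar B \<in> C1 K" "src K (mcar B) = mobj B" "trg K (mcar B) = mobj B"
    and mmul: "mmul B \<in> cell2 K (mcar B \<cdot> mcar B) (mcar B)"
    and mone: "mone B \<in> cell2 K (id1 K (mobj B)) (mcar B)"
    and mmul_assoc: "mmul B \<bullet> (mmul B \<lhd> mcar B) = mmul B \<bullet> (mcar B \<rhd> mmul B)"
    and mmul_mone: "mmul B \<bullet> (mone B \<lhd> mcar B) = id2 K (mcar B)"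
      "mmul B \<bullet> (mcar B \<rhd> mone B) = id2 K (mcar B)"

text \<open>A 1-cell \<open>(X, \<psi>) : (\<A>, B) \<rightarrow> (\<A>', B')\<close>, with its source and target monads.\<close>

record ('o, 'm, 'c) mnd1 =
  m1src :: "('o, 'm, 'c) mnd"
  m1trg :: "('o, 'm, 'c) mnd"
  und1 :: 'm
  str :: 'c

locale monad_1cell =
  fixes K :: "('o, 'm, 'c) bicat" (structure) and X :: "('o, 'm, 'c) mnd1"
  assumes monads: "monad_in K (m1src X)" "monad_in K (m1trg X)"
    and und1: "und1 X \<in> C1 K" "src K (und1 X) = mobj (m1src X)" "trg K (und1 X) = mobj (m1trg X)"
    and str: "str X \<in> cell2 K (mcar (m1trg X) \<cdot> und1 X) (und1 X \<cdot> mcar (m1src X))"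
    and str_mmul: "str X \<bullet> (mmul (m1trg X) \<lhd> und1 X) =
        (und1 X \<rhd> mmul (m1src X)) \<bullet> (str X \<lhd> mcar (m1src X)) \<bullet> (mcar (m1trg X) \<rhd> str X)"
    and str_mone: "str X \<bullet> (mone (m1trg X) \<lhd> und1 X) = und1 X \<rhd> mone (m1src X)"

record ('o, 'm, 'c) mnd2 =
  m2dom :: "('o, 'm, 'c) mnd1"
  m2cod :: "('o, 'm, 'c) mnd1"
  und2 :: 'c

locale monad_2cell =
  fixes K :: "('o, 'm, 'c) bicat" (structure) and \<zeta> :: "('o, 'm, 'c) mnd2"
  assumes cells1: "monad_1cell K (m2dom \<zeta>)" "monad_1cell K (m2cod \<zeta>)"
    and parallel: "m1src (m2dom \<zeta>) = m1src (m2cod \<zeta>)" "m1trg (m2dom \<zeta>) = m1trg (m2cod \<zeta>)"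
    and und2: "und2 \<zeta> \<in> cell2 K (und1 (m2dom \<zeta>)) (und1 (m2cod \<zeta>))"
    and str_und2: "(und2 \<zeta> \<lhd> mcar (m1src (m2dom \<zeta>))) \<bullet> str (m2dom \<zeta>) =
        str (m2cod \<zeta>) \<bullet> (mcar (m1trg (m2dom \<zeta>)) \<rhd> und2 \<zeta>)"

definition mnd_comp1 ::
  "('o, 'm, 'c) bicat \<Rightarrow> ('o, 'm, 'c) mnd1 \<Rightarrow> ('o, 'm, 'c) mnd1 \<Rightarrow> ('o, 'm, 'c) mnd1" where
  "mnd_comp1 K Y X = \<lparr>m1src = m1src X, m1trg = m1trg Y, und1 = und1 Y \<cdot>\<^bsub>K\<^esub> und1 X,
     str = (und1 Y \<rhd>\<^bsub>K\<^esub> str X) \<bullet>\<^bsub>K\<^esub> (str Y \<lhd>\<^bsub>K\<^esub> und1 X)\<rparr>"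

definition mnd_id2 ::
  "('o, 'm, 'c) bicat \<Rightarrow> ('o, 'm, 'c) mnd1 \<Rightarrow> ('o, 'm, 'c) mnd2" where
  "mnd_id2 K X = \<lparr>m2dom = X, m2cod = X, und2 = id2 K (und1 X)\<rparr>"

definition Mnd ::
  "('o, 'm, 'c) bicat \<Rightarrow> (('o, 'm, 'c) mnd, ('o, 'm, 'c) mnd1, ('o, 'm, 'c) mnd2) bicat" where
  "Mnd K = \<lparr>C0 = {B. monad_in K B}, C1 = {X. monad_1cell K X}, C2 = {\<zeta>. monad_2cell K \<zeta>},
     src = m1src, trg = m1trg, dom2 = m2dom, cod2 = m2cod,
     id1 = (\<lambda>B. \<lparr>m1src = B, m1trg = B, und1 = id1 K (mobj B), str = id2 K (mcar B)\<rparr>),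
     comp1 = mnd_comp1 K,
     id2 = mnd_id2 K,
     vcomp = (\<lambda>\<xi> \<zeta>. \<lparr>m2dom = m2dom \<zeta>, m2cod = m2cod \<xi>, und2 = und2 \<xi> \<bullet>\<^bsub>K\<^esub> und2 \<zeta>\<rparr>),
     hcomp = (\<lambda>\<xi> \<zeta>. \<lparr>m2dom = mnd_comp1 K (m2dom \<xi>) (m2dom \<zeta>),
        m2cod = mnd_comp1 K (m2cod \<xi>) (m2cod \<zeta>), und2 = und2 \<xi> \<star>\<^bsub>K\<^esub> und2 \<zeta>\<rparr>),
     assoc = (\<lambda>Z Y X. mnd_id2 K (mnd_comp1 K Z (mnd_comp1 K Y X))),
     lunit = mnd_id2 K, runit = mnd_id2 K\<rparr>"

section \<open>Left modules over a monad\<close>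

record ('m, 'c) lmod =
  lcar :: 'm
  lact :: 'c

record ('m, 'c) lmor =
  ldom :: "('m, 'c) lmod"
  lcod :: "('m, 'c) lmod"
  lund :: 'c

locale left_module =
  fixes K :: "('o, 'm, 'c) bicat" (structure) and B :: "('o, 'm, 'c) mnd" and M :: "('m, 'c) lmod"
  assumes lcar: "lcar M \<in> C1 K" "trg K (lcar M) = mobj B"
    and lact: "lact M \<in> cell2 K (mcar B \<cdot> lcar M) (lcar M)"
    and lact_mmul: "lact M \<bullet> (mmul B \<lhd> lcar M) = lact M \<bullet> (mcar B \<rhd> lact M)"
    and lact_mone: "lact M \<bullet> (mone B \<lhd> lcar M) = id2 K (lcar M)"

locale left_linear =
  fixes K :: "('o, 'm, 'c) bicat" (structure) and B :: "('o, 'm, 'c) mnd" and f :: "('m, 'c) lmor"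
  assumes modules: "left_module K B (ldom f)" "left_module K B (lcod f)"
    and lund: "lund f \<in> cell2 K (lcar (ldom f)) (lcar (lcod f))"
    and linear: "lund f \<bullet> lact (ldom f) = lact (lcod f) \<bullet> (mcar B \<rhd> lund f)"

definition Mod ::
  "('o, 'm, 'c) bicat \<Rightarrow> ('o, 'm, 'c) mnd \<Rightarrow> (('m, 'c) lmod, ('m, 'c) lmor) cat" where
  "Mod K B = \<lparr>Ob = {M. left_module K B M}, Ar = {f. left_linear K B f}, Dom = ldom, Cod = lcod,
     Id = (\<lambda>M. \<lparr>ldom = M, lcod = M, lund = id2 K (lcar M)\<rparr>),
     Cmp = (\<lambda>g f. \<lparr>ldom = ldom f, lcod = lcod g, lund = lund g \<bullet>\<^bsub>K\<^esub> lund f\<rparr>)\<rparr>"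

definition regular_mod :: "('o, 'm, 'c) mnd \<Rightarrow> ('m, 'c) lmod" where
  "regular_mod B = \<lparr>lcar = mcar B, lact = mmul B\<rparr>"

definition tmod ::
  "('o, 'm, 'c) bicat \<Rightarrow> ('o, 'm, 'c) mnd1 \<Rightarrow> ('m, 'c) lmod \<Rightarrow> ('m, 'c) lmod" where
  "tmod K X M = \<lparr>lcar = und1 X \<cdot>\<^bsub>K\<^esub> lcar M,
     lact = (und1 X \<rhd>\<^bsub>K\<^esub> lact M) \<bullet>\<^bsub>K\<^esub> (str X \<lhd>\<^bsub>K\<^esub> lcar M)\<rparr>"

definition T_fun :: "('o, 'm, 'c) bicat \<Rightarrow> ('o, 'm, 'c) mnd1 \<Rightarrow>
    (('m, 'c) lmod, ('m, 'c) lmor, ('m, 'c) lmod, ('m, 'c) lmor) cfun" where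
  "T_fun K X = \<lparr>fdom = Mod K (m1src X), fcod = Mod K (m1trg X),
     fob = (\<lambda>M \<in> Ob (Mod K (m1src X)). tmod K X M),
     far = (\<lambda>f \<in> Ar (Mod K (m1src X)).
       \<lparr>ldom = tmod K X (ldom f), lcod = tmod K X (lcod f), lund = und1 X \<rhd>\<^bsub>K\<^esub> lund f\<rparr>)\<rparr>"

definition T_nt :: "('o, 'm, 'c) bicat \<Rightarrow> ('o, 'm, 'c) mnd2 \<Rightarrow>
    (('m, 'c) lmod, ('m, 'c) lmor, ('m, 'c) lmod, ('m, 'c) lmor) ntrans" where
  "T_nt K \<zeta> = \<lparr>ndom = T_fun K (m2dom \<zeta>), ncod = T_fun K (m2cod \<zeta>),
     ncmp = (\<lambda>M \<in> Ob (Mod K (m1src (m2dom \<zeta>))).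
       \<lparr>ldom = tmod K (m2dom \<zeta>) M, lcod = tmod K (m2cod \<zeta>) M, lund = und2 \<zeta> \<lhd>\<^bsub>K\<^esub> lcar M\<rparr>)\<rparr>"

section \<open>Bicategories over the 2-category of monads\<close>

type_synonym ('o, 'm, 'c, 'p, 'n, 'd) to_mnd =
  "('p, 'n, 'd, ('o, 'm, 'c) mnd, ('o, 'm, 'c) mnd1, ('o, 'm, 'c) mnd2) bimap"

text \<open>That \<open>F\<close> factors through \<open>U\<close> is meant as follows: the two agree on 0-cells and on
  underlying 1- and 2-cells, and may differ only in the structure 2-cells
  \<open>\<tau>\<^sub>B\<^sub>,\<^sub>X = str (map1 U X)\<close> and \<open>\<psi>\<^sub>B\<^sub>,\<^sub>X = str (map1 F X)\<close>.\<close>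

definition factors_through :: "('p, 'n, 'd) bicat \<Rightarrow>
    ('o, 'm, 'c, 'p, 'n, 'd) to_mnd \<Rightarrow> ('o, 'm, 'c, 'p, 'n, 'd) to_mnd \<Rightarrow> bool" where
  "factors_through L F U \<longleftrightarrow>
     (\<forall>A \<in> C0 L. map0 F A = map0 U A) \<and>
     (\<forall>X \<in> C1 L. und1 (map1 F X) = und1 (map1 U X)) \<and>
     (\<forall>\<zeta> \<in> C2 L. und2 (map2 F \<zeta>) = und2 (map2 U \<zeta>))"

locale bicategory_over_monads = L: bicategory L +
    U: quasi_2functor L "Mnd K" U + F: quasi_2functor L "Mnd K" F
  for K :: "('o, 'm, 'c) bicat" and L :: "('p, 'n, 'd) bicat"
    and U F :: "('o, 'm, 'c, 'p, 'n, 'd) to_mnd" +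
  assumes faithful: "locally_faithful L U"
    and factors: "factors_through L F U"
    and unit_constraints: "unit_strict L"

section \<open>The associativity isomorphisms and the pseudofunctor\<close>

text \<open>\<open>s Y X M\<close> is the 2-cell \<open>s\<^sub>Y\<^sub>,\<^sub>X(M) : Y(XM) \<rightarrow> (YX)M\<close> of \<open>K\<close>; \<open>s_mor\<close> regards it as a
  morphism of modules. Both use the module structures given by \<open>F\<close>.\<close>

type_synonym ('m, 'c, 'n) assoc_family = "'n \<Rightarrow> 'n \<Rightarrow> ('m, 'c) lmod \<Rightarrow> 'c"

definition s_mor :: "('o, 'm, 'c) bicat \<Rightarrow> ('p, 'n, 'd) bicat \<Rightarrow>
    ('o, 'm, 'c, 'p, 'n, 'd) to_mnd \<Rightarrow> ('m, 'c, 'n) assoc_family \<Rightarrow>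
    'n \<Rightarrow> 'n \<Rightarrow> ('m, 'c) lmod \<Rightarrow> ('m, 'c) lmor" where
  "s_mor K L F s Y X M =
     \<lparr>ldom = tmod K (map1 F Y) (tmod K (map1 F X) M), lcod = tmod K (map1 F (Y \<cdot>\<^bsub>L\<^esub> X)) M,
      lund = s Y X M\<rparr>"

locale coherent_assoc_family =
  fixes K :: "('o, 'm, 'c) bicat" (structure) and L :: "('p, 'n, 'd) bicat"
    and F :: "('o, 'm, 'c, 'p, 'n, 'd) to_mnd" and s :: "('m, 'c, 'n) assoc_family"
  assumes s_iso: "\<lbrakk>X \<in> C1 L; Y \<in> C1 L; trg L X = src L Y; M \<in> Ob (Mod K (map0 F (src L X)))\<rbrakk> \<Longrightarrow>
        is_iso (Mod K (map0 F (trg L Y))) (s_mor K L F s Y X M)"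
    and s_natural: "\<lbrakk>X \<in> C1 L; Y \<in> C1 L; trg L X = src L Y;
        f \<in> Ar (Mod K (map0 F (src L X)))\<rbrakk> \<Longrightarrow>
        s Y X (lcod f) \<bullet> (und1 (map1 F Y) \<rhd> (und1 (map1 F X) \<rhd> lund f)) =
        (und1 (map1 F (Y \<cdot>\<^bsub>L\<^esub> X)) \<rhd> lund f) \<bullet> s Y X (ldom f)"
    and s_natural_1cells: "\<lbrakk>\<zeta> \<in> C2 L; \<xi> \<in> C2 L; trg L (dom2 L \<zeta>) = src L (dom2 L \<xi>);
        M \<in> Ob (Mod K (map0 F (src L (dom2 L \<zeta>))))\<rbrakk> \<Longrightarrow>
        s (cod2 L \<xi>) (cod2 L \<zeta>) M \<bullet> (und2 (map2 F \<xi>) \<star> (und2 (map2 F \<zeta>) \<lhd> lcar M)) =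
        (und2 (map2 F (\<xi> \<star>\<^bsub>L\<^esub> \<zeta>)) \<lhd> lcar M) \<bullet> s (dom2 L \<xi>) (dom2 L \<zeta>) M"
    and s_assoc: "\<lbrakk>X \<in> C1 L; Y \<in> C1 L; Z \<in> C1 L; trg L X = src L Y; trg L Y = src L Z;
        M \<in> Ob (Mod K (map0 F (src L X)))\<rbrakk> \<Longrightarrow>
        (und2 (map2 F (assoc L Z Y X)) \<lhd> lcar M) \<bullet> s (Z \<cdot>\<^bsub>L\<^esub> Y) X M \<bullet>
          s Z Y (tmod K (map1 F X) M) =
        s Z (Y \<cdot>\<^bsub>L\<^esub> X) M \<bullet> (und1 (map1 F Z) \<rhd> s Y X M)"
    and s_unit: "\<lbrakk>X \<in> C1 L; M \<in> Ob (Mod K (map0 F (src L X)))\<rbrakk> \<Longrightarrow>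
        s (id1 L (trg L X)) X M = id2 K (und1 (map1 F X) \<cdot> lcar M) \<and>
        s X (id1 L (src L X)) M = id2 K (und1 (map1 F X) \<cdot> lcar M)"

definition T_pseudo :: "('o, 'm, 'c) bicat \<Rightarrow> ('p, 'n, 'd) bicat \<Rightarrow>
    ('o, 'm, 'c, 'p, 'n, 'd) to_mnd \<Rightarrow> ('m, 'c, 'n) assoc_family \<Rightarrow>
    ('p, 'n, 'd, (('m, 'c) lmod, ('m, 'c) lmor) cat,
     (('m, 'c) lmod, ('m, 'c) lmor, ('m, 'c) lmod, ('m, 'c) lmor) cfun,
     (('m, 'c) lmod, ('m, 'c) lmor, ('m, 'c) lmod, ('m, 'c) lmor) ntrans) pseudo" where
  "T_pseudo K L F s =
     \<lparr>map0 = (\<lambda>A. Mod K (map0 F A)),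
      map1 = (\<lambda>X. T_fun K (map1 F X)),
      map2 = (\<lambda>\<zeta>. T_nt K (map2 F \<zeta>)),
      pcomp = (\<lambda>Y X.
        \<lparr>ndom = comp_fun (T_fun K (map1 F Y)) (T_fun K (map1 F X)),
         ncod = T_fun K (map1 F (Y \<cdot>\<^bsub>L\<^esub> X)),
         ncmp = (\<lambda>M \<in> Ob (Mod K (map0 F (src L X))). s_mor K L F s Y X M)\<rparr>),
      punit = (\<lambda>A. id_nt (id_fun (Mod K (map0 F A))))\<rparr>"

section \<open>Actions of monoidal categories\<close>

record ('x, 'y) moncat =
  mon_cat :: "('x, 'y) cat"
  tens_ob :: "'x \<Rightarrow> 'x \<Rightarrow> 'x"
  tens_ar :: "'y \<Rightarrow> 'y \<Rightarrow> 'y"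
  tens_unit :: 'x
  mon_assoc :: "'x \<Rightarrow> 'x \<Rightarrow> 'x \<Rightarrow> 'y"
  mon_lunit :: "'x \<Rightarrow> 'y"
  mon_runit :: "'x \<Rightarrow> 'y"

definition tens_fun :: "('x, 'y) moncat \<Rightarrow> ('x \<times> 'x, 'y \<times> 'y, 'x, 'y) cfun" where
  "tens_fun V = \<lparr>fdom = prod_cat (mon_cat V) (mon_cat V), fcod = mon_cat V,
     fob = (\<lambda>(Y, X) \<in> Ob (mon_cat V) \<times> Ob (mon_cat V). tens_ob V Y X),
     far = (\<lambda>(\<xi>, \<zeta>) \<in> Ar (mon_cat V) \<times> Ar (mon_cat V). tens_ar V \<xi> \<zeta>)\<rparr>"

abbreviation homset :: "('o, 'a) cat \<Rightarrow> 'o \<Rightarrow> 'o \<Rightarrow> 'a set" where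
  "homset C a b \<equiv> {f \<in> Ar C. Dom C f = a \<and> Cod C f = b}"

locale monoidal_category =
  fixes V :: "('x, 'y) moncat"
  assumes base_category: "category (mon_cat V)"
    and tensor: "cat_functor (tens_fun V)"
    and tens_unit: "tens_unit V \<in> Ob (mon_cat V)"
    and mon_assoc: "\<lbrakk>X \<in> Ob (mon_cat V); Y \<in> Ob (mon_cat V); Z \<in> Ob (mon_cat V)\<rbrakk> \<Longrightarrow>
        is_iso (mon_cat V) (mon_assoc V Z Y X) \<and>
        mon_assoc V Z Y X \<in>
          homset (mon_cat V) (tens_ob V (tens_ob V Z Y) X) (tens_ob V Z (tens_ob V Y X))"
    and mon_assoc_natural: "\<lbrakk>f \<in> Ar (mon_cat V); g \<in> Ar (mon_cat V); h \<in> Ar (mon_cat V)\<rbrakk> \<Longrightarrow>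
        mon_assoc V (Cod (mon_cat V) h) (Cod (mon_cat V) g) (Cod (mon_cat V) f) \<odot>\<^bsub>mon_cat V\<^esub>
          tens_ar V (tens_ar V h g) f =
        tens_ar V h (tens_ar V g f) \<odot>\<^bsub>mon_cat V\<^esub>
          mon_assoc V (Dom (mon_cat V) h) (Dom (mon_cat V) g) (Dom (mon_cat V) f)"
    and mon_lunit: "X \<in> Ob (mon_cat V) \<Longrightarrow> is_iso (mon_cat V) (mon_lunit V X) \<and>
        mon_lunit V X \<in> homset (mon_cat V) (tens_ob V (tens_unit V) X) X"
    and mon_lunit_natural: "f \<in> Ar (mon_cat V) \<Longrightarrow>
        mon_lunit V (Cod (mon_cat V) f) \<odot>\<^bsub>mon_cat V\<^esub>
          tens_ar V (Id (mon_cat V) (tens_unit V)) f =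
        f \<odot>\<^bsub>mon_cat V\<^esub> mon_lunit V (Dom (mon_cat V) f)"
    and mon_runit: "X \<in> Ob (mon_cat V) \<Longrightarrow> is_iso (mon_cat V) (mon_runit V X) \<and>
        mon_runit V X \<in> homset (mon_cat V) (tens_ob V X (tens_unit V)) X"
    and mon_runit_natural: "f \<in> Ar (mon_cat V) \<Longrightarrow>
        mon_runit V (Cod (mon_cat V) f) \<odot>\<^bsub>mon_cat V\<^esub>
          tens_ar V f (Id (mon_cat V) (tens_unit V)) =
        f \<odot>\<^bsub>mon_cat V\<^esub> mon_runit V (Dom (mon_cat V) f)"
    and mon_pentagon: "\<lbrakk>X \<in> Ob (mon_cat V); Y \<in> Ob (mon_cat V); Z \<in> Ob (mon_cat V);
        W \<in> Ob (mon_cat V)\<rbrakk> \<Longrightarrow>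
        mon_assoc V W Z (tens_ob V Y X) \<odot>\<^bsub>mon_cat V\<^esub> mon_assoc V (tens_ob V W Z) Y X =
        tens_ar V (Id (mon_cat V) W) (mon_assoc V Z Y X) \<odot>\<^bsub>mon_cat V\<^esub>
          mon_assoc V W (tens_ob V Z Y) X \<odot>\<^bsub>mon_cat V\<^esub>
          tens_ar V (mon_assoc V W Z Y) (Id (mon_cat V) X)"
    and mon_triangle: "\<lbrakk>X \<in> Ob (mon_cat V); Y \<in> Ob (mon_cat V)\<rbrakk> \<Longrightarrow>
        tens_ar V (Id (mon_cat V) Y) (mon_lunit V X) \<odot>\<^bsub>mon_cat V\<^esub>
          mon_assoc V Y (tens_unit V) X =
        tens_ar V (mon_runit V Y) (Id (mon_cat V) X)"

definition endo_moncat :: "('o, 'm, 'c) bicat \<Rightarrow> 'o \<Rightarrow> ('m, 'c) moncat" where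
  "endo_moncat L A = \<lparr>mon_cat = hom_cat L A A, tens_ob = comp1 L, tens_ar = hcomp L,
     tens_unit = id1 L A, mon_assoc = assoc L, mon_lunit = lunit L, mon_runit = runit L\<rparr>"

text \<open>\<open>act_assoc\<close> has components \<open>Y(XM) \<rightarrow> (YX)M\<close> and \<open>act_unit\<close> has components \<open>M \<rightarrow> IM\<close>.\<close>

record ('x, 'y, 'o, 'a) action =
  act_fun :: "('x \<times> 'o, 'y \<times> 'a, 'o, 'a) cfun"
  act_assoc :: "'x \<Rightarrow> 'x \<Rightarrow> 'o \<Rightarrow> 'a"
  act_unit :: "'o \<Rightarrow> 'a"

abbreviation act_ob :: "('x, 'y, 'o, 'a) action \<Rightarrow> 'x \<Rightarrow> 'o \<Rightarrow> 'o" where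
  "act_ob a X M \<equiv> fob (act_fun a) (X, M)"

abbreviation act_ar :: "('x, 'y, 'o, 'a) action \<Rightarrow> 'y \<Rightarrow> 'a \<Rightarrow> 'a" where
  "act_ar a \<zeta> f \<equiv> far (act_fun a) (\<zeta>, f)"

locale category_action = monoidal_category V + category D
  for V :: "('x, 'y) moncat" and D :: "('o, 'a) cat" (structure) +
  fixes a :: "('x, 'y, 'o, 'a) action"
  assumes act_fun: "cat_functor (act_fun a)"
      "fdom (act_fun a) = prod_cat (mon_cat V) D" "fcod (act_fun a) = D"
    and act_assoc: "\<lbrakk>X \<in> Ob (mon_cat V); Y \<in> Ob (mon_cat V); M \<in> Ob D\<rbrakk> \<Longrightarrow>
        is_iso D (act_assoc a Y X M) \<and>
        act_assoc a Y X M \<in> homset D (act_ob a Y (act_ob a X M)) (act_ob a (tens_ob V Y X) M)"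
    and act_assoc_natural: "\<lbrakk>\<zeta> \<in> Ar (mon_cat V); \<xi> \<in> Ar (mon_cat V); f \<in> Ar D\<rbrakk> \<Longrightarrow>
        act_assoc a (Cod (mon_cat V) \<xi>) (Cod (mon_cat V) \<zeta>) (Cod D f) \<odot>
          act_ar a \<xi> (act_ar a \<zeta> f) =
        act_ar a (tens_ar V \<xi> \<zeta>) f \<odot>
          act_assoc a (Dom (mon_cat V) \<xi>) (Dom (mon_cat V) \<zeta>) (Dom D f)"
    and act_unit: "M \<in> Ob D \<Longrightarrow> is_iso D (act_unit a M) \<and>
        act_unit a M \<in> homset D M (act_ob a (tens_unit V) M)"
    and act_unit_natural: "f \<in> Ar D \<Longrightarrow>
        act_unit a (Cod D f) \<odot> f =
        act_ar a (Id (mon_cat V) (tens_unit V)) f \<odot> act_unit a (Dom D f)"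
    and act_pentagon: "\<lbrakk>X \<in> Ob (mon_cat V); Y \<in> Ob (mon_cat V); Z \<in> Ob (mon_cat V);
        M \<in> Ob D\<rbrakk> \<Longrightarrow>
        act_ar a (mon_assoc V Z Y X) (Id D M) \<odot> act_assoc a (tens_ob V Z Y) X M \<odot>
          act_assoc a Z Y (act_ob a X M) =
        act_assoc a Z (tens_ob V Y X) M \<odot> act_ar a (Id (mon_cat V) Z) (act_assoc a Y X M)"
    and act_lunit: "\<lbrakk>X \<in> Ob (mon_cat V); M \<in> Ob D\<rbrakk> \<Longrightarrow>
        act_ar a (mon_lunit V X) (Id D M) \<odot> act_assoc a (tens_unit V) X M \<odot>
          act_unit a (act_ob a X M) = Id D (act_ob a X M)"
    and act_runit: "\<lbrakk>X \<in> Ob (mon_cat V); M \<in> Ob D\<rbrakk> \<Longrightarrow>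
        act_ar a (mon_runit V X) (Id D M) \<odot> act_assoc a X (tens_unit V) M \<odot>
          act_ar a (Id (mon_cat V) X) (act_unit a M) = Id D (act_ob a X M)"

text \<open>The action of \<open>L(A, A)\<close> on \<open>map0 G A\<close> given by a pseudofunctor \<open>G : L \<rightarrow> Cat\<close>: \<open>(X, M)\<close> is
  sent to \<open>G\<^sub>X(M)\<close>, and \<open>(\<zeta> : X \<rightarrow> X', f : M \<rightarrow> N)\<close> to \<open>G\<^sub>X(M) \<rightarrow> G\<^sub>X(N) \<rightarrow> G\<^sub>X\<^sub>'(N)\<close>.\<close>

definition induced_action :: "('p, 'n, 'd) bicat \<Rightarrow>
    ('p, 'n, 'd, ('o, 'a) cat, ('o, 'a, 'o, 'a) cfun, ('o, 'a, 'o, 'a) ntrans) pseudo \<Rightarrow>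
    'p \<Rightarrow> ('n, 'd, 'o, 'a) action" where
  "induced_action L G A =
     \<lparr>act_fun =
        \<lparr>fdom = prod_cat (hom_cat L A A) (map0 G A), fcod = map0 G A,
         fob = (\<lambda>(X, M) \<in> Ob (hom_cat L A A) \<times> Ob (map0 G A). fob (map1 G X) M),
         far = (\<lambda>(\<zeta>, f) \<in> Ar (hom_cat L A A) \<times> Ar (map0 G A).
           ncmp (map2 G \<zeta>) (Cod (map0 G A) f) \<odot>\<^bsub>map0 G A\<^esub> far (map1 G (dom2 L \<zeta>)) f)\<rparr>,
      act_assoc = (\<lambda>Y X M. ncmp (pcomp G Y X) M),
      act_unit = (\<lambda>M. ncmp (punit G A) M)\<rparr>"

section \<open>2-cocycles in the Eilenberg-Moore 2-category\<close>

text \<open>A 2-cell \<open>(X, \<psi>) \<rightarrow> (Y, \<psi>')\<close> of \<open>EM\<^sup>M(K)\<close> is carried by a 2-cell \<open>X \<rightarrow> Y B\<close> of \<open>K\<close>, where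
  \<open>B\<close> is the source monad; identities and vertical composition therefore involve the unit and
  the multiplication of \<open>B\<close>.\<close>

definition em_2cell ::
  "('o, 'm, 'c) bicat \<Rightarrow> ('o, 'm, 'c) mnd1 \<Rightarrow> ('o, 'm, 'c) mnd1 \<Rightarrow> 'c \<Rightarrow> bool" where
  "em_2cell K X Y \<zeta> \<longleftrightarrow> (let B = m1src X; B' = m1trg X in
     \<zeta> \<in> cell2 K (und1 X) (und1 Y \<cdot>\<^bsub>K\<^esub> mcar B) \<and>
     (und1 Y \<rhd>\<^bsub>K\<^esub> mmul B) \<bullet>\<^bsub>K\<^esub> (\<zeta> \<lhd>\<^bsub>K\<^esub> mcar B) \<bullet>\<^bsub>K\<^esub> str X =
     (und1 Y \<rhd>\<^bsub>K\<^esub> mmul B) \<bullet>\<^bsub>K\<^esub> (str Y \<lhd>\<^bsub>K\<^esub> mcar B) \<bullet>\<^bsub>K\<^esub> (mcar B' \<rhd>\<^bsub>K\<^esub> \<zeta>))"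

text \<open>The composite of \<open>\<zeta> : W \<rightarrow> X B\<close> and \<open>\<xi> : X \<rightarrow> Y B\<close>, where \<open>Y\<close> is the first argument.\<close>

definition em_comp ::
  "('o, 'm, 'c) bicat \<Rightarrow> ('o, 'm, 'c) mnd1 \<Rightarrow> 'c \<Rightarrow> 'c \<Rightarrow> 'c" where
  "em_comp K Y \<xi> \<zeta> = (und1 Y \<rhd>\<^bsub>K\<^esub> mmul (m1src Y)) \<bullet>\<^bsub>K\<^esub> (\<xi> \<lhd>\<^bsub>K\<^esub> mcar (m1src Y)) \<bullet>\<^bsub>K\<^esub> \<zeta>"

definition em_id :: "('o, 'm, 'c) bicat \<Rightarrow> ('o, 'm, 'c) mnd1 \<Rightarrow> 'c" where
  "em_id K X = und1 X \<rhd>\<^bsub>K\<^esub> mone (m1src X)"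

locale em_cocycle =
  fixes K :: "('o, 'm, 'c) bicat" (structure) and L :: "('p, 'n, 'd) bicat"
    and F :: "('o, 'm, 'c, 'p, 'n, 'd) to_mnd" and A :: 'p and \<rho> :: "'n \<Rightarrow> 'n \<Rightarrow> 'c"
  assumes rho_2cell: "\<lbrakk>X \<in> Ob (hom_cat L A A); Y \<in> Ob (hom_cat L A A)\<rbrakk> \<Longrightarrow>
        em_2cell K (map1 F X \<cdot>\<^bsub>Mnd K\<^esub> map1 F Y) (map1 F X \<cdot>\<^bsub>Mnd K\<^esub> map1 F Y) (\<rho> X Y)"
    and rho_natural: "\<lbrakk>\<zeta> \<in> Ar (hom_cat L A A); \<xi> \<in> Ar (hom_cat L A A)\<rbrakk> \<Longrightarrow>
        \<rho> (cod2 L \<zeta>) (cod2 L \<xi>) \<bullet> (und2 (map2 F \<zeta>) \<star> und2 (map2 F \<xi>)) =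
        ((und2 (map2 F \<zeta>) \<star> und2 (map2 F \<xi>)) \<lhd> mcar (map0 F A)) \<bullet> \<rho> (dom2 L \<zeta>) (dom2 L \<xi>)"
    and rho_cocycle: "\<lbrakk>X \<in> Ob (hom_cat L A A); Y \<in> Ob (hom_cat L A A);
        Z \<in> Ob (hom_cat L A A)\<rbrakk> \<Longrightarrow>
        (und2 (map2 F (assoc L X Y Z)) \<star> mmul (map0 F A)) \<bullet>
          (\<rho> (X \<cdot>\<^bsub>L\<^esub> Y) Z \<lhd> mcar (map0 F A)) \<bullet>
          ((und1 (map1 F X) \<cdot> und1 (map1 F Y)) \<rhd> str (map1 F Z)) \<bullet>
          (\<rho> X Y \<lhd> und1 (map1 F Z)) =
        ((und1 (map1 F X) \<cdot> und1 (map1 F Y) \<cdot> und1 (map1 F Z)) \<rhd> mmul (map0 F A)) \<bullet>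
          (\<rho> X (Y \<cdot>\<^bsub>L\<^esub> Z) \<lhd> mcar (map0 F A)) \<bullet>
          (und1 (map1 F X) \<rhd> \<rho> Y Z)"
    and rho_invertible: "\<lbrakk>X \<in> Ob (hom_cat L A A); Y \<in> Ob (hom_cat L A A)\<rbrakk> \<Longrightarrow>
        \<exists>\<sigma> \<in> cell2 K (und1 (map1 F X) \<cdot> und1 (map1 F Y))
            ((und1 (map1 F X) \<cdot> und1 (map1 F Y)) \<cdot> mcar (map0 F A)).
          em_comp K (map1 F X \<cdot>\<^bsub>Mnd K\<^esub> map1 F Y) \<sigma> (\<rho> X Y) =
            em_id K (map1 F X \<cdot>\<^bsub>Mnd K\<^esub> map1 F Y) \<and>
          em_comp K (map1 F X \<cdot>\<^bsub>Mnd K\<^esub> map1 F Y) (\<rho> X Y) \<sigma> =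
            em_id K (map1 F X \<cdot>\<^bsub>Mnd K\<^esub> map1 F Y)"
    and rho_normalized: "X \<in> Ob (hom_cat L A A) \<Longrightarrow>
        \<rho> X (id1 L A) = em_id K (map1 F X) \<and> \<rho> (id1 L A) X = em_id K (map1 F X)"

definition induced_by_cocycle :: "('o, 'm, 'c) bicat \<Rightarrow> ('p, 'n, 'd) bicat \<Rightarrow>
    ('o, 'm, 'c, 'p, 'n, 'd) to_mnd \<Rightarrow> 'p \<Rightarrow> ('m, 'c, 'n) assoc_family \<Rightarrow>
    ('n \<Rightarrow> 'n \<Rightarrow> 'c) \<Rightarrow> bool" where
  "induced_by_cocycle K L F A s \<rho> \<longleftrightarrow>
     (\<forall>X \<in> Ob (hom_cat L A A). \<forall>Y \<in> Ob (hom_cat L A A). \<forall>M \<in> Ob (Mod K (map0 F A)).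
        s X Y M = ((und1 (map1 F X) \<cdot>\<^bsub>K\<^esub> und1 (map1 F Y)) \<rhd>\<^bsub>K\<^esub> lact M) \<bullet>\<^bsub>K\<^esub> (\<rho> X Y \<lhd>\<^bsub>K\<^esub> lcar M))"

text \<open>The condition
  \<open>s\<^sub>Y\<^sub>,\<^sub>X(M) = (Y \<times> X \<times> \<nu>\<^sub>M)(s\<^sub>Y\<^sub>,\<^sub>X(B) \<times> M)(Y \<times> X \<times> \<eta>\<^sub>B \<times> M)\<close>, with \<open>B\<close> the regular module.\<close>

definition determined_at_regular :: "('o, 'm, 'c) bicat \<Rightarrow> ('p, 'n, 'd) bicat \<Rightarrow>
    ('o, 'm, 'c, 'p, 'n, 'd) to_mnd \<Rightarrow> 'p \<Rightarrow> ('m, 'c, 'n) assoc_family \<Rightarrow> bool" where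
  "determined_at_regular K L F A s \<longleftrightarrow>
     (\<forall>X \<in> Ob (hom_cat L A A). \<forall>Y \<in> Ob (hom_cat L A A). \<forall>M \<in> Ob (Mod K (map0 F A)).
        s Y X M =
          ((und1 (map1 F Y) \<cdot>\<^bsub>K\<^esub> und1 (map1 F X)) \<rhd>\<^bsub>K\<^esub> lact M) \<bullet>\<^bsub>K\<^esub>
          (s Y X (regular_mod (map0 F A)) \<lhd>\<^bsub>K\<^esub> lcar M) \<bullet>\<^bsub>K\<^esub>
          (((und1 (map1 F Y) \<cdot>\<^bsub>K\<^esub> und1 (map1 F X)) \<rhd>\<^bsub>K\<^esub> mone (map0 F A)) \<lhd>\<^bsub>K\<^esub> lcar M))"

end

theory Submission
  imports Defs
begin

text \<open>A 2-cell \<open>\<rho> : W \<rightarrow> P B\<close> of the Eilenberg-Moore 2-category acts on every left \<open>B\<close>-module \<open>M\<close>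
  by \<open>W M \<rightarrow> P B M \<rightarrow> P M\<close>, naturally in \<open>M\<close>, and \<open>\<rho>\<close> is recovered from its action on the regular
  module by precomposing with the unit of \<open>B\<close>. This turns composition of such 2-cells into
  composition of linear maps. A family \<open>s\<close> determined by its values on the regular module is the
  action of a family \<open>\<rho>\<close>, and under this correspondence the coherence conditions on \<open>s\<close> are the
  cocycle conditions on \<open>\<rho>\<close>. The pseudofunctor axioms for \<open>\<T>\<close> are the coherence conditions on
  \<open>s\<close> read componentwise; restricted to a single 0-cell they are the axioms of an action.\<close>

section \<open>Calculus in a strict 2-category\<close>

text \<open>Since K is strict, \<open>tmod\<close> is strictly compatible with composition of
  1-cells: Y(XM) and (YX)M are the same module, and every s_{Y,X}(M) is an automorphism of it that
  need not be the identity. Likewise \<open>F\<close> preserves composites on the nose but not the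
  associativity constraints, so \<open>assoc L Z Y X\<close> becomes an endo-2-cell of ZYX. It need
  not be an identity and has to be carried through both the coherence and the cocycle conditions.
  The equivalence with cocycles concerns an arbitrary family t, and an action constrains t only on
  the endomorphisms of one 0-cell. Instead of a second list of coherence conditions,
  \<open>coherent_assoc_family\<close> is read over the one-object bicategory
  \<open>endo_part L A\<close>, and the pseudofunctor theorem applied there produces the action. The
  delicate point is invertibility. The inverse of s(B) is given as a left linear map, while the
  action of a 2-cell P -> P B on the regular module is also right linear over B; this second
  linearity has to be transported to the inverse before an inverse cocycle can be read off.\<close>

context bicategory
begin

lemma id2_simps [simp]:
  assumes "X \<in> C1 K"
  shows "id2 K X \<in> C2 K" "dom2 K (id2 K X) = X" "cod2 K (id2 K X) = X"
  using category.Id[OF hom_category, of "src K X" "trg K X" X] assms src_trg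
  by (auto simp: hom_cat_def)

lemma dom_cod_simps [simp]:
  assumes "f \<in> C2 K"
  shows "dom2 K f \<in> C1 K" "cod2 K f \<in> C1 K"
    "src K (cod2 K f) = src K (dom2 K f)" "trg K (cod2 K f) = trg K (dom2 K f)"
  using dom_cod[OF assms] by auto

lemma src_trg_simps [simp]:
  assumes "X \<in> C1 K"
  shows "src K X \<in> C0 K" "trg K X \<in> C0 K"
  using src_trg[OF assms] by auto

lemma composable_src_trg:
  assumes "f \<in> C2 K" "g \<in> C2 K" "cod2 K f = dom2 K g"
  shows "src K (dom2 K g) = src K (dom2 K f)" "trg K (dom2 K g) = trg K (dom2 K f)"
  using dom_cod_simps[OF assms(1)] assms(3) by auto

lemma vcomp_simps [simp]:
  assumes "f \<in> C2 K" "g \<in> C2 K" "cod2 K f = dom2 K g"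
  shows "g \<bullet> f \<in> C2 K" "dom2 K (g \<bullet> f) = dom2 K f" "cod2 K (g \<bullet> f) = cod2 K g"
  using category.Cmp[OF hom_category, of "src K (dom2 K f)" "trg K (dom2 K f)" f g]
    assms composable_src_trg[OF assms]
  by (auto simp: hom_cat_def)

lemma vcomp_assoc:
  assumes "f \<in> C2 K" "g \<in> C2 K" "h \<in> C2 K" "cod2 K f = dom2 K g" "cod2 K g = dom2 K h"
  shows "(h \<bullet> g) \<bullet> f = h \<bullet> (g \<bullet> f)"
  using category.Cmp_assoc[OF hom_category, of "src K (dom2 K f)" "trg K (dom2 K f)" f g h]
    assms composable_src_trg[OF assms(1,2,4)] composable_src_trg[OF assms(2,3,5)]
  by (auto simp: hom_cat_def)

lemma vcomp_id2 [simp]: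
  assumes "f \<in> C2 K"
  shows "dom2 K f = X \<Longrightarrow> f \<bullet> id2 K X = f" "cod2 K f = X \<Longrightarrow> id2 K X \<bullet> f = f"
  using category.Cmp_Id[OF hom_category, of "src K (dom2 K f)" "trg K (dom2 K f)" f]
    assms
  by (auto simp: hom_cat_def)

lemma hcomp_simps [simp]:
  assumes "f \<in> C2 K" "g \<in> C2 K" "trg K (dom2 K f) = src K (dom2 K g)"
  shows "g \<star> f \<in> C2 K" "dom2 K (g \<star> f) = dom2 K g \<cdot> dom2 K f"
    "cod2 K (g \<star> f) = cod2 K g \<cdot> cod2 K f"
  using hcomp[OF assms] by (auto simp: cell2_def)

lemma id1_simps [simp]:
  assumes "A \<in> C0 K"
  shows "id1 K A \<in> C1 K" "src K (id1 K A) = A" "trg K (id1 K A) = A"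
  using id1[OF assms] by auto

lemma comp1_simps [simp]:
  assumes "X \<in> C1 K" "Y \<in> C1 K" "trg K X = src K Y"
  shows "Y \<cdot> X \<in> C1 K" "src K (Y \<cdot> X) = src K X" "trg K (Y \<cdot> X) = trg K Y"
  using comp1[OF assms] by auto

lemma lwhisker_vcomp:
  assumes "f \<in> C2 K" "g \<in> C2 K" "cod2 K f = dom2 K g" "X \<in> C1 K" "trg K (dom2 K f) = src K X"
  shows "X \<rhd> (g \<bullet> f) = (X \<rhd> g) \<bullet> (X \<rhd> f)"
  using interchange[of f g "id2 K X" "id2 K X"] assms by simp

lemma rwhisker_vcomp:
  assumes "f \<in> C2 K" "g \<in> C2 K" "cod2 K f = dom2 K g" "X \<in> C1 K" "trg K X = src K (dom2 K f)"
  shows "(g \<bullet> f) \<lhd> X = (g \<lhd> X) \<bullet> (f \<lhd> X)"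
  using interchange[of "id2 K X" "id2 K X" f g] assms by simp

lemma hcomp_rl:
  assumes "f \<in> C2 K" "g \<in> C2 K" "trg K (dom2 K f) = src K (dom2 K g)"
  shows "(g \<lhd> cod2 K f) \<bullet> (dom2 K g \<rhd> f) = g \<star> f"
  using interchange[of f "id2 K (cod2 K f)" "id2 K (dom2 K g)" g] assms by simp

lemma hcomp_lr:
  assumes "f \<in> C2 K" "g \<in> C2 K" "trg K (dom2 K f) = src K (dom2 K g)"
  shows "(cod2 K g \<rhd> f) \<bullet> (g \<lhd> dom2 K f) = g \<star> f"
  using interchange[of "id2 K (dom2 K f)" f g "id2 K (cod2 K g)"] assms by simp

text \<open>Both sides are factorizations of \<open>g \<star> f\<close>. Typical instances take
  \<open>g\<close> to be a structure cell or an Eilenberg-Moore 2-cell and \<open>f\<close> an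
  action, a unit or a linear map; they provide the commuting squares of the diagram chases
  below.\<close>

lemma exchange:
  assumes "f \<in> C2 K" "g \<in> C2 K" "trg K (dom2 K f) = src K (dom2 K g)"
  shows "(cod2 K g \<rhd> f) \<bullet> (g \<lhd> dom2 K f) = (g \<lhd> cod2 K f) \<bullet> (dom2 K g \<rhd> f)"
  using hcomp_rl[OF assms] hcomp_lr[OF assms] by simp

text \<open>Composites are kept bracketed to the right, where two adjacent factors in general do not
  form a subterm. This lemma and \<open>vcomp_cong3\<close> restate an equation between short
  composites with a further cell \<open>f\<close> appended, so that it can rewrite inside longer
  ones.\<close>

lemma vcomp_extend:
  assumes "b \<bullet> c = d" "b \<in> C2 K" "c \<in> C2 K" "f \<in> C2 K" "cod2 K f = dom2 K c" "cod2 K c = dom2 K b"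
  shows "b \<bullet> (c \<bullet> f) = d \<bullet> f"
  using vcomp_assoc[of f c b] assms by simp

lemma vcomp_cong3:
  assumes "a \<bullet> b = c \<bullet> d" "a \<in> C2 K" "b \<in> C2 K" "c \<in> C2 K" "d \<in> C2 K" "f \<in> C2 K"
    "cod2 K f = dom2 K b" "cod2 K b = dom2 K a" "cod2 K f = dom2 K d" "cod2 K d = dom2 K c"
  shows "a \<bullet> (b \<bullet> f) = c \<bullet> (d \<bullet> f)"
  using vcomp_assoc[of f b a] vcomp_assoc[of f d c] assms by simp

end

context two_category
begin

text \<open>The associativity constraint is an identity, so its domain and codomain coincide; these
  are the two bracketings.\<close>

lemma comp1_assoc [simp]:
  assumes "X \<in> C1 K" "Y \<in> C1 K" "Z \<in> C1 K" "trg K X = src K Y" "trg K Y = src K Z"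
  shows "(Z \<cdot> Y) \<cdot> X = Z \<cdot> (Y \<cdot> X)"
  using assoc[OF assms] assoc_strict[OF assms] assms by (auto simp: cell2_def)

lemma comp1_id1 [simp]:
  assumes "X \<in> C1 K"
  shows "trg K X = A \<Longrightarrow> id1 K A \<cdot> X = X" "src K X = A \<Longrightarrow> X \<cdot> id1 K A = X"
  using lunit[OF assms] runit[OF assms] units_strict assms
  by (auto simp: unit_strict_def cell2_def)

text \<open>The naturality square of the associativity constraint loses two of its sides once the
  constraint is an identity.\<close>

lemma hcomp_assoc [simp]:
  assumes "f \<in> C2 K" "g \<in> C2 K" "h \<in> C2 K"
    "trg K (dom2 K f) = src K (dom2 K g)" "trg K (dom2 K g) = src K (dom2 K h)"
  shows "(h \<star> g) \<star> f = h \<star> (g \<star> f)"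
  using assoc_natural[OF assms] assms by (simp add: assoc_strict)

lemma hcomp_id1 [simp]:
  assumes "f \<in> C2 K"
  shows "trg K (dom2 K f) = A \<Longrightarrow> id2 K (id1 K A) \<star> f = f"
    "src K (dom2 K f) = A \<Longrightarrow> f \<star> id2 K (id1 K A) = f"
  using lunit_natural[OF assms] runit_natural[OF assms] units_strict assms
  by (auto simp: unit_strict_def)

declare hcomp_id2 [simp]

text \<open>Bracketing to the right leaves nested left whiskerings apart. Merging them gives a
  normal form in which a 2-cell is whiskered by a single composite 1-cell on each side.\<close>

lemma lwhisker_lwhisker [simp]:
  assumes "X \<in> C1 K" "Y \<in> C1 K" "f \<in> C2 K"
    "trg K X = src K Y" "trg K (dom2 K f) = src K X"
  shows "Y \<rhd> (X \<rhd> f) = (Y \<cdot> X) \<rhd> f"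
  using hcomp_assoc[of f "id2 K X" "id2 K Y"] assms by simp

lemmas norm = vcomp_assoc lwhisker_vcomp rwhisker_vcomp

end

section \<open>Monads and modules\<close>

context monad_in
begin

lemma mnd_simps [simp]:
  "mobj B \<in> C0 K" "mcar B \<in> C1 K" "src K (mcar B) = mobj B" "trg K (mcar B) = mobj B"
  "mmul B \<in> C2 K" "dom2 K (mmul B) = mcar B \<cdot> mcar B" "cod2 K (mmul B) = mcar B"
  "mone B \<in> C2 K" "dom2 K (mone B) = id1 K (mobj B)" "cod2 K (mone B) = mcar B"
  using mobj mcar mmul mone by (auto simp: cell2_def)

end

context left_module
begin

lemma mod_simps [simp]:
  "lcar M \<in> C1 K" "trg K (lcar M) = mobj B"
  "lact M \<in> C2 K" "dom2 K (lact M) = mcar B \<cdot> lcar M" "cod2 K (lact M) = lcar M"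
  using lcar lact by (auto simp: cell2_def)

end

context left_linear
begin

lemma lin_simps [simp]:
  "lund f \<in> C2 K" "dom2 K (lund f) = lcar (ldom f)" "cod2 K (lund f) = lcar (lcod f)"
  using lund by (auto simp: cell2_def)

end

context monad_1cell
begin

lemma cell_simps [simp]:
  "und1 X \<in> C1 K" "src K (und1 X) = mobj (m1src X)" "trg K (und1 X) = mobj (m1trg X)"
  "str X \<in> C2 K" "dom2 K (str X) = mcar (m1trg X) \<cdot> und1 X"
  "cod2 K (str X) = und1 X \<cdot> mcar (m1src X)"
  using und1 str by (auto simp: cell2_def)

end

context monad_2cell
begin

lemma cell_simps [simp]:
  "und2 \<zeta> \<in> C2 K" "dom2 K (und2 \<zeta>) = und1 (m2dom \<zeta>)" "cod2 K (und2 \<zeta>) = und1 (m2cod \<zeta>)"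
  using und2 by (auto simp: cell2_def)

end

lemma tmod_simps [simp]: 
  "lcar (tmod K X M) = und1 X \<cdot>\<^bsub>K\<^esub> lcar M"
  "lact (tmod K X M) = (und1 X \<rhd>\<^bsub>K\<^esub> lact M) \<bullet>\<^bsub>K\<^esub> (str X \<lhd>\<^bsub>K\<^esub> lcar M)"
  by (simp_all add: tmod_def)

context two_category
begin

text \<open>\<open>str_mmul\<close> trades the multiplication of the target monad for that of the
  source monad (1), associativity of \<open>M\<close> turns the latter into a second action (2), and
  that action slides past \<open>str X\<close> (3). The unit law is \<open>str_mone\<close> followed
  by the unit law of \<open>M\<close> (4 and 5).\<close>

lemma tmod_module:
  assumes "monad_1cell K X" "left_module K (m1src X) M"
  shows "left_module K (m1trg X) (tmod K X M)"
proof -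
  interpret X: monad_1cell K X by fact
  interpret B: monad_in K "m1src X" by (rule X.monads)
  interpret B': monad_in K "m1trg X" by (rule X.monads)
  interpret M: left_module K "m1src X" M by fact
  let ?B = "mcar (m1src X)" and ?B' = "mcar (m1trg X)" and ?X = "und1 X" and ?M = "lcar M"
  let ?\<nu> = "lact M" and ?\<psi> = "str X"
  have 1: "(?\<psi> \<lhd> ?M) \<bullet> (mmul (m1trg X) \<lhd> (?X \<cdot> ?M)) =
      (?X \<rhd> (mmul (m1src X) \<lhd> ?M)) \<bullet> (?\<psi> \<lhd> (?B \<cdot> ?M)) \<bullet> (?B' \<rhd> (?\<psi> \<lhd> ?M))"
    using arg_cong[OF X.str_mmul, of "\<lambda>z. z \<lhd> ?M"] by (simp add: norm)
  have 2: "(?X \<rhd> ?\<nu>) \<bullet> (?X \<rhd> (mmul (m1src X) \<lhd> ?M)) = (?X \<rhd> ?\<nu>) \<bullet> ((?X \<cdot> ?B) \<rhd> ?\<nu>)"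
    using arg_cong[OF M.lact_mmul, of "\<lambda>z. ?X \<rhd> z"] by (simp add: norm)
  have 3: "((?X \<cdot> ?B) \<rhd> ?\<nu>) \<bullet> (?\<psi> \<lhd> (?B \<cdot> ?M)) = (?\<psi> \<lhd> ?M) \<bullet> ((?B' \<cdot> ?X) \<rhd> ?\<nu>)"
    using exchange[of ?\<nu> ?\<psi>] by simp
  have 4: "(?\<psi> \<lhd> ?M) \<bullet> (mone (m1trg X) \<lhd> (?X \<cdot> ?M)) = ?X \<rhd> (mone (m1src X) \<lhd> ?M)"
    using arg_cong[OF X.str_mone, of "\<lambda>z. z \<lhd> ?M"] by (simp add: norm)
  have 5: "(?X \<rhd> ?\<nu>) \<bullet> (?X \<rhd> (mone (m1src X) \<lhd> ?M)) = id2 K (?X \<cdot> ?M)"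
    using arg_cong[OF M.lact_mone, of "\<lambda>z. ?X \<rhd> z"] by (simp add: norm)
  show ?thesis
    by unfold_locales
      (simp_all add: cell2_def norm 1 vcomp_cong3[OF 2] vcomp_cong3[OF 3] 4 5)
qed

end

section \<open>The 2-category of categories\<close>

context category
begin

lemma Dom_Cod_in [simp]: "f \<in> Ar C \<Longrightarrow> Dom C f \<in> Ob C" "f \<in> Ar C \<Longrightarrow> Cod C f \<in> Ob C"
  using Dom_Cod by auto

lemma Id_simps [simp]:
  assumes "a \<in> Ob C"
  shows "Id C a \<in> Ar C" "Dom C (Id C a) = a" "Cod C (Id C a) = a"
  using Id[OF assms] by auto

lemma Cmp_simps [simp]:
  assumes "f \<in> Ar C" "g \<in> Ar C" "Cod C f = Dom C g"
  shows "g \<odot> f \<in> Ar C" "Dom C (g \<odot> f) = Dom C f" "Cod C (g \<odot> f) = Cod C g"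
  using Cmp[OF assms] by auto

lemma Cmp_Id_simps [simp]:
  assumes "f \<in> Ar C"
  shows "Dom C f = a \<Longrightarrow> f \<odot> Id C a = f" "Cod C f = a \<Longrightarrow> Id C a \<odot> f = f"
  using Cmp_Id[OF assms] by auto

lemma is_iso_Id: "a \<in> Ob C \<Longrightarrow> is_iso C (Id C a)"
  unfolding is_iso_def by (intro conjI bexI[of _ "Id C a"]) auto

lemma is_isoI:
  assumes "f \<in> Ar C" "g \<in> Ar C" "Dom C g = Cod C f" "Cod C g = Dom C f"
    "g \<odot> f = Id C (Dom C f)" "f \<odot> g = Id C (Cod C f)"
  shows "is_iso C f"
  using assms unfolding is_iso_def by blast

end

text \<open>Functor records carry their categories. Naming these as parameters lets the
  simplification rules speak of \<open>C\<close> and \<open>D\<close>, so that one category reached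
  through several functors is recognized as the same.\<close>

locale functor_between = C: category C + D: category D + cat_functor F
  for C :: "('o, 'a) cat" and D :: "('p, 'b) cat" and F +
  assumes fdom_fcod [simp]: "fdom F = C" "fcod F = D"
begin

lemma fob_in [simp]: "a \<in> Ob C \<Longrightarrow> fob F a \<in> Ob D"
  using fob by auto

lemma far_simps [simp]:
  assumes "f \<in> Ar C"
  shows "far F f \<in> Ar D" "Dom D (far F f) = fob F (Dom C f)" "Cod D (far F f) = fob F (Cod C f)"
  using far far_Dom_Cod[of f] assms by auto

lemma far_Id_Cmp [simp]:
  "a \<in> Ob C \<Longrightarrow> far F (Id C a) = Id D (fob F a)"
  "\<lbrakk>f \<in> Ar C; g \<in> Ar C; Cod C f = Dom C g\<rbrakk> \<Longrightarrow>
     far F (g \<odot>\<^bsub>C\<^esub> f) = far F g \<odot>\<^bsub>D\<^esub> far F f"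
  using far_Id[of a] far_Cmp[of f g] by auto

end

lemma functor_betweenI:
  assumes "cat_functor F" "fdom F = C" "fcod F = D"
  shows "functor_between C D F"
  using assms cat_functor.categories[OF assms(1)]
  by (auto simp: functor_between_def functor_between_axioms_def)

text \<open>Membership in \<open>PiE\<close> fixes all values off the carriers, so agreement on
  objects and arrows leaves no room for a difference.\<close>

lemma cfun_eqI:
  assumes "functor_between C D F" "functor_between C D G"
    "\<And>a. a \<in> Ob C \<Longrightarrow> fob F a = fob G a"
    "\<And>f. f \<in> Ar C \<Longrightarrow> far F f = far G f"
  shows "F = G"
proof (rule cfun.equality)
  interpret F: functor_between C D F by fact
  interpret G: functor_between C D G by fact
  show "fob F = fob G"
    by (rule PiE_ext[OF F.fob]) (use G.fob assms(3) in auto)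
  show "far F = far G"
    by (rule PiE_ext[OF F.far]) (use G.far assms(4) in auto)
  show "fdom F = fdom G" "fcod F = fcod G" by simp_all
qed simp

lemma id_fun_simps [simp]:
  "fdom (id_fun C) = C" "fcod (id_fun C) = C"
  "a \<in> Ob C \<Longrightarrow> fob (id_fun C) a = a" "f \<in> Ar C \<Longrightarrow> far (id_fun C) f = f"
  by (auto simp: id_fun_def)

lemma comp_fun_simps [simp]:
  "fdom (comp_fun G F) = fdom F" "fcod (comp_fun G F) = fcod G"
  "a \<in> Ob (fdom F) \<Longrightarrow> fob (comp_fun G F) a = fob G (fob F a)"
  "f \<in> Ar (fdom F) \<Longrightarrow> far (comp_fun G F) f = far G (far F f)"
  by (auto simp: comp_fun_def)

lemma id_functor: "category C \<Longrightarrow> functor_between C C (id_fun C)"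
proof -
  assume "category C"
  then interpret category C .
  show ?thesis
    by unfold_locales (auto simp: id_fun_def Cmp_assoc)
qed

lemma comp_functor:
  assumes "functor_between C D F" "functor_between D E G"
  shows "functor_between C E (comp_fun G F)"
proof -
  interpret F: functor_between C D F by fact
  interpret G: functor_between D E G by fact
  show ?thesis
  proof (rule functor_betweenI)
    show "cat_functor (comp_fun G F)"
    proof (rule cat_functor.intro)
      show "category (fdom (comp_fun G F))" "category (fcod (comp_fun G F))"
        by (simp_all add: F.C.category_axioms G.D.category_axioms)
    qed (auto simp: comp_fun_def)
  qed simp_all
qed

lemma comp_fun_assoc:
  assumes "functor_between A B F" "functor_between B C G" "functor_between C D H"
  shows "comp_fun (comp_fun H G) F = comp_fun H (comp_fun G F)"
proof -
  interpret F: functor_between A B F by fact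
  interpret G: functor_between B C G by fact
  show ?thesis
    by (rule cfun_eqI[of A D]) (auto intro: comp_functor assms)
qed

lemma comp_fun_id:
  assumes "functor_between C D F"
  shows "comp_fun F (id_fun C) = F" "comp_fun (id_fun D) F = F"
proof -
  interpret functor_between C D F by fact
  show "comp_fun F (id_fun C) = F" "comp_fun (id_fun D) F = F"
    by (rule cfun_eqI[of C D];
        auto intro: comp_functor assms id_functor C.category_axioms D.category_axioms)+
qed

section \<open>Natural transformations and their compositions\<close>

locale nat_between = F: functor_between C D F + G: functor_between C D G + nat_trans \<theta>
  for C :: "('o, 'a) cat" and D :: "('p, 'b) cat" and F G \<theta> +
  assumes ndom_ncod [simp]: "ndom \<theta> = F" "ncod \<theta> = G"
begin

lemma ncmp_simps [simp]:
  assumes "a \<in> Ob C"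
  shows "ncmp \<theta> a \<in> Ar D" "Dom D (ncmp \<theta> a) = fob F a" "Cod D (ncmp \<theta> a) = fob G a"
  using ncmp ncmp_Dom_Cod[of a] assms by auto

lemma natural:
  assumes "f \<in> Ar C" "Dom C f = a" "Cod C f = b"
  shows "far G f \<odot>\<^bsub>D\<^esub> ncmp \<theta> a = ncmp \<theta> b \<odot>\<^bsub>D\<^esub> far F f"
  using naturality[of f] assms by auto

end

lemma nat_betweenI:
  assumes "nat_trans \<theta>" "ndom \<theta> = F" "ncod \<theta> = G" "fdom F = C" "fcod F = D"
  shows "nat_between C D F G \<theta>"
  using assms nat_trans.functors[OF assms(1)] nat_trans.parallel[OF assms(1)]
  by (auto simp: nat_between_def nat_between_axioms_def intro: functor_betweenI)

lemma nat_between_intro: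
  assumes "functor_between C D F" "functor_between C D G" "ndom \<theta> = F" "ncod \<theta> = G"
    and "\<And>a. a \<notin> Ob C \<Longrightarrow> ncmp \<theta> a = undefined"
    and "\<And>a. a \<in> Ob C \<Longrightarrow> ncmp \<theta> a \<in> homset D (fob F a) (fob G a)"
    and "\<And>f. f \<in> Ar C \<Longrightarrow>
      far G f \<odot>\<^bsub>D\<^esub> ncmp \<theta> (Dom C f) = ncmp \<theta> (Cod C f) \<odot>\<^bsub>D\<^esub> far F f"
  shows "nat_between C D F G \<theta>"
proof -
  interpret F: functor_between C D F by fact
  interpret G: functor_between C D G by fact
  have ncmp: "ncmp \<theta> \<in> Ob C \<rightarrow>\<^sub>E Ar D"
    using assms(5,6) by (auto intro!: PiE_I)
  have "nat_trans \<theta>"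
    by (rule nat_trans.intro)
      (use assms(6,7) in \<open>simp_all add: assms(3,4) F.cat_functor_axioms G.cat_functor_axioms ncmp\<close>)
  then show ?thesis
    by (rule nat_betweenI) (simp_all add: assms)
qed

lemma ntrans_eqI:
  assumes "nat_between C D F G \<theta>" "nat_between C D F G \<phi>"
    "\<And>a. a \<in> Ob C \<Longrightarrow> ncmp \<theta> a = ncmp \<phi> a"
  shows "\<theta> = \<phi>"
proof (rule ntrans.equality)
  interpret \<theta>: nat_between C D F G \<theta> by fact
  interpret \<phi>: nat_between C D F G \<phi> by fact
  show "ncmp \<theta> = ncmp \<phi>"
    by (rule PiE_ext[OF \<theta>.ncmp]) (use \<phi>.ncmp assms(3) in auto)
  show "ndom \<theta> = ndom \<phi>" "ncod \<theta> = ncod \<phi>" by simp_all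
qed simp

lemma id_nt_simps [simp]:
  "ndom (id_nt F) = F" "ncod (id_nt F) = F"
  "a \<in> Ob (fdom F) \<Longrightarrow> ncmp (id_nt F) a = Id (fcod F) (fob F a)"
  by (auto simp: id_nt_def)

lemma vcomp_nt_simps [simp]:
  "ndom (vcomp_nt \<phi> \<theta>) = ndom \<theta>" "ncod (vcomp_nt \<phi> \<theta>) = ncod \<phi>"
  "a \<in> Ob (fdom (ndom \<theta>)) \<Longrightarrow> ncmp (vcomp_nt \<phi> \<theta>) a = ncmp \<phi> a \<odot>\<^bsub>fcod (ndom \<theta>)\<^esub> ncmp \<theta> a"
  by (auto simp: vcomp_nt_def)

lemma hcomp_nt_simps [simp]:
  "ndom (hcomp_nt \<phi> \<theta>) = comp_fun (ndom \<phi>) (ndom \<theta>)"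
  "ncod (hcomp_nt \<phi> \<theta>) = comp_fun (ncod \<phi>) (ncod \<theta>)"
  "a \<in> Ob (fdom (ndom \<theta>)) \<Longrightarrow> ncmp (hcomp_nt \<phi> \<theta>) a =
     ncmp \<phi> (fob (ncod \<theta>) a) \<odot>\<^bsub>fcod (ndom \<phi>)\<^esub> far (ndom \<phi>) (ncmp \<theta> a)"
  by (auto simp: hcomp_nt_def)

lemma nat_between_id:
  assumes "functor_between C D F"
  shows "nat_between C D F F (id_nt F)"
proof -
  interpret functor_between C D F by fact
  show ?thesis by (rule nat_between_intro) (auto simp: assms, simp add: id_nt_def)
qed

lemma nat_between_vcomp:
  assumes "nat_between C D F G \<theta>" "nat_between C D G H \<phi>"
  shows "nat_between C D F H (vcomp_nt \<phi> \<theta>)"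
proof -
  interpret \<theta>: nat_between C D F G \<theta> by fact
  interpret \<phi>: nat_between C D G H \<phi> by fact
  show ?thesis
  proof (rule nat_between_intro)
    fix f assume f: "f \<in> Ar C"
    have "far H f \<odot>\<^bsub>D\<^esub> (ncmp \<phi> (Dom C f) \<odot>\<^bsub>D\<^esub> ncmp \<theta> (Dom C f)) =
        (ncmp \<phi> (Cod C f) \<odot>\<^bsub>D\<^esub> far G f) \<odot>\<^bsub>D\<^esub> ncmp \<theta> (Dom C f)"
      using f by (simp flip: \<theta>.F.D.Cmp_assoc add: \<phi>.natural[OF f])
    also have "\<dots> = (ncmp \<phi> (Cod C f) \<odot>\<^bsub>D\<^esub> ncmp \<theta> (Cod C f)) \<odot>\<^bsub>D\<^esub> far F f"
      using f by (simp add: \<theta>.F.D.Cmp_assoc \<theta>.natural[OF f])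
    finally show "far H f \<odot>\<^bsub>D\<^esub> ncmp (vcomp_nt \<phi> \<theta>) (Dom C f) =
        ncmp (vcomp_nt \<phi> \<theta>) (Cod C f) \<odot>\<^bsub>D\<^esub> far F f"
      using f by simp
  qed (auto simp: vcomp_nt_def intro: \<theta>.F.functor_between_axioms \<phi>.G.functor_between_axioms)
qed

lemma nat_between_hcomp:
  assumes "nat_between B C F F' \<theta>" "nat_between C D G G' \<phi>"
  shows "nat_between B D (comp_fun G F) (comp_fun G' F') (hcomp_nt \<phi> \<theta>)"
proof -
  interpret \<theta>: nat_between B C F F' \<theta> by fact
  interpret \<phi>: nat_between C D G G' \<phi> by fact
  note funs = \<theta>.F.functor_between_axioms \<phi>.G.functor_between_axioms
    \<phi>.F.functor_between_axioms \<theta>.G.functor_between_axioms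
  show ?thesis
  proof (rule nat_between_intro)
    fix f assume f: "f \<in> Ar B"
    let ?a = "Dom B f" and ?b = "Cod B f"
    have "far G' (far F' f) \<odot>\<^bsub>D\<^esub> (ncmp \<phi> (fob F' ?a) \<odot>\<^bsub>D\<^esub> far G (ncmp \<theta> ?a)) =
        (ncmp \<phi> (fob F' ?b) \<odot>\<^bsub>D\<^esub> far G (far F' f)) \<odot>\<^bsub>D\<^esub> far G (ncmp \<theta> ?a)"
      using f by (simp flip: \<phi>.F.D.Cmp_assoc add: \<phi>.natural[of "far F' f"])
    also have "\<dots> = ncmp \<phi> (fob F' ?b) \<odot>\<^bsub>D\<^esub> far G (far F' f \<odot>\<^bsub>C\<^esub> ncmp \<theta> ?a)"
      using f by (simp add: \<phi>.F.D.Cmp_assoc)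
    also have "\<dots> = (ncmp \<phi> (fob F' ?b) \<odot>\<^bsub>D\<^esub> far G (ncmp \<theta> ?b)) \<odot>\<^bsub>D\<^esub> far G (far F f)"
      using f by (simp add: \<phi>.F.D.Cmp_assoc \<theta>.natural[OF f])
    finally show "far (comp_fun G' F') f \<odot>\<^bsub>D\<^esub> ncmp (hcomp_nt \<phi> \<theta>) ?a =
        ncmp (hcomp_nt \<phi> \<theta>) ?b \<odot>\<^bsub>D\<^esub> far (comp_fun G F) f"
      using f by simp
  qed (auto simp: funs intro: comp_functor funs, simp add: hcomp_nt_def)
qed

lemma Cat_simps [simp]:
  "C0 Cat = {C. category C}" "C1 Cat = {F. cat_functor F}" "C2 Cat = {\<theta>. nat_trans \<theta>}"
  "src Cat = fdom" "trg Cat = fcod" "dom2 Cat = ndom" "cod2 Cat = ncod"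
  "id1 Cat = id_fun" "comp1 Cat = comp_fun" "id2 Cat = id_nt" "vcomp Cat = vcomp_nt"
  "hcomp Cat = hcomp_nt" "assoc Cat H G F = id_nt (comp_fun H (comp_fun G F))"
  "lunit Cat = id_nt" "runit Cat = id_nt"
  by (simp_all add: Cat_def)

lemma hom_Cat_Ar:
  "\<theta> \<in> Ar (hom_cat Cat A B) \<Longrightarrow> nat_between A B (ndom \<theta>) (ncod \<theta>) \<theta>"
  by (auto simp: hom_cat_def intro: nat_betweenI)

lemma hom_cat_simps [simp]:
  "Ob (hom_cat K A B) = {X \<in> C1 K. src K X = A \<and> trg K X = B}"
  "Ar (hom_cat K A B) = {\<zeta> \<in> C2 K. src K (dom2 K \<zeta>) = A \<and> trg K (dom2 K \<zeta>) = B}"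
  "Dom (hom_cat K A B) = dom2 K" "Cod (hom_cat K A B) = cod2 K" "Id (hom_cat K A B) = id2 K"
  "Cmp (hom_cat K A B) = vcomp K"
  by (simp_all add: hom_cat_def)

lemma nat_betweenD:
  assumes "nat_between C D F G \<theta>"
  shows "nat_trans \<theta>" "ndom \<theta> = F" "ncod \<theta> = G" "fdom F = C" "fcod F = D"
    "cat_functor F" "cat_functor G" "fdom G = C" "fcod G = D"
    "functor_between C D F" "functor_between C D G"
proof -
  interpret nat_between C D F G \<theta> by fact
  show "nat_trans \<theta>" "ndom \<theta> = F" "ncod \<theta> = G" "fdom F = C" "fcod F = D"
    "cat_functor F" "cat_functor G" "fdom G = C" "fcod G = D"
    "functor_between C D F" "functor_between C D G"
    by (simp_all add: nat_trans_axioms F.cat_functor_axioms G.cat_functor_axioms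
      F.functor_between_axioms G.functor_between_axioms)
qed

lemma functor_betweenD:
  assumes "functor_between C D F"
  shows "cat_functor F" "fdom F = C" "fcod F = D" "category C" "category D"
proof -
  interpret functor_between C D F by fact
  show "cat_functor F" "fdom F = C" "fcod F = D" "category C" "category D"
    by (simp_all add: cat_functor_axioms C.category_axioms D.category_axioms)
qed

lemma vcomp_nt_id:
  assumes "nat_between C D F G \<theta>"
  shows "vcomp_nt \<theta> (id_nt F) = \<theta>" "vcomp_nt (id_nt G) \<theta> = \<theta>"
proof -
  interpret nat_between C D F G \<theta> by fact
  note ids = nat_between_id[OF F.functor_between_axioms] nat_between_id[OF G.functor_between_axioms]
  show "vcomp_nt \<theta> (id_nt F) = \<theta>" "vcomp_nt (id_nt G) \<theta> = \<theta>"
    by (rule ntrans_eqI[of C D F G]; auto intro: nat_between_vcomp ids nat_between_axioms)+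
qed

lemma vcomp_nt_assoc:
  assumes "nat_between C D F G \<theta>" "nat_between C D G H \<phi>" "nat_between C D H J \<chi>"
  shows "vcomp_nt (vcomp_nt \<chi> \<phi>) \<theta> = vcomp_nt \<chi> (vcomp_nt \<phi> \<theta>)"
proof -
  interpret \<theta>: nat_between C D F G \<theta> by fact
  interpret \<phi>: nat_between C D G H \<phi> by fact
  interpret \<chi>: nat_between C D H J \<chi> by fact
  show ?thesis
    by (rule ntrans_eqI[of C D F J])
      (auto intro: nat_between_vcomp assms simp: \<theta>.F.D.Cmp_assoc)
qed

lemma hcomp_nt_id:
  assumes "functor_between C D F" "functor_between D E G"
  shows "hcomp_nt (id_nt G) (id_nt F) = id_nt (comp_fun G F)"
proof -
  interpret F: functor_between C D F by fact
  interpret G: functor_between D E G by fact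
  show ?thesis
    by (rule ntrans_eqI[of C E "comp_fun G F" "comp_fun G F"])
      (auto intro!: nat_between_hcomp nat_between_id comp_functor assms)
qed

text \<open>Both sides are first placed between the same functors by \<open>comp_fun_assoc\<close>.
  Their components then agree by functoriality of \<open>H\<close> and associativity in
  \<open>D\<close>.\<close>

lemma hcomp_nt_assoc:
  assumes "nat_between A B F F' \<theta>" "nat_between B C G G' \<phi>" "nat_between C D H H' \<chi>"
  shows "hcomp_nt (hcomp_nt \<chi> \<phi>) \<theta> = hcomp_nt \<chi> (hcomp_nt \<phi> \<theta>)"
proof -
  interpret \<theta>: nat_between A B F F' \<theta> by fact
  interpret \<phi>: nat_between B C G G' \<phi> by fact
  interpret \<chi>: nat_between C D H H' \<chi> by fact
  note funs = comp_fun_assoc[OF \<theta>.F.functor_between_axioms \<phi>.F.functor_between_axioms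
      \<chi>.F.functor_between_axioms] comp_fun_assoc[OF \<theta>.G.functor_between_axioms
      \<phi>.G.functor_between_axioms \<chi>.G.functor_between_axioms]
  show ?thesis
  proof (rule ntrans_eqI[of A D "comp_fun H (comp_fun G F)" "comp_fun H' (comp_fun G' F')"])
    show "nat_between A D (comp_fun H (comp_fun G F)) (comp_fun H' (comp_fun G' F'))
        (hcomp_nt (hcomp_nt \<chi> \<phi>) \<theta>)"
      using nat_between_hcomp[OF assms(1) nat_between_hcomp[OF assms(2,3)]] by (simp only: funs)
    show "nat_between A D (comp_fun H (comp_fun G F)) (comp_fun H' (comp_fun G' F'))
        (hcomp_nt \<chi> (hcomp_nt \<phi> \<theta>))"
      by (rule nat_between_hcomp[OF nat_between_hcomp[OF assms(1,2)] assms(3)])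
  qed (auto simp: \<chi>.F.D.Cmp_assoc)
qed

lemma hcomp_nt_unit:
  assumes "nat_between C D F G \<theta>"
  shows "hcomp_nt (id_nt (id_fun D)) \<theta> = \<theta>" "hcomp_nt \<theta> (id_nt (id_fun C)) = \<theta>"
proof -
  interpret nat_between C D F G \<theta> by fact
  note ids = nat_between_id[OF id_functor[OF F.C.category_axioms]]
    nat_between_id[OF id_functor[OF F.D.category_axioms]]
  note funs = comp_fun_id[OF F.functor_between_axioms] comp_fun_id[OF G.functor_between_axioms]
  note hcomps = nat_between_hcomp[OF nat_between_axioms ids(2)]
    nat_between_hcomp[OF ids(1) nat_between_axioms]
  have "nat_between C D F G (hcomp_nt (id_nt (id_fun D)) \<theta>)"
    "nat_between C D F G (hcomp_nt \<theta> (id_nt (id_fun C)))"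
    using hcomps by (simp_all only: funs)
  then show "hcomp_nt (id_nt (id_fun D)) \<theta> = \<theta>" "hcomp_nt \<theta> (id_nt (id_fun C)) = \<theta>"
    using ntrans_eqI[OF _ nat_between_axioms] by simp_all
qed

text \<open>On components this is naturality of \<open>\<phi>\<close> at the arrow
  \<open>ncmp \<theta>' a\<close>.\<close>

lemma nt_interchange:
  assumes "nat_between B C F F' \<theta>" "nat_between B C F' F'' \<theta>'"
    "nat_between C D G G' \<phi>" "nat_between C D G' G'' \<phi>'"
  shows "hcomp_nt (vcomp_nt \<phi>' \<phi>) (vcomp_nt \<theta>' \<theta>) = vcomp_nt (hcomp_nt \<phi>' \<theta>') (hcomp_nt \<phi> \<theta>)"
proof -
  interpret \<theta>: nat_between B C F F' \<theta> by fact
  interpret \<theta>': nat_between B C F' F'' \<theta>' by fact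
  interpret \<phi>: nat_between C D G G' \<phi> by fact
  interpret \<phi>': nat_between C D G' G'' \<phi>' by fact
  show ?thesis
  proof (rule ntrans_eqI[of B D "comp_fun G F" "comp_fun G'' F''"])
    show "nat_between B D (comp_fun G F) (comp_fun G'' F'')
        (hcomp_nt (vcomp_nt \<phi>' \<phi>) (vcomp_nt \<theta>' \<theta>))"
      by (rule nat_between_hcomp[OF nat_between_vcomp[OF assms(1,2)] nat_between_vcomp[OF assms(3,4)]])
    show "nat_between B D (comp_fun G F) (comp_fun G'' F'')
        (vcomp_nt (hcomp_nt \<phi>' \<theta>') (hcomp_nt \<phi> \<theta>))"
      by (rule nat_between_vcomp[OF nat_between_hcomp[OF assms(1,3)] nat_between_hcomp[OF assms(2,4)]])
    fix a assume a: "a \<in> Ob B"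
    have "(ncmp \<phi>' (fob F'' a) \<odot>\<^bsub>D\<^esub> ncmp \<phi> (fob F'' a)) \<odot>\<^bsub>D\<^esub> (far G (ncmp \<theta>' a) \<odot>\<^bsub>D\<^esub> far G (ncmp \<theta> a)) =
        ncmp \<phi>' (fob F'' a) \<odot>\<^bsub>D\<^esub> (ncmp \<phi> (fob F'' a) \<odot>\<^bsub>D\<^esub> far G (ncmp \<theta>' a)) \<odot>\<^bsub>D\<^esub> far G (ncmp \<theta> a)"
      using a by (simp add: \<phi>.F.D.Cmp_assoc)
    also have "\<dots> = ncmp \<phi>' (fob F'' a) \<odot>\<^bsub>D\<^esub>
        (far G' (ncmp \<theta>' a) \<odot>\<^bsub>D\<^esub> ncmp \<phi> (fob F' a)) \<odot>\<^bsub>D\<^esub> far G (ncmp \<theta> a)"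
      using a by (simp add: \<phi>.natural[of "ncmp \<theta>' a"])
    finally show "ncmp (hcomp_nt (vcomp_nt \<phi>' \<phi>) (vcomp_nt \<theta>' \<theta>)) a =
        ncmp (vcomp_nt (hcomp_nt \<phi>' \<theta>') (hcomp_nt \<phi> \<theta>)) a"
      using a by (simp add: \<phi>.F.D.Cmp_assoc)
  qed
qed

section \<open>\<open>Cat\<close> as a bicategory, and its invertible 2-cells\<close>

lemma category_hom_Cat:
  assumes "category A" "category B"
  shows "category (hom_cat Cat A B)"
proof
  fix f g h assume "f \<in> Ar (hom_cat Cat A B)" "g \<in> Ar (hom_cat Cat A B)" "h \<in> Ar (hom_cat Cat A B)"
    "Cod (hom_cat Cat A B) f = Dom (hom_cat Cat A B) g"
    "Cod (hom_cat Cat A B) g = Dom (hom_cat Cat A B) h"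
  then show "(h \<odot>\<^bsub>hom_cat Cat A B\<^esub> g) \<odot>\<^bsub>hom_cat Cat A B\<^esub> f =
      h \<odot>\<^bsub>hom_cat Cat A B\<^esub> (g \<odot>\<^bsub>hom_cat Cat A B\<^esub> f)"
    using vcomp_nt_assoc[of A B "ndom f" "ncod f" f "ncod g" g "ncod h" h]
      hom_Cat_Ar[of f A B] hom_Cat_Ar[of g A B] hom_Cat_Ar[of h A B]
    by (simp del: hom_cat_simps(2))
next
  fix f g assume "f \<in> Ar (hom_cat Cat A B)" "g \<in> Ar (hom_cat Cat A B)"
    "Cod (hom_cat Cat A B) f = Dom (hom_cat Cat A B) g"
  then show "g \<odot>\<^bsub>hom_cat Cat A B\<^esub> f \<in> Ar (hom_cat Cat A B) \<and>
      Dom (hom_cat Cat A B) (g \<odot>\<^bsub>hom_cat Cat A B\<^esub> f) = Dom (hom_cat Cat A B) f \<and>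
      Cod (hom_cat Cat A B) (g \<odot>\<^bsub>hom_cat Cat A B\<^esub> f) = Cod (hom_cat Cat A B) g"
    using nat_between_vcomp[of A B "ndom f" "ncod f" f "ncod g" g] hom_Cat_Ar[of f A B] hom_Cat_Ar[of g A B]
    by (auto dest: nat_betweenD)
next
  fix f assume "f \<in> Ar (hom_cat Cat A B)"
  note f = hom_Cat_Ar[OF this]
  show "Dom (hom_cat Cat A B) f \<in> Ob (hom_cat Cat A B) \<and> Cod (hom_cat Cat A B) f \<in> Ob (hom_cat Cat A B)"
    using nat_betweenD[OF f] by simp
  show "f \<odot>\<^bsub>hom_cat Cat A B\<^esub> Id (hom_cat Cat A B) (Dom (hom_cat Cat A B) f) = f \<and>
      Id (hom_cat Cat A B) (Cod (hom_cat Cat A B) f) \<odot>\<^bsub>hom_cat Cat A B\<^esub> f = f"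
    using vcomp_nt_id[OF f] by simp
next
  fix F assume "F \<in> Ob (hom_cat Cat A B)"
  then have "nat_between A B F F (id_nt F)"
    by (auto intro: nat_between_id functor_betweenI)
  then show "Id (hom_cat Cat A B) F \<in> Ar (hom_cat Cat A B) \<and>
      Dom (hom_cat Cat A B) (Id (hom_cat Cat A B) F) = F \<and>
      Cod (hom_cat Cat A B) (Id (hom_cat Cat A B) F) = F"
    by (auto dest: nat_betweenD)
qed

lemma iso2_Cat_id:
  assumes "functor_between A B F"
  shows "iso2 Cat (id_nt F)"
  using category.is_iso_Id[OF category_hom_Cat, of A B F] functor_betweenD[OF assms]
  by (simp add: iso2_def)

text \<open>Inverses chosen one object at a time are automatically natural, because the naturality
  square of \<open>\<theta>\<close> can be conjugated by them. Restricting the choice to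
  \<open>Ob C\<close> makes it a legitimate component function.\<close>

lemma iso2_CatI:
  assumes "nat_between C D F G \<theta>" "\<And>a. a \<in> Ob C \<Longrightarrow> is_iso D (ncmp \<theta> a)"
  shows "iso2 Cat \<theta>"
proof -
  interpret nat_between C D F G \<theta> by fact
  have "\<forall>a. \<exists>g. a \<in> Ob C \<longrightarrow> g \<in> homset D (fob G a) (fob F a) \<and>
      g \<odot>\<^bsub>D\<^esub> ncmp \<theta> a = Id D (fob F a) \<and> ncmp \<theta> a \<odot>\<^bsub>D\<^esub> g = Id D (fob G a)"
    using assms(2) unfolding is_iso_def by (simp, metis ncmp_simps)
  then obtain t where t: "\<And>a. a \<in> Ob C \<Longrightarrow> t a \<in> Ar D" "\<And>a. a \<in> Ob C \<Longrightarrow> Dom D (t a) = fob G a"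
    "\<And>a. a \<in> Ob C \<Longrightarrow> Cod D (t a) = fob F a"
    "\<And>a. a \<in> Ob C \<Longrightarrow> t a \<odot>\<^bsub>D\<^esub> ncmp \<theta> a = Id D (fob F a)"
    "\<And>a. a \<in> Ob C \<Longrightarrow> ncmp \<theta> a \<odot>\<^bsub>D\<^esub> t a = Id D (fob G a)"
    by simp metis
  let ?\<phi> = "\<lparr>ndom = G, ncod = F, ncmp = (\<lambda>a \<in> Ob C. t a)\<rparr>"
  have \<phi>: "nat_between C D G F ?\<phi>"
  proof (rule nat_between_intro)
    fix f assume f: "f \<in> Ar C"
    let ?a = "Dom C f" and ?b = "Cod C f"
    have "far F f \<odot>\<^bsub>D\<^esub> t ?a = (t ?b \<odot>\<^bsub>D\<^esub> ncmp \<theta> ?b) \<odot>\<^bsub>D\<^esub> far F f \<odot>\<^bsub>D\<^esub> t ?a"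
      using f by (simp add: t)
    also have "\<dots> = t ?b \<odot>\<^bsub>D\<^esub> (ncmp \<theta> ?b \<odot>\<^bsub>D\<^esub> far F f) \<odot>\<^bsub>D\<^esub> t ?a"
      using f by (simp add: t(1-3) F.D.Cmp_assoc)
    also have "\<dots> = t ?b \<odot>\<^bsub>D\<^esub> far G f \<odot>\<^bsub>D\<^esub> ncmp \<theta> ?a \<odot>\<^bsub>D\<^esub> t ?a"
      using f by (simp add: t(1-3) F.D.Cmp_assoc flip: natural[OF f])
    also have "\<dots> = t ?b \<odot>\<^bsub>D\<^esub> far G f"
      using f by (simp add: t)
    finally show "far F f \<odot>\<^bsub>D\<^esub> ncmp ?\<phi> ?a = ncmp ?\<phi> ?b \<odot>\<^bsub>D\<^esub> far G f"
      using f by simp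
  qed (auto simp: t intro: F.functor_between_axioms G.functor_between_axioms)
  have "vcomp_nt ?\<phi> \<theta> = id_nt F" "vcomp_nt \<theta> ?\<phi> = id_nt G"
    using ntrans_eqI[OF nat_between_vcomp[OF nat_between_axioms \<phi>]
        nat_between_id[OF F.functor_between_axioms]]
      ntrans_eqI[OF nat_between_vcomp[OF \<phi> nat_between_axioms]
        nat_between_id[OF G.functor_between_axioms]]
    by (simp_all add: t)
  then show ?thesis
    using nat_betweenD[OF \<phi>] nat_betweenD[OF nat_between_axioms]
    by (auto simp: iso2_def is_iso_def intro!: exI[of _ ?\<phi>])
qed

text \<open>The constraints are identity transformations, so the naturality and coherence axioms
  come down to the strict associativity and unit laws of functors and transformations.\<close>

lemma bicategory_Cat: "bicategory Cat"
proof (rule bicategory.intro, goal_cases)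
  case (1 X) then show ?case by (auto simp: cat_functor.categories)
next
  case (2 \<zeta>) then show ?case by (auto simp: nat_trans.functors nat_trans.parallel)
next
  case (3 A B) then show ?case using category_hom_Cat by simp
next
  case (4 A) then show ?case using functor_betweenD[OF id_functor] by auto
next
  case (5 X Y) then show ?case
    using functor_betweenD[OF comp_functor[of "fdom X" "fcod X" X "fcod Y" Y]]
    by (auto intro: functor_betweenI)
next
  case (6 \<zeta> \<xi>)
  then have "nat_between (fdom (ndom \<zeta>)) (fcod (ndom \<zeta>)) (ndom \<zeta>) (ncod \<zeta>) \<zeta>"
    "nat_between (fcod (ndom \<zeta>)) (fcod (ndom \<xi>)) (ndom \<xi>) (ncod \<xi>) \<xi>"
    by (auto intro: nat_betweenI)
  from nat_betweenD[OF nat_between_hcomp[OF this]] show ?case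
    by (simp add: cell2_def)
next
  case (7 X Y)
  then show ?case using hcomp_nt_id[of "fdom X" "fcod X" X "fcod Y" Y]
    by (auto intro: functor_betweenI)
next
  case (8 \<zeta> \<zeta>' \<xi> \<xi>')
  let ?A = "fdom (ndom \<zeta>)" and ?B = "fcod (ndom \<zeta>)" and ?C = "fcod (ndom \<xi>)"
  have "nat_between ?A ?B (ndom \<zeta>) (ncod \<zeta>) \<zeta>" "nat_between ?B ?C (ndom \<xi>) (ncod \<xi>) \<xi>"
    using 8 by (auto intro: nat_betweenI)
  \<comment> \<open>The second transformation of each pair starts where the first ends, and the
    functor at that place has the same source and target categories.\<close>
  moreover from this[THEN nat_betweenD(8)] this[THEN nat_betweenD(9)]
  have "nat_between ?A ?B (ncod \<zeta>) (ncod \<zeta>') \<zeta>'" "nat_between ?B ?C (ncod \<xi>) (ncod \<xi>') \<xi>'"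
    using 8 by (auto intro!: nat_betweenI)
  ultimately show ?case using nt_interchange by simp
next
  case (9 X Y Z)
  let ?A = "fdom X" and ?B = "fcod X" and ?C = "fcod Y" and ?D = "fcod Z"
  have *: "functor_between ?A ?B X" "functor_between ?B ?C Y" "functor_between ?C ?D Z"
    using 9 by (auto intro: functor_betweenI)
  note comp = comp_functor[OF comp_functor[OF *(1,2)] *(3)]
  show ?case
    using comp_fun_assoc[OF *] iso2_Cat_id[OF comp] nat_betweenD[OF nat_between_id[OF comp]]
    by (simp add: cell2_def)
next
  case (10 \<zeta> \<xi> \<chi>)
  let ?A = "fdom (ndom \<zeta>)" and ?B = "fcod (ndom \<zeta>)" and ?C = "fcod (ndom \<xi>)"
  let ?D = "fcod (ndom \<chi>)"
  have *: "nat_between ?A ?B (ndom \<zeta>) (ncod \<zeta>) \<zeta>" "nat_between ?B ?C (ndom \<xi>) (ncod \<xi>) \<xi>"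
    "nat_between ?C ?D (ndom \<chi>) (ncod \<chi>) \<chi>"
    using 10 by (auto intro: nat_betweenI)
  show ?case
    using vcomp_nt_id[OF nat_between_hcomp[OF nat_between_hcomp[OF *(1,2)] *(3)]]
    by (simp add: hcomp_nt_assoc[OF *])
next
  case (11 X)
  then have *: "functor_between (fdom X) (fcod X) X" by (auto intro: functor_betweenI)
  then show ?case using nat_betweenD[OF nat_between_id[OF *]]
    by (simp add: comp_fun_id iso2_Cat_id cell2_def)
next
  case (12 \<zeta>)
  then have "nat_between (fdom (ndom \<zeta>)) (fcod (ndom \<zeta>)) (ndom \<zeta>) (ncod \<zeta>) \<zeta>"
    by (auto intro: nat_betweenI)
  from vcomp_nt_id[OF this] hcomp_nt_unit[OF this] show ?case by simp
next
  case (13 X)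
  then have *: "functor_between (fdom X) (fcod X) X" by (auto intro: functor_betweenI)
  then show ?case using nat_betweenD[OF nat_between_id[OF *]]
    by (simp add: comp_fun_id iso2_Cat_id cell2_def)
next
  case (14 \<zeta>)
  then have "nat_between (fdom (ndom \<zeta>)) (fcod (ndom \<zeta>)) (ndom \<zeta>) (ncod \<zeta>) \<zeta>"
    by (auto intro: nat_betweenI)
  from vcomp_nt_id[OF this] hcomp_nt_unit[OF this] show ?case by simp
next
  case (15 X Y Z W)
  let ?A = "fdom X" and ?B = "fcod X" and ?C = "fcod Y" and ?D = "fcod Z" and ?E = "fcod W"
  have *: "functor_between ?A ?B X" "functor_between ?B ?C Y" "functor_between ?C ?D Z"
    "functor_between ?D ?E W"
    using 15 by (auto intro: functor_betweenI)
  note YX = comp_functor[OF *(1,2)] and ZY = comp_functor[OF *(2,3)]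
  note ZYX = comp_functor[OF YX *(3)] and WZY = comp_functor[OF ZY *(4)]
  show ?case
    using vcomp_nt_id[OF nat_between_id[OF comp_functor[OF ZYX *(4)]]]
      hcomp_nt_id[OF *(1) WZY] hcomp_nt_id[OF ZYX *(4)]
    by (simp add: comp_fun_assoc[OF *(1-3)] comp_fun_assoc[OF *(2-4)] comp_fun_assoc[OF YX *(3,4)]
      comp_fun_assoc[OF *(1) ZY *(4)])
next
  case (16 X Y)
  let ?A = "fdom X" and ?B = "fdom Y" and ?C = "fcod Y"
  have *: "functor_between ?A ?B X" "functor_between ?B ?C Y"
    using 16 by (auto intro: functor_betweenI)
  from vcomp_nt_id[OF nat_between_id[OF comp_functor[OF *]]] 16 show ?case
    by (simp add: hcomp_nt_id[OF *] comp_fun_id[OF *(1)] comp_fun_id[OF *(2)])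
qed

section \<open>Categories of modules\<close>

lemma Mod_simps [simp]:
  "Ob (Mod K B) = {M. left_module K B M}" "Ar (Mod K B) = {f. left_linear K B f}"
  "Dom (Mod K B) = ldom" "Cod (Mod K B) = lcod"
  "Id (Mod K B) M = \<lparr>ldom = M, lcod = M, lund = id2 K (lcar M)\<rparr>"
  "g \<odot>\<^bsub>Mod K B\<^esub> f = \<lparr>ldom = ldom f, lcod = lcod g, lund = lund g \<bullet>\<^bsub>K\<^esub> lund f\<rparr>"
  by (simp_all add: Mod_def)

lemma Mnd_simps [simp]:
  "C0 (Mnd K) = {B. monad_in K B}" "C1 (Mnd K) = {X. monad_1cell K X}"
  "C2 (Mnd K) = {\<zeta>. monad_2cell K \<zeta>}"
  "src (Mnd K) = m1src" "trg (Mnd K) = m1trg" "dom2 (Mnd K) = m2dom" "cod2 (Mnd K) = m2cod"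
  "id1 (Mnd K) B = \<lparr>m1src = B, m1trg = B, und1 = id1 K (mobj B), str = id2 K (mcar B)\<rparr>"
  "comp1 (Mnd K) = mnd_comp1 K" "id2 (Mnd K) = mnd_id2 K"
  "und2 (\<xi> \<bullet>\<^bsub>Mnd K\<^esub> \<zeta>) = und2 \<xi> \<bullet>\<^bsub>K\<^esub> und2 \<zeta>"
  "und2 (\<xi> \<star>\<^bsub>Mnd K\<^esub> \<zeta>) = und2 \<xi> \<star>\<^bsub>K\<^esub> und2 \<zeta>"
  "lunit (Mnd K) = mnd_id2 K" "runit (Mnd K) = mnd_id2 K"
  by (simp_all add: Mnd_def)

lemma mnd_id2_simps [simp]:
  "m2dom (mnd_id2 K X) = X" "m2cod (mnd_id2 K X) = X" "und2 (mnd_id2 K X) = id2 K (und1 X)"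
  by (simp_all add: mnd_id2_def)

lemma mnd_comp1_simps [simp]:
  "m1src (mnd_comp1 K Y X) = m1src X" "m1trg (mnd_comp1 K Y X) = m1trg Y"
  "und1 (mnd_comp1 K Y X) = und1 Y \<cdot>\<^bsub>K\<^esub> und1 X"
  "str (mnd_comp1 K Y X) = (und1 Y \<rhd>\<^bsub>K\<^esub> str X) \<bullet>\<^bsub>K\<^esub> (str Y \<lhd>\<^bsub>K\<^esub> und1 X)"
  by (simp_all add: mnd_comp1_def)

lemma T_fun_simps [simp]:
  "fdom (T_fun K X) = Mod K (m1src X)" "fcod (T_fun K X) = Mod K (m1trg X)"
  "left_module K (m1src X) M \<Longrightarrow> fob (T_fun K X) M = tmod K X M"
  "left_linear K (m1src X) f \<Longrightarrow> far (T_fun K X) f =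
     \<lparr>ldom = tmod K X (ldom f), lcod = tmod K X (lcod f), lund = und1 X \<rhd>\<^bsub>K\<^esub> lund f\<rparr>"
  by (simp_all add: T_fun_def)

lemma T_nt_simps [simp]:
  "ndom (T_nt K \<zeta>) = T_fun K (m2dom \<zeta>)" "ncod (T_nt K \<zeta>) = T_fun K (m2cod \<zeta>)"
  "left_module K (m1src (m2dom \<zeta>)) M \<Longrightarrow> ncmp (T_nt K \<zeta>) M =
     \<lparr>ldom = tmod K (m2dom \<zeta>) M, lcod = tmod K (m2cod \<zeta>) M, lund = und2 \<zeta> \<lhd>\<^bsub>K\<^esub> lcar M\<rparr>"
  by (simp_all add: T_nt_def)

lemma left_linear_modules [simp]:
  assumes "left_linear K B f"
  shows "left_module K B (ldom f)" "left_module K B (lcod f)"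
  using left_linear.modules[OF assms] by auto

context two_category
begin

lemma left_linear_id:
  assumes "monad_in K B" "left_module K B M"
  shows "left_linear K B \<lparr>ldom = M, lcod = M, lund = id2 K (lcar M)\<rparr>"
proof -
  interpret B: monad_in K B by fact
  interpret M: left_module K B M by fact
  show ?thesis
    by (rule left_linear.intro) (simp_all add: assms cell2_def)
qed

lemma left_linear_comp:
  assumes "monad_in K B" "left_linear K B f" "left_linear K B g" "lcod f = ldom g"
  shows "left_linear K B \<lparr>ldom = ldom f, lcod = lcod g, lund = lund g \<bullet> lund f\<rparr>"
proof -
  interpret B: monad_in K B by fact
  interpret f: left_linear K B f by fact
  interpret g: left_linear K B g by fact
  interpret M: left_module K B "ldom f" by (rule f.modules)
  interpret N: left_module K B "ldom g" by (rule g.modules)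
  interpret P: left_module K B "lcod g" by (rule g.modules)
  show ?thesis
    using vcomp_cong3[OF g.linear] f.linear
    by (intro left_linear.intro) (simp_all add: assms f.modules cell2_def norm)
qed

lemma category_Mod:
  assumes "monad_in K B"
  shows "category (Mod K B)"
proof (rule category.intro)
  fix f g h assume "f \<in> Ar (Mod K B)" "g \<in> Ar (Mod K B)" "h \<in> Ar (Mod K B)"
    "Cod (Mod K B) f = Dom (Mod K B) g" "Cod (Mod K B) g = Dom (Mod K B) h"
  then show "(h \<odot>\<^bsub>Mod K B\<^esub> g) \<odot>\<^bsub>Mod K B\<^esub> f = h \<odot>\<^bsub>Mod K B\<^esub> g \<odot>\<^bsub>Mod K B\<^esub> f"
    by (simp add: left_linear.lin_simps vcomp_assoc)
qed (use left_linear_id[OF assms] left_linear_comp[OF assms] in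
    \<open>auto simp: left_linear.lin_simps left_linear_modules\<close>)

text \<open>Two squares are pasted: linearity of \<open>f\<close> whiskered by the 1-cell, and the
  exchange of \<open>lund f\<close> with \<open>str X\<close>.\<close>

lemma left_linear_whisker:
  assumes "monad_1cell K X" "left_linear K (m1src X) f"
  shows "left_linear K (m1trg X)
    \<lparr>ldom = tmod K X (ldom f), lcod = tmod K X (lcod f), lund = und1 X \<rhd> lund f\<rparr>"
proof -
  interpret X: monad_1cell K X by fact
  interpret B: monad_in K "m1src X" by (rule X.monads)
  interpret B': monad_in K "m1trg X" by (rule X.monads)
  interpret f: left_linear K "m1src X" f by fact
  interpret M: left_module K "m1src X" "ldom f" by (rule f.modules)
  interpret N: left_module K "m1src X" "lcod f" by (rule f.modules)
  let ?B = "mcar (m1src X)" and ?B' = "mcar (m1trg X)" and ?X = "und1 X"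
  have 1: "(?X \<rhd> lund f) \<bullet> (?X \<rhd> lact (ldom f)) = (?X \<rhd> lact (lcod f)) \<bullet> ((?X \<cdot> ?B) \<rhd> lund f)"
    using arg_cong[OF f.linear, of "\<lambda>z. ?X \<rhd> z"] by (simp add: norm)
  have 2: "((?X \<cdot> ?B) \<rhd> lund f) \<bullet> (str X \<lhd> lcar (ldom f)) =
      (str X \<lhd> lcar (lcod f)) \<bullet> ((?B' \<cdot> ?X) \<rhd> lund f)"
    using exchange[of "lund f" "str X"] by simp
  show ?thesis
    by (rule left_linear.intro)
      (simp_all add: tmod_module assms f.modules cell2_def norm vcomp_cong3[OF 1] 2)
qed

lemma functor_T_fun:
  assumes "monad_1cell K X"
  shows "functor_between (Mod K (m1src X)) (Mod K (m1trg X)) (T_fun K X)"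
proof (rule functor_betweenI)
  interpret X: monad_1cell K X by fact
  show "cat_functor (T_fun K X)"
  proof (rule cat_functor.intro)
    show "fob (T_fun K X) \<in> Ob (fdom (T_fun K X)) \<rightarrow>\<^sub>E Ob (fcod (T_fun K X))"
      using tmod_module[OF assms] by (auto simp: T_fun_def)
    show "far (T_fun K X) \<in> Ar (fdom (T_fun K X)) \<rightarrow>\<^sub>E Ar (fcod (T_fun K X))"
      using left_linear_whisker[OF assms] by (auto simp: T_fun_def)
    fix M assume "M \<in> Ob (fdom (T_fun K X))"
    then show "far (T_fun K X) (Id (fdom (T_fun K X)) M) = Id (fcod (T_fun K X)) (fob (T_fun K X) M)"
      using left_linear_id[OF X.monads(1)] by (simp add: left_module.mod_simps)
  next
    fix f g assume *: "f \<in> Ar (fdom (T_fun K X))" "g \<in> Ar (fdom (T_fun K X))"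
      "Cod (fdom (T_fun K X)) f = Dom (fdom (T_fun K X)) g"
    then have "src K (und1 X) = trg K (lcar (ldom f))"
      by (simp add: left_module.mod_simps(2)[of K "m1src X"])
    with * show "far (T_fun K X) (g \<odot>\<^bsub>fdom (T_fun K X)\<^esub> f) =
        far (T_fun K X) g \<odot>\<^bsub>fcod (T_fun K X)\<^esub> far (T_fun K X) f"
      using left_linear_comp[OF X.monads(1)] by (simp add: left_linear.lin_simps lwhisker_vcomp)
  qed (simp_all add: category_Mod X.monads)
qed simp_all

text \<open>\<open>und2 \<zeta>\<close> passes the action of \<open>M\<close> by exchange, and
  passes the structure cells by the defining equation of a 2-cell of monads.\<close>

lemma left_linear_T_nt:
  assumes "monad_2cell K \<zeta>" "left_module K (m1src (m2dom \<zeta>)) M"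
  shows "left_linear K (m1trg (m2dom \<zeta>))
    \<lparr>ldom = tmod K (m2dom \<zeta>) M, lcod = tmod K (m2cod \<zeta>) M, lund = und2 \<zeta> \<lhd> lcar M\<rparr>"
proof -
  interpret z: monad_2cell K \<zeta> by fact
  let ?X = "m2dom \<zeta>" and ?Y = "m2cod \<zeta>"
  interpret X: monad_1cell K ?X by (rule z.cells1)
  interpret Y: monad_1cell K ?Y by (rule z.cells1)
  interpret B: monad_in K "m1src ?X" by (rule X.monads)
  interpret B': monad_in K "m1trg ?X" by (rule X.monads)
  interpret M: left_module K "m1src ?X" M by fact
  let ?B = "mcar (m1src ?X)" and ?B' = "mcar (m1trg ?X)" and ?M = "lcar M"
  have 1: "(und2 \<zeta> \<lhd> ?M) \<bullet> (und1 ?X \<rhd> lact M) = (und1 ?Y \<rhd> lact M) \<bullet> (und2 \<zeta> \<lhd> (?B \<cdot> ?M))"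
    using exchange[of "lact M" "und2 \<zeta>"] by (simp flip: z.parallel)
  have 2: "(und2 \<zeta> \<lhd> (?B \<cdot> ?M)) \<bullet> (str ?X \<lhd> ?M) = (str ?Y \<lhd> ?M) \<bullet> (?B' \<rhd> (und2 \<zeta> \<lhd> ?M))"
    using arg_cong[OF z.str_und2, of "\<lambda>z. z \<lhd> ?M"] by (simp add: norm flip: z.parallel)
  show ?thesis
    using tmod_module[OF X.monad_1cell_axioms] tmod_module[OF Y.monad_1cell_axioms]
    by (intro left_linear.intro)
      (simp_all add: assms cell2_def norm vcomp_cong3[OF 1] 2 flip: z.parallel)
qed

lemma nat_between_T_nt:
  assumes "monad_2cell K \<zeta>"
  shows "nat_between (Mod K (m1src (m2dom \<zeta>))) (Mod K (m1trg (m2dom \<zeta>)))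
    (T_fun K (m2dom \<zeta>)) (T_fun K (m2cod \<zeta>)) (T_nt K \<zeta>)"
proof (rule nat_between_intro)
  interpret z: monad_2cell K \<zeta> by fact
  let ?X = "m2dom \<zeta>" and ?Y = "m2cod \<zeta>"
  interpret X: monad_1cell K ?X by (rule z.cells1)
  interpret Y: monad_1cell K ?Y by (rule z.cells1)
  show "functor_between (Mod K (m1src ?X)) (Mod K (m1trg ?X)) (T_fun K ?X)"
    by (rule functor_T_fun[OF z.cells1(1)])
  show "functor_between (Mod K (m1src ?X)) (Mod K (m1trg ?X)) (T_fun K ?Y)"
    using functor_T_fun[OF z.cells1(2)] by (simp add: z.parallel)
  fix f assume f: "f \<in> Ar (Mod K (m1src ?X))"
  then interpret f: left_linear K "m1src ?X" f by simp
  interpret M: left_module K "m1src ?X" "ldom f" by (rule f.modules)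
  interpret N: left_module K "m1src ?X" "lcod f" by (rule f.modules)
  have "left_linear K (m1src ?Y) f"
    using f z.parallel by simp
  with f exchange[of "lund f" "und2 \<zeta>"]
  show "far (T_fun K ?Y) f \<odot>\<^bsub>Mod K (m1trg ?X)\<^esub> ncmp (T_nt K \<zeta>) (Dom (Mod K (m1src ?X)) f) =
      ncmp (T_nt K \<zeta>) (Cod (Mod K (m1src ?X)) f) \<odot>\<^bsub>Mod K (m1trg ?X)\<^esub> far (T_fun K ?X) f"
    by simp
next
  fix M assume "M \<in> Ob (Mod K (m1src (m2dom \<zeta>)))"
  then show "ncmp (T_nt K \<zeta>) M \<in> homset (Mod K (m1trg (m2dom \<zeta>)))
      (fob (T_fun K (m2dom \<zeta>)) M) (fob (T_fun K (m2cod \<zeta>)) M)"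
    using left_linear_T_nt[OF assms] monad_2cell.parallel[OF assms] by simp
qed (simp_all add: T_nt_def)

text \<open>The two whiskerings that make up \<open>str\<close> of a composite are exactly those
  produced by forming the module structure twice.\<close>

lemma tmod_comp:
  assumes "monad_1cell K X" "monad_1cell K Y" "m1trg X = m1src Y" "left_module K (m1src X) M"
  shows "tmod K (mnd_comp1 K Y X) M = tmod K Y (tmod K X M)"
proof -
  interpret X: monad_1cell K X by fact
  interpret Y: monad_1cell K Y by fact
  interpret B: monad_in K "m1src X" by (rule X.monads)
  interpret B': monad_in K "m1trg X" by (rule X.monads)
  interpret B'': monad_in K "m1trg Y" by (rule Y.monads)
  interpret M: left_module K "m1src X" M by fact
  show ?thesis
    by (simp add: tmod_def norm flip: assms(3))
qed

lemma tmod_id: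
  assumes "monad_in K B" "left_module K B M"
  shows "tmod K (id1 (Mnd K) B) M = M"
proof -
  interpret B: monad_in K B by fact
  interpret M: left_module K B M by fact
  show ?thesis by (simp add: tmod_def)
qed

text \<open>An equality rather than an isomorphism is what allows the unit of the pseudofunctor to
  be an identity transformation.\<close>

lemma T_fun_id:
  assumes "monad_in K B"
  shows "T_fun K (id1 (Mnd K) B) = id_fun (Mod K B)"
proof (rule cfun.equality)
  have "lund f \<in> C2 K" "trg K (dom2 K (lund f)) = mobj B" if "left_linear K B f" for f
    using that left_linear.lin_simps[OF that] left_module.mod_simps(2)[of K B "ldom f"] by simp_all
  then show "far (T_fun K (id1 (Mnd K) B)) = far (id_fun (Mod K B))"
    by (auto simp: T_fun_def id_fun_def tmod_id[OF assms, simplified] intro!: restrict_ext)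
  show "fob (T_fun K (id1 (Mnd K) B)) = fob (id_fun (Mod K B))"
    by (auto simp: T_fun_def id_fun_def tmod_id[OF assms, simplified] intro!: restrict_ext)
qed simp_all

end

section \<open>The pseudofunctor\<close>

context two_category
begin

lemma T_nt_id:
  assumes "monad_1cell K X"
  shows "T_nt K (mnd_id2 K X) = id_nt (T_fun K X)"
proof (rule ntrans.equality)
  interpret X: monad_1cell K X by fact
  have "lcar M \<in> C1 K" "trg K (lcar M) = mobj (m1src X)" if "left_module K (m1src X) M" for M
    using left_module.mod_simps[OF that] by simp_all
  then show "ncmp (T_nt K (mnd_id2 K X)) = ncmp (id_nt (T_fun K X))"
    by (auto simp: T_nt_def id_nt_def intro!: restrict_ext)
qed simp_all

end

text \<open>These assumptions determine the module structures and are inherited by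
  \<open>endo_part L A\<close> (see \<open>quasi_endo_part\<close>). Facts proved here can therefore
  be applied both to \<open>L\<close> and to its one-object parts.\<close>

locale quasi_over_monads = two_category K + L: bicategory L + F: quasi_2functor L "Mnd K" F
  for K :: "('o, 'm, 'c) bicat" (structure) and L :: "('p, 'n, 'd) bicat"
    and F :: "('o, 'm, 'c, 'p, 'n, 'd) to_mnd" +
  assumes strict_units: "unit_strict L"
begin

lemma F0 [simp]:
  assumes "A \<in> C0 L"
  shows "monad_in K (map0 F A)"
  using F.map0[OF assms] by simp

lemmas F0_simps [simp] = monad_in.mnd_simps[OF F0]

lemma F1 [simp]:
  assumes "X \<in> C1 L"
  shows "monad_1cell K (map1 F X)" "m1src (map1 F X) = map0 F (src L X)"
    "m1trg (map1 F X) = map0 F (trg L X)"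
  using F.map1[OF assms] by simp_all

lemma F1_simps [simp]:
  assumes "X \<in> C1 L"
  shows "und1 (map1 F X) \<in> C1 K" "src K (und1 (map1 F X)) = mobj (map0 F (src L X))"
    "trg K (und1 (map1 F X)) = mobj (map0 F (trg L X))"
    "str (map1 F X) \<in> C2 K"
    "dom2 K (str (map1 F X)) = mcar (map0 F (trg L X)) \<cdot> und1 (map1 F X)"
    "cod2 K (str (map1 F X)) = und1 (map1 F X) \<cdot> mcar (map0 F (src L X))"
  using monad_1cell.cell_simps[OF F1(1)] assms by simp_all

lemma F2 [simp]:
  assumes "\<zeta> \<in> C2 L"
  shows "monad_2cell K (map2 F \<zeta>)" "m2dom (map2 F \<zeta>) = map1 F (dom2 L \<zeta>)"
    "m2cod (map2 F \<zeta>) = map1 F (cod2 L \<zeta>)"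
  using F.map2[OF assms] by (simp_all add: cell2_def)

lemma F2_simps [simp]:
  assumes "\<zeta> \<in> C2 L"
  shows "und2 (map2 F \<zeta>) \<in> C2 K" "dom2 K (und2 (map2 F \<zeta>)) = und1 (map1 F (dom2 L \<zeta>))"
    "cod2 K (und2 (map2 F \<zeta>)) = und1 (map1 F (cod2 L \<zeta>))"
  using monad_2cell.cell_simps[OF F2(1)] assms by simp_all

lemma F_comp [simp]:
  "\<lbrakk>X \<in> C1 L; Y \<in> C1 L; trg L X = src L Y\<rbrakk> \<Longrightarrow>
    map1 F (Y \<cdot>\<^bsub>L\<^esub> X) = mnd_comp1 K (map1 F Y) (map1 F X)"
  "X \<in> C1 L \<Longrightarrow> map2 F (id2 L X) = mnd_id2 K (map1 F X)"
  "\<lbrakk>\<zeta> \<in> C2 L; \<xi> \<in> C2 L; cod2 L \<zeta> = dom2 L \<xi>\<rbrakk> \<Longrightarrow>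
    und2 (map2 F (\<xi> \<bullet>\<^bsub>L\<^esub> \<zeta>)) = und2 (map2 F \<xi>) \<bullet> und2 (map2 F \<zeta>)"
  "\<lbrakk>\<zeta> \<in> C2 L; \<xi> \<in> C2 L; trg L (dom2 L \<zeta>) = src L (dom2 L \<xi>)\<rbrakk> \<Longrightarrow>
    und2 (map2 F (\<xi> \<star>\<^bsub>L\<^esub> \<zeta>)) = und2 (map2 F \<xi>) \<star> und2 (map2 F \<zeta>)"
  by (simp_all add: F.map1_comp1 F.map2_id2 F.map2_vcomp F.map2_hcomp)

lemma F_id1 [simp]:
  assumes "A \<in> C0 L"
  shows "und1 (map1 F (id1 L A)) = id1 K (mobj (map0 F A))"
    "T_fun K (map1 F (id1 L A)) = id_fun (Mod K (map0 F A))"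
    "left_module K (map0 F A) M \<Longrightarrow> tmod K (map1 F (id1 L A)) M = M"
  using T_fun_id[of "map0 F A"] tmod_id[of "map0 F A" M] assms
  by (simp_all add: F.map1_id1)

lemma L_units [simp]:
  assumes "X \<in> C1 L"
  shows "lunit L X = id2 L X" "runit L X = id2 L X"
    "trg L X = A \<Longrightarrow> id1 L A \<cdot>\<^bsub>L\<^esub> X = X" "src L X = A \<Longrightarrow> X \<cdot>\<^bsub>L\<^esub> id1 L A = X"
  using strict_units L.lunit[OF assms] L.runit[OF assms] assms
  by (auto simp: unit_strict_def cell2_def)

lemma L_assoc [simp]:
  assumes "X \<in> C1 L" "Y \<in> C1 L" "Z \<in> C1 L" "trg L X = src L Y" "trg L Y = src L Z"
  shows "assoc L Z Y X \<in> C2 L" "dom2 L (assoc L Z Y X) = (Z \<cdot>\<^bsub>L\<^esub> Y) \<cdot>\<^bsub>L\<^esub> X"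
    "cod2 L (assoc L Z Y X) = Z \<cdot>\<^bsub>L\<^esub> (Y \<cdot>\<^bsub>L\<^esub> X)"
  using L.assoc[OF assms] by (auto simp: cell2_def)

lemma tmod_module_F [simp]:
  assumes "X \<in> C1 L" "left_module K (map0 F (src L X)) M" "trg L X = A"
  shows "left_module K (map0 F A) (tmod K (map1 F X) M)"
  using tmod_module[of "map1 F X" M] assms by simp

lemma tmod_comp_F [simp]:
  assumes "X \<in> C1 L" "Y \<in> C1 L" "trg L X = src L Y" "left_module K (map0 F (src L X)) M"
  shows "tmod K (mnd_comp1 K (map1 F Y) (map1 F X)) M = tmod K (map1 F Y) (tmod K (map1 F X) M)"
  using tmod_comp[of "map1 F X" "map1 F Y" M] assms by simp

lemma functor_T [simp]:
  assumes "X \<in> C1 L" "src L X = A" "trg L X = B"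
  shows "functor_between (Mod K (map0 F A)) (Mod K (map0 F B)) (T_fun K (map1 F X))"
  using functor_T_fun[of "map1 F X"] assms by simp

lemma nat_between_T [simp]:
  assumes "\<zeta> \<in> C2 L" "src L (dom2 L \<zeta>) = A" "trg L (dom2 L \<zeta>) = B" "dom2 L \<zeta> = X" "cod2 L \<zeta> = Y"
  shows "nat_between (Mod K (map0 F A)) (Mod K (map0 F B))
    (T_fun K (map1 F X)) (T_fun K (map1 F Y)) (T_nt K (map2 F \<zeta>))"
  using nat_between_T_nt[of "map2 F \<zeta>"] L.dom_cod_simps(1)[OF assms(1)] assms by simp

lemma T_nt_vcomp_F:
  assumes "\<zeta> \<in> C2 L" "\<xi> \<in> C2 L" "cod2 L \<zeta> = dom2 L \<xi>"
  shows "T_nt K (map2 F (\<xi> \<bullet>\<^bsub>L\<^esub> \<zeta>)) = vcomp_nt (T_nt K (map2 F \<xi>)) (T_nt K (map2 F \<zeta>))"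
proof (rule ntrans_eqI)
  let ?A = "src L (dom2 L \<zeta>)" and ?B = "trg L (dom2 L \<zeta>)"
  note * = L.composable_src_trg[OF assms]
  show "nat_between (Mod K (map0 F ?A)) (Mod K (map0 F ?B)) (T_fun K (map1 F (dom2 L \<zeta>)))
      (T_fun K (map1 F (cod2 L \<xi>))) (T_nt K (map2 F (\<xi> \<bullet>\<^bsub>L\<^esub> \<zeta>)))"
    using assms by simp
  show "nat_between (Mod K (map0 F ?A)) (Mod K (map0 F ?B)) (T_fun K (map1 F (dom2 L \<zeta>)))
      (T_fun K (map1 F (cod2 L \<xi>))) (vcomp_nt (T_nt K (map2 F \<xi>)) (T_nt K (map2 F \<zeta>)))"
    by (rule nat_between_vcomp[of _ _ _ "T_fun K (map1 F (cod2 L \<zeta>))"]) (use assms * in auto)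
  fix M assume "M \<in> Ob (Mod K (map0 F ?A))"
  then have M: "left_module K (map0 F ?A) M" by simp
  interpret M: left_module K "map0 F ?A" M by fact
  show "ncmp (T_nt K (map2 F (\<xi> \<bullet>\<^bsub>L\<^esub> \<zeta>))) M = ncmp (vcomp_nt (T_nt K (map2 F \<xi>)) (T_nt K (map2 F \<zeta>))) M"
    using assms M * by (simp add: rwhisker_vcomp)
qed

end

lemma T_pseudo_simps [simp]:
  "map0 (T_pseudo K L F s) A = Mod K (map0 F A)"
  "map1 (T_pseudo K L F s) X = T_fun K (map1 F X)"
  "map2 (T_pseudo K L F s) \<zeta> = T_nt K (map2 F \<zeta>)"
  "punit (T_pseudo K L F s) A = id_nt (id_fun (Mod K (map0 F A)))"
  "ndom (pcomp (T_pseudo K L F s) Y X) = comp_fun (T_fun K (map1 F Y)) (T_fun K (map1 F X))"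
  "ncod (pcomp (T_pseudo K L F s) Y X) = T_fun K (map1 F (Y \<cdot>\<^bsub>L\<^esub> X))"
  "left_module K (map0 F (src L X)) M \<Longrightarrow> ncmp (pcomp (T_pseudo K L F s) Y X) M = s_mor K L F s Y X M"
  by (simp_all add: T_pseudo_def)

lemma s_mor_simps [simp]:
  "ldom (s_mor K L F s Y X M) = tmod K (map1 F Y) (tmod K (map1 F X) M)"
  "lcod (s_mor K L F s Y X M) = tmod K (map1 F (Y \<cdot>\<^bsub>L\<^esub> X)) M"
  "lund (s_mor K L F s Y X M) = s Y X M"
  by (simp_all add: s_mor_def)

locale coherent_over_monads = quasi_over_monads + coherent_assoc_family
begin

lemma s_linear [simp]:
  assumes "X \<in> C1 L" "Y \<in> C1 L" "trg L X = src L Y" "left_module K (map0 F (src L X)) M" "trg L Y = A"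
  shows "left_linear K (map0 F A) (s_mor K L F s Y X M)"
  using s_iso[of X Y M] assms by (simp add: is_iso_def)

lemma s_simps [simp]:
  assumes "X \<in> C1 L" "Y \<in> C1 L" "trg L X = src L Y" "left_module K (map0 F (src L X)) M"
  shows "s Y X M \<in> C2 K" "dom2 K (s Y X M) = und1 (map1 F Y) \<cdot> (und1 (map1 F X) \<cdot> lcar M)"
    "cod2 K (s Y X M) = und1 (map1 F Y) \<cdot> (und1 (map1 F X) \<cdot> lcar M)"
proof -
  interpret M: left_module K "map0 F (src L X)" M by fact
  show "s Y X M \<in> C2 K" "dom2 K (s Y X M) = und1 (map1 F Y) \<cdot> (und1 (map1 F X) \<cdot> lcar M)"
    "cod2 K (s Y X M) = und1 (map1 F Y) \<cdot> (und1 (map1 F X) \<cdot> lcar M)"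
    using left_linear.lin_simps[OF s_linear[OF assms refl]] assms by (simp_all del: tmod_comp_F)
qed

text \<open>Linearity of the components is contained in \<open>s_iso\<close>, and their naturality
  in the module is \<open>s_natural\<close>.\<close>

lemma nat_between_pcomp:
  assumes "X \<in> C1 L" "Y \<in> C1 L" "trg L X = src L Y"
  shows "nat_between (Mod K (map0 F (src L X))) (Mod K (map0 F (trg L Y)))
    (comp_fun (T_fun K (map1 F Y)) (T_fun K (map1 F X))) (T_fun K (map1 F (Y \<cdot>\<^bsub>L\<^esub> X)))
    (pcomp (T_pseudo K L F s) Y X)"
proof (rule nat_between_intro)
  show "functor_between (Mod K (map0 F (src L X))) (Mod K (map0 F (trg L Y)))
      (comp_fun (T_fun K (map1 F Y)) (T_fun K (map1 F X)))"
    by (rule comp_functor[of _ "Mod K (map0 F (trg L X))"]) (use assms in auto)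
  show "functor_between (Mod K (map0 F (src L X))) (Mod K (map0 F (trg L Y)))
      (T_fun K (map1 F (Y \<cdot>\<^bsub>L\<^esub> X)))"
    using functor_T[of "Y \<cdot>\<^bsub>L\<^esub> X"] assms by (simp del: functor_T)
  fix f assume f: "f \<in> Ar (Mod K (map0 F (src L X)))"
  then have *: "left_linear K (map0 F (src L X)) f" by simp
  interpret f: left_linear K "map0 F (src L X)" f by fact
  interpret M: left_module K "map0 F (src L X)" "ldom f" by (rule f.modules)
  show "far (T_fun K (map1 F (Y \<cdot>\<^bsub>L\<^esub> X))) f \<odot>\<^bsub>Mod K (map0 F (trg L Y))\<^esub>
      ncmp (pcomp (T_pseudo K L F s) Y X) (Dom (Mod K (map0 F (src L X))) f) =
      ncmp (pcomp (T_pseudo K L F s) Y X) (Cod (Mod K (map0 F (src L X))) f) \<odot>\<^bsub>Mod K (map0 F (trg L Y))\<^esub>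
      far (comp_fun (T_fun K (map1 F Y)) (T_fun K (map1 F X))) f"
    using s_natural[OF assms f] left_linear_whisker[of "map1 F X" f] assms * by simp
next
  fix M assume "M \<in> Ob (Mod K (map0 F (src L X)))"
  then show "ncmp (pcomp (T_pseudo K L F s) Y X) M \<in> homset (Mod K (map0 F (trg L Y)))
      (fob (comp_fun (T_fun K (map1 F Y)) (T_fun K (map1 F X))) M)
      (fob (T_fun K (map1 F (Y \<cdot>\<^bsub>L\<^esub> X))) M)"
    using assms by simp
qed (simp_all add: T_pseudo_def)

text \<open>Identity 1-cells go to identity functors and \<open>L\<close> has strict units, so
  domain and codomain of the comparison are both \<open>T_fun K (map1 F X)\<close>; its components
  are identities by \<open>s_unit\<close>. This trivializes both unit axioms of the
  pseudofunctor.\<close>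

lemma pcomp_unit:
  assumes X: "X \<in> C1 L"
  shows "pcomp (T_pseudo K L F s) (id1 L (trg L X)) X = id_nt (T_fun K (map1 F X))"
    and "pcomp (T_pseudo K L F s) X (id1 L (src L X)) = id_nt (T_fun K (map1 F X))"
proof -
  let ?A = "src L X" and ?B = "trg L X"
  note id = nat_between_id[OF functor_T[OF X refl refl]]
  have [simp]: "comp_fun (id_fun (Mod K (map0 F ?B))) (T_fun K (map1 F X)) = T_fun K (map1 F X)"
    "comp_fun (T_fun K (map1 F X)) (id_fun (Mod K (map0 F ?A))) = T_fun K (map1 F X)"
    using comp_fun_id[OF functor_T[OF X refl refl]] by simp_all
  have "nat_between (Mod K (map0 F ?A)) (Mod K (map0 F ?B)) (T_fun K (map1 F X)) (T_fun K (map1 F X))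
      (pcomp (T_pseudo K L F s) (id1 L ?B) X)"
    using nat_between_pcomp[of X "id1 L ?B"] X by (simp del: F_comp)
  from ntrans_eqI[OF this id]
  show "pcomp (T_pseudo K L F s) (id1 L ?B) X = id_nt (T_fun K (map1 F X))"
    using X s_unit[OF X] by (simp add: s_mor_def del: F_comp)
  have "nat_between (Mod K (map0 F ?A)) (Mod K (map0 F ?B)) (T_fun K (map1 F X)) (T_fun K (map1 F X))
      (pcomp (T_pseudo K L F s) X (id1 L ?A))"
    using nat_between_pcomp[of "id1 L ?A" X] X by (simp del: F_comp)
  from ntrans_eqI[OF this id]
  show "pcomp (T_pseudo K L F s) X (id1 L ?A) = id_nt (T_fun K (map1 F X))"
    using X s_unit[OF X] by (simp add: s_mor_def del: F_comp)
qed

text \<open>Equations between transformations are checked on components. There naturality in the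
  1-cells becomes \<open>s_natural_1cells\<close>, the associativity axiom becomes
  \<open>s_assoc\<close>, and the unit axioms follow from \<open>pcomp_unit\<close>.\<close>

lemma pseudofunctor_T: "pseudofunctor L Cat (T_pseudo K L F s)"
proof (intro pseudofunctor.intro locally_functorial.intro pseudofunctor_axioms.intro, goal_cases)
  case (1 A) then show ?case by (simp add: category_Mod)
next
  case (2 X)
  then show ?case using functor_betweenD[OF functor_T[OF 2 refl refl]] by simp
next
  case (3 \<zeta>)
  then show ?case using nat_betweenD[OF nat_between_T[OF 3 refl refl refl refl]] by (simp add: cell2_def)
next
  case (4 X) then show ?case by (simp add: T_nt_id)
next
  case (5 \<zeta> \<xi>) then show ?case by (simp add: T_nt_vcomp_F)
next
  case 6 then show ?case by (rule L.bicategory_axioms)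
next
  case 7 then show ?case by (rule bicategory_Cat)
next
  case (8 X Y)
  note nat = nat_between_pcomp[OF 8]
  show ?case using nat_betweenD[OF nat] iso2_CatI[OF nat] s_iso[OF 8] by (simp add: cell2_def)
next
  case (9 \<zeta> \<xi>)
  let ?A = "src L (dom2 L \<zeta>)" and ?B = "trg L (dom2 L \<zeta>)" and ?C = "trg L (dom2 L \<xi>)"
  let ?X = "dom2 L \<zeta>" and ?Y = "dom2 L \<xi>" and ?X' = "cod2 L \<zeta>" and ?Y' = "cod2 L \<xi>"
  let ?T = "T_pseudo K L F s"
  have X: "?X \<in> C1 L" "?Y \<in> C1 L" "trg L ?X = src L ?Y" and X': "?X' \<in> C1 L" "?Y' \<in> C1 L" "trg L ?X' = src L ?Y'"
    using 9 by simp_all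
  have "vcomp_nt (pcomp ?T ?Y' ?X') (hcomp_nt (T_nt K (map2 F \<xi>)) (T_nt K (map2 F \<zeta>))) =
      vcomp_nt (T_nt K (map2 F (\<xi> \<star>\<^bsub>L\<^esub> \<zeta>))) (pcomp ?T ?Y ?X)"
  proof (rule ntrans_eqI)
    show "nat_between (Mod K (map0 F ?A)) (Mod K (map0 F ?C))
        (comp_fun (T_fun K (map1 F ?Y)) (T_fun K (map1 F ?X))) (T_fun K (map1 F (?Y' \<cdot>\<^bsub>L\<^esub> ?X')))
        (vcomp_nt (pcomp ?T ?Y' ?X') (hcomp_nt (T_nt K (map2 F \<xi>)) (T_nt K (map2 F \<zeta>))))"
      by (rule nat_between_vcomp[OF nat_between_hcomp[of _ "Mod K (map0 F ?B)"] 
        nat_between_pcomp[OF X', simplified L.dom_cod_simps[OF 9(1)] L.dom_cod_simps[OF 9(2)]]]) 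
        (use 9 in auto)
    show "nat_between (Mod K (map0 F ?A)) (Mod K (map0 F ?C))
        (comp_fun (T_fun K (map1 F ?Y)) (T_fun K (map1 F ?X))) (T_fun K (map1 F (?Y' \<cdot>\<^bsub>L\<^esub> ?X')))
        (vcomp_nt (T_nt K (map2 F (\<xi> \<star>\<^bsub>L\<^esub> \<zeta>))) (pcomp ?T ?Y ?X))"
      by (rule nat_between_vcomp[OF nat_between_pcomp[OF X] nat_between_T]) (use 9 in auto)
    fix M assume M: "M \<in> Ob (Mod K (map0 F ?A))"
    then interpret M: left_module K "map0 F ?A" M by simp
    \<comment> \<open>The component of a horizontal composite in \<open>Cat\<close> is a composite
      of two whiskerings; the coherence condition is phrased with the single horizontal composite in
      \<open>K\<close>.\<close>
    have "(und2 (map2 F \<xi>) \<lhd> (und1 (map1 F ?X') \<cdot> lcar M)) \<bullet>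
        (und1 (map1 F ?Y) \<rhd> (und2 (map2 F \<zeta>) \<lhd> lcar M)) =
        und2 (map2 F \<xi>) \<star> (und2 (map2 F \<zeta>) \<lhd> lcar M)"
      using hcomp_rl[of "und2 (map2 F \<zeta>) \<lhd> lcar M" "und2 (map2 F \<xi>)"] 9 by simp
    then show "ncmp (vcomp_nt (pcomp ?T ?Y' ?X') (hcomp_nt (T_nt K (map2 F \<xi>)) (T_nt K (map2 F \<zeta>)))) M =
        ncmp (vcomp_nt (T_nt K (map2 F (\<xi> \<star>\<^bsub>L\<^esub> \<zeta>))) (pcomp ?T ?Y ?X)) M"
      using s_natural_1cells[OF 9 M] 9 M left_linear_T_nt[of "map2 F \<zeta>" M] by simp
  qed
  then show ?case by simp
next
  case (10 A)
  note id = id_functor[OF category_Mod[OF F0[OF 10]]]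
  show ?case
    using iso2_Cat_id[OF id] functor_betweenD[OF id] nat_betweenD(1)[OF nat_between_id[OF id]] 10
    by (simp add: cell2_def)
next
  case (11 X Y Z)
  let ?A = "src L X" and ?B = "src L Y" and ?C = "src L Z" and ?D = "trg L Z"
  let ?T = "T_pseudo K L F s"
  let ?TX = "T_fun K (map1 F X)" and ?TY = "T_fun K (map1 F Y)" and ?TZ = "T_fun K (map1 F Z)"
  have T: "functor_between (Mod K (map0 F ?A)) (Mod K (map0 F ?B)) ?TX"
    "functor_between (Mod K (map0 F ?B)) (Mod K (map0 F ?C)) ?TY"
    "functor_between (Mod K (map0 F ?C)) (Mod K (map0 F ?D)) ?TZ"
    using 11 by auto
  have "vcomp_nt (T_nt K (map2 F (assoc L Z Y X))) (vcomp_nt (pcomp ?T (Z \<cdot>\<^bsub>L\<^esub> Y) X)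
        (hcomp_nt (pcomp ?T Z Y) (id_nt ?TX))) =
      vcomp_nt (pcomp ?T Z (Y \<cdot>\<^bsub>L\<^esub> X)) (hcomp_nt (id_nt ?TZ) (pcomp ?T Y X))"
  proof (rule ntrans_eqI)
    have 1: "nat_between (Mod K (map0 F ?A)) (Mod K (map0 F ?D))
        (comp_fun (comp_fun ?TZ ?TY) ?TX) (comp_fun (T_fun K (map1 F (Z \<cdot>\<^bsub>L\<^esub> Y))) ?TX)
        (hcomp_nt (pcomp ?T Z Y) (id_nt ?TX))"
      by (rule nat_between_hcomp[OF nat_between_id[OF T(1)]]) (use nat_between_pcomp[of Y Z] 11 in auto)
    have 2: "nat_between (Mod K (map0 F ?A)) (Mod K (map0 F ?D))
        (comp_fun (T_fun K (map1 F (Z \<cdot>\<^bsub>L\<^esub> Y))) ?TX) (T_fun K (map1 F ((Z \<cdot>\<^bsub>L\<^esub> Y) \<cdot>\<^bsub>L\<^esub> X)))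
        (pcomp ?T (Z \<cdot>\<^bsub>L\<^esub> Y) X)"
      using nat_between_pcomp[of X "Z \<cdot>\<^bsub>L\<^esub> Y"] 11 by simp
    have 3: "nat_between (Mod K (map0 F ?A)) (Mod K (map0 F ?D))
        (T_fun K (map1 F ((Z \<cdot>\<^bsub>L\<^esub> Y) \<cdot>\<^bsub>L\<^esub> X))) (T_fun K (map1 F (Z \<cdot>\<^bsub>L\<^esub> Y \<cdot>\<^bsub>L\<^esub> X)))
        (T_nt K (map2 F (assoc L Z Y X)))"
      using nat_between_T[of "assoc L Z Y X"] 11 by (simp del: F_comp nat_between_T)
    show "nat_between (Mod K (map0 F ?A)) (Mod K (map0 F ?D))
        (comp_fun ?TZ (comp_fun ?TY ?TX)) (T_fun K (map1 F (Z \<cdot>\<^bsub>L\<^esub> Y \<cdot>\<^bsub>L\<^esub> X)))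
        (vcomp_nt (T_nt K (map2 F (assoc L Z Y X))) (vcomp_nt (pcomp ?T (Z \<cdot>\<^bsub>L\<^esub> Y) X)
        (hcomp_nt (pcomp ?T Z Y) (id_nt ?TX))))"
      using nat_between_vcomp[OF nat_between_vcomp[OF 1 2] 3] comp_fun_assoc[OF T] by simp
    show "nat_between (Mod K (map0 F ?A)) (Mod K (map0 F ?D))
        (comp_fun ?TZ (comp_fun ?TY ?TX)) (T_fun K (map1 F (Z \<cdot>\<^bsub>L\<^esub> Y \<cdot>\<^bsub>L\<^esub> X)))
        (vcomp_nt (pcomp ?T Z (Y \<cdot>\<^bsub>L\<^esub> X)) (hcomp_nt (id_nt ?TZ) (pcomp ?T Y X)))"
      by (rule nat_between_vcomp[OF nat_between_hcomp[of _ "Mod K (map0 F ?C)",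
            OF _ nat_between_id[OF T(3)]]])
        (use nat_between_pcomp[of X Y] nat_between_pcomp[of "Y \<cdot>\<^bsub>L\<^esub> X" Z] 11 in auto)
    fix M assume M: "M \<in> Ob (Mod K (map0 F ?A))"
    then interpret M: left_module K "map0 F ?A" M by simp
    \<comment> \<open>Whiskering with a functor brings in identities of \<open>tmod\<close>. They
      have to be known as linear maps before the functors can be evaluated on them.\<close>
    have id: "left_linear K (map0 F ?B) \<lparr>ldom = tmod K (map1 F X) M, lcod = tmod K (map1 F X) M,
       lund = id2 K (und1 (map1 F X) \<cdot> lcar M)\<rparr>"
      using left_linear_id[of "map0 F ?B" "tmod K (map1 F X) M"] 11 M by simp
    have id': "left_linear K (map0 F ?C) \<lparr>ldom = tmod K (map1 F Y) (tmod K (map1 F X) M),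
       lcod = tmod K (map1 F Y) (tmod K (map1 F X) M),
       lund = id2 K (und1 (map1 F Y) \<cdot> (und1 (map1 F X) \<cdot> lcar M))\<rparr>"
      using left_linear_id[of "map0 F ?C" "tmod K (map1 F Y) (tmod K (map1 F X) M)"] 11 M by simp
    show "ncmp (vcomp_nt (T_nt K (map2 F (assoc L Z Y X))) (vcomp_nt (pcomp ?T (Z \<cdot>\<^bsub>L\<^esub> Y) X)
        (hcomp_nt (pcomp ?T Z Y) (id_nt ?TX)))) M =
      ncmp (vcomp_nt (pcomp ?T Z (Y \<cdot>\<^bsub>L\<^esub> X)) (hcomp_nt (id_nt ?TZ) (pcomp ?T Y X))) M"
      using s_assoc[OF 11 M] 11 M id id' by simp
  qed
  \<comment> \<open>The axiom has the associativity constraint of \<open>Cat\<close> as its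
    rightmost factor; being an identity, it is absorbed.\<close>
  moreover have "nat_between (Mod K (map0 F ?A)) (Mod K (map0 F ?D))
        (comp_fun ?TZ (comp_fun ?TY ?TX)) (comp_fun ?TZ (T_fun K (map1 F (Y \<cdot>\<^bsub>L\<^esub> X))))
        (hcomp_nt (id_nt ?TZ) (pcomp ?T Y X))"
    by (rule nat_between_hcomp[OF _ nat_between_id[OF T(3)]]) (use nat_between_pcomp[of X Y] 11 in auto)
  from vcomp_nt_id(1)[OF this]
  have "vcomp_nt (hcomp_nt (id_nt ?TZ) (pcomp ?T Y X)) (id_nt (comp_fun ?TZ (comp_fun ?TY ?TX))) =
    hcomp_nt (id_nt ?TZ) (pcomp ?T Y X)" .
  ultimately show ?case by simp
next
  case (12 X)
  note T = functor_T[OF 12 refl refl]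
  note ids = id_functor[OF functor_betweenD(4)[OF T]] id_functor[OF functor_betweenD(5)[OF T]]
  show ?case
    using 12 vcomp_nt_id[OF nat_between_id[OF T]] hcomp_nt_id[OF ids(1) T] hcomp_nt_id[OF T ids(2)]
    by (simp add: pcomp_unit comp_fun_id[OF T] T_nt_id)
next
  case (13 X)
  note T = functor_T[OF 13 refl refl]
  note ids = id_functor[OF functor_betweenD(4)[OF T]] id_functor[OF functor_betweenD(5)[OF T]]
  show ?case
    using 13 vcomp_nt_id[OF nat_between_id[OF T]] hcomp_nt_id[OF ids(1) T] hcomp_nt_id[OF T ids(2)]
    by (simp add: pcomp_unit comp_fun_id[OF T] T_nt_id)
qed

end

section \<open>Actions induced by pseudofunctors\<close>

lemma prod_cat_simps [simp]:
  "Ob (prod_cat C D) = Ob C \<times> Ob D" "Ar (prod_cat C D) = Ar C \<times> Ar D"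
  "Dom (prod_cat C D) (f, g) = (Dom C f, Dom D g)" "Cod (prod_cat C D) (f, g) = (Cod C f, Cod D g)"
  "Id (prod_cat C D) (a, b) = (Id C a, Id D b)"
  "(f', g') \<odot>\<^bsub>prod_cat C D\<^esub> (f, g) = (f' \<odot>\<^bsub>C\<^esub> f, g' \<odot>\<^bsub>D\<^esub> g)"
  by (simp_all add: prod_cat_def)

lemma category_prod:
  assumes "category C" "category D"
  shows "category (prod_cat C D)"
proof -
  interpret C: category C by fact
  interpret D: category D by fact
  show ?thesis
    by (rule category.intro) (auto simp: C.Cmp_assoc D.Cmp_assoc)
qed

lemma endo_moncat_simps [simp]:
  "mon_cat (endo_moncat L A) = hom_cat L A A" "tens_ob (endo_moncat L A) = comp1 L"
  "tens_ar (endo_moncat L A) = hcomp L" "tens_unit (endo_moncat L A) = id1 L A"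
  "mon_assoc (endo_moncat L A) = assoc L" "mon_lunit (endo_moncat L A) = lunit L"
  "mon_runit (endo_moncat L A) = runit L"
  by (simp_all add: endo_moncat_def)

lemma (in bicategory) monoidal_category_endo:
  assumes A: "A \<in> C0 K"
  shows "monoidal_category (endo_moncat K A)"
proof (rule monoidal_category.intro)
  have hom: "category (hom_cat K A A)"
    by (rule hom_category[OF A A])
  then show "category (mon_cat (endo_moncat K A))" by simp
  show "cat_functor (tens_fun (endo_moncat K A))"
  proof (rule cat_functor.intro)
    show "category (fdom (tens_fun (endo_moncat K A)))"
      using category_prod[OF hom hom] by (simp add: tens_fun_def)
  qed (use hom A in \<open>auto simp: tens_fun_def hcomp_id2 interchange composable_src_trg\<close>)
next
  fix X assume "X \<in> Ob (mon_cat (endo_moncat K A))"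
  then show "is_iso (mon_cat (endo_moncat K A)) (mon_lunit (endo_moncat K A) X) \<and>
      mon_lunit (endo_moncat K A) X \<in> homset (mon_cat (endo_moncat K A))
        (tens_ob (endo_moncat K A) (tens_unit (endo_moncat K A)) X) X"
    "is_iso (mon_cat (endo_moncat K A)) (mon_runit (endo_moncat K A) X) \<and>
      mon_runit (endo_moncat K A) X \<in> homset (mon_cat (endo_moncat K A))
        (tens_ob (endo_moncat K A) X (tens_unit (endo_moncat K A))) X"
    using lunit[of X] runit[of X] A by (auto simp: cell2_def iso2_def)
next
  fix X Y Z assume "X \<in> Ob (mon_cat (endo_moncat K A))" "Y \<in> Ob (mon_cat (endo_moncat K A))"
    "Z \<in> Ob (mon_cat (endo_moncat K A))"
  then show "is_iso (mon_cat (endo_moncat K A)) (mon_assoc (endo_moncat K A) Z Y X) \<and>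
      mon_assoc (endo_moncat K A) Z Y X \<in> homset (mon_cat (endo_moncat K A))
        (tens_ob (endo_moncat K A) (tens_ob (endo_moncat K A) Z Y) X)
        (tens_ob (endo_moncat K A) Z (tens_ob (endo_moncat K A) Y X))"
    using assoc[of X Y Z] by (auto simp: cell2_def iso2_def)
next
  fix f assume "f \<in> Ar (mon_cat (endo_moncat K A))"
  then show "mon_lunit (endo_moncat K A) (Cod (mon_cat (endo_moncat K A)) f)
      \<odot>\<^bsub>mon_cat (endo_moncat K A)\<^esub> tens_ar (endo_moncat K A)
        (Id (mon_cat (endo_moncat K A)) (tens_unit (endo_moncat K A))) f =
      f \<odot>\<^bsub>mon_cat (endo_moncat K A)\<^esub>
        mon_lunit (endo_moncat K A) (Dom (mon_cat (endo_moncat K A)) f)"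
    "mon_runit (endo_moncat K A) (Cod (mon_cat (endo_moncat K A)) f)
      \<odot>\<^bsub>mon_cat (endo_moncat K A)\<^esub> tens_ar (endo_moncat K A) f
        (Id (mon_cat (endo_moncat K A)) (tens_unit (endo_moncat K A))) =
      f \<odot>\<^bsub>mon_cat (endo_moncat K A)\<^esub>
        mon_runit (endo_moncat K A) (Dom (mon_cat (endo_moncat K A)) f)"
    using lunit_natural[of f] runit_natural[of f] by auto
next
  fix X Y assume "X \<in> Ob (mon_cat (endo_moncat K A))" "Y \<in> Ob (mon_cat (endo_moncat K A))"
  then show "tens_ar (endo_moncat K A) (Id (mon_cat (endo_moncat K A)) Y) (mon_lunit (endo_moncat K A) X)
      \<odot>\<^bsub>mon_cat (endo_moncat K A)\<^esub>
        mon_assoc (endo_moncat K A) Y (tens_unit (endo_moncat K A)) X =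
      tens_ar (endo_moncat K A) (mon_runit (endo_moncat K A) Y) (Id (mon_cat (endo_moncat K A)) X)"
    using triangle[of X Y] by auto
qed (auto simp: A assoc_natural pentagon)

text \<open>An action of \<open>L(A, A)\<close> amounts to a coherent family for the one-object bicategory
  \<open>endo_part L A\<close>.\<close>

definition endo_part :: "('o, 'm, 'c) bicat \<Rightarrow> 'o \<Rightarrow> ('o, 'm, 'c) bicat" where
  "endo_part L A = L\<lparr>C0 := {A}, C1 := Ob (hom_cat L A A), C2 := Ar (hom_cat L A A)\<rparr>"

lemma endo_part_simps [simp]:
  "C0 (endo_part L A) = {A}" "C1 (endo_part L A) = Ob (hom_cat L A A)"
  "C2 (endo_part L A) = Ar (hom_cat L A A)"
  "src (endo_part L A) = src L" "trg (endo_part L A) = trg L"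
  "dom2 (endo_part L A) = dom2 L" "cod2 (endo_part L A) = cod2 L"
  "id1 (endo_part L A) = id1 L" "comp1 (endo_part L A) = comp1 L" "id2 (endo_part L A) = id2 L"
  "vcomp (endo_part L A) = vcomp L" "hcomp (endo_part L A) = hcomp L"
  "assoc (endo_part L A) = assoc L" "lunit (endo_part L A) = lunit L"
  "runit (endo_part L A) = runit L"
  by (simp_all add: endo_part_def)

lemma hom_cat_endo_part [simp]: "hom_cat (endo_part L A) A A = hom_cat L A A"
  by (auto simp: hom_cat_def)

lemma (in bicategory) bicategory_endo_part:
  assumes A: "A \<in> C0 K"
  shows "bicategory (endo_part K A)"
proof (rule bicategory.intro, goal_cases)
  case (9 X Y Z)
  then show ?case using assoc[of X Y Z] by (auto simp: cell2_def iso2_def)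
next
  case (11 X)
  then show ?case using lunit[of X] A by (auto simp: cell2_def iso2_def)
next
  case (13 X)
  then show ?case using runit[of X] A by (auto simp: cell2_def iso2_def)
next
  case (12 \<zeta>) then show ?case using lunit_natural[of \<zeta>] by auto
next
  case (14 \<zeta>) then show ?case using runit_natural[of \<zeta>] by auto
next
  case (15 X Y Z W) then show ?case using pentagon[of X Y Z W] by auto
next
  case (16 X Y) then show ?case using triangle[of X Y] by auto
next
  case (3 A' B') then show ?case using hom_category[OF A A] by auto
qed (auto simp: A hcomp_id2 cell2_def interchange composable_src_trg assoc_natural)

lemma induced_action_simps [simp]:
  "fdom (act_fun (induced_action L G A)) = prod_cat (hom_cat L A A) (map0 G A)"
  "fcod (act_fun (induced_action L G A)) = map0 G A"
  "\<lbrakk>X \<in> C1 L; src L X = A; trg L X = A; M \<in> Ob (map0 G A)\<rbrakk> \<Longrightarrow>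
    act_ob (induced_action L G A) X M = fob (map1 G X) M"
  "\<lbrakk>\<zeta> \<in> C2 L; src L (dom2 L \<zeta>) = A; trg L (dom2 L \<zeta>) = A; f \<in> Ar (map0 G A)\<rbrakk> \<Longrightarrow>
    act_ar (induced_action L G A) \<zeta> f =
    ncmp (map2 G \<zeta>) (Cod (map0 G A) f) \<odot>\<^bsub>map0 G A\<^esub> far (map1 G (dom2 L \<zeta>)) f"
  "act_assoc (induced_action L G A) Y X M = ncmp (pcomp G Y X) M"
  "act_unit (induced_action L G A) M = ncmp (punit G A) M"
  by (simp_all add: induced_action_def)

section \<open>The action induced by a pseudofunctor to \<open>Cat\<close>\<close>

locale cat_pseudofunctor = pseudofunctor L Cat G
  for L :: "('p, 'n, 'd) bicat" and G ::
    "('p, 'n, 'd, ('o, 'a) cat, ('o, 'a, 'o, 'a) cfun, ('o, 'a, 'o, 'a) ntrans) pseudo"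
begin

lemma functor_map1:
  assumes "X \<in> C1 L"
  shows "functor_between (map0 G (src L X)) (map0 G (trg L X)) (map1 G X)"
  using map1[OF assms] by (auto intro: functor_betweenI)

lemma nat_between_map2:
  assumes "\<zeta> \<in> C2 L"
  shows "nat_between (map0 G (src L (dom2 L \<zeta>))) (map0 G (trg L (dom2 L \<zeta>)))
    (map1 G (dom2 L \<zeta>)) (map1 G (cod2 L \<zeta>)) (map2 G \<zeta>)"
  using map2[OF assms] functor_betweenD[OF functor_map1[of "dom2 L \<zeta>"]] assms
  by (auto simp: cell2_def intro!: nat_betweenI)

lemma nat_between_pcomp:
  assumes "X \<in> C1 L" "Y \<in> C1 L" "trg L X = src L Y"
  shows "nat_between (map0 G (src L X)) (map0 G (trg L Y))
    (comp_fun (map1 G Y) (map1 G X)) (map1 G (Y \<cdot>\<^bsub>L\<^esub> X)) (pcomp G Y X)"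
  using pcomp[OF assms] map1[OF assms(1)] map1[OF assms(2)]
  by (auto simp: cell2_def intro!: nat_betweenI)

lemma nat_between_punit:
  assumes "A \<in> C0 L"
  shows "nat_between (map0 G A) (map0 G A) (id_fun (map0 G A)) (map1 G (id1 L A)) (punit G A)"
  using punit[OF assms] by (auto simp: cell2_def intro!: nat_betweenI)

end

text \<open>The isomorphisms of an action live in the category acted on, whereas a pseudofunctor
  supplies invertible 2-cells of \<open>Cat\<close>; evaluation at an object connects the
  two.\<close>

lemma iso2_CatD:
  assumes "nat_between C D F G \<theta>" "iso2 Cat \<theta>" "a \<in> Ob C"
  shows "is_iso D (ncmp \<theta> a)"
proof -
  interpret \<theta>: nat_between C D F G \<theta> by fact
  obtain \<phi> where \<phi>: "nat_trans \<phi>" "ndom \<phi> = G" "ncod \<phi> = F"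
    "vcomp_nt \<phi> \<theta> = id_nt F" "vcomp_nt \<theta> \<phi> = id_nt G"
    using assms(2) by (auto simp: iso2_def is_iso_def)
  interpret \<phi>: nat_between C D G F \<phi> by (rule nat_betweenI) (simp_all add: \<phi>)
  show ?thesis
    using arg_cong[OF \<phi>(4), of "\<lambda>\<theta>. ncmp \<theta> a"] arg_cong[OF \<phi>(5), of "\<lambda>\<theta>. ncmp \<theta> a"] assms(3)
    by (intro \<theta>.F.D.is_isoI[of _ "ncmp \<phi> a"]) simp_all
qed

context cat_pseudofunctor
begin

text \<open>The coherence axioms are those of the pseudofunctor evaluated at an object. The work
  lies in functoriality in both variables together and in the joint naturality of the associativity,
  where naturality in the 1-cell and naturality in the object must be combined.\<close>

lemma category_action_induced:
  assumes A: "A \<in> C0 L"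
  shows "category_action (endo_moncat L A) (map0 G A) (induced_action L G A)"
proof -
  let ?D = "map0 G A" and ?a = "induced_action L G A" and ?H = "hom_cat L A A"
  interpret D: category ?D using map0[OF A] by simp
  have funct: "functor_between ?D ?D (map1 G X)" if "X \<in> C1 L" "src L X = A" "trg L X = A" for X
    using functor_map1[OF that(1)] that by simp
  have nt: "nat_between ?D ?D (map1 G (dom2 L \<zeta>)) (map1 G (cod2 L \<zeta>)) (map2 G \<zeta>)"
    if "\<zeta> \<in> C2 L" "src L (dom2 L \<zeta>) = A" "trg L (dom2 L \<zeta>) = A" for \<zeta>
    using nat_between_map2[OF that(1)] that by simp
  have pc: "nat_between ?D ?D (comp_fun (map1 G Y) (map1 G X)) (map1 G (Y \<cdot>\<^bsub>L\<^esub> X)) (pcomp G Y X)"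
    if "X \<in> C1 L" "src L X = A" "trg L X = A" "Y \<in> C1 L" "src L Y = A" "trg L Y = A" for X Y
    using nat_between_pcomp[of X Y] that by simp
  note pu = nat_between_punit[OF A]
  note [simp] = functor_between.fob_in[OF funct] functor_between.far_simps[OF funct] functor_between.far_Id_Cmp[OF funct]
    nat_between.ncmp_simps[OF nt]
  have cat_fun: "cat_functor (act_fun ?a)"
  proof (rule cat_functor.intro)
    show "category (fdom (act_fun ?a))"
      using category_prod[OF S.hom_category[OF A A] D.category_axioms] by simp
    show "category (fcod (act_fun ?a))" by (simp add: D.category_axioms)
    show "fob (act_fun ?a) \<in> Ob (fdom (act_fun ?a)) \<rightarrow>\<^sub>E Ob (fcod (act_fun ?a))"
      by (rule PiE_I) (simp add: induced_action_def mem_Times_iff case_prod_beta,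
          auto simp: induced_action_def)
    show "far (act_fun ?a) \<in> Ar (fdom (act_fun ?a)) \<rightarrow>\<^sub>E Ar (fcod (act_fun ?a))"
      by (rule PiE_I) (simp add: induced_action_def mem_Times_iff case_prod_beta,
          auto simp: induced_action_def)
    fix p assume "p \<in> Ar (fdom (act_fun ?a))"
    then show "Dom (fcod (act_fun ?a)) (far (act_fun ?a) p) =
          fob (act_fun ?a) (Dom (fdom (act_fun ?a)) p) \<and>
        Cod (fcod (act_fun ?a)) (far (act_fun ?a) p) =
          fob (act_fun ?a) (Cod (fdom (act_fun ?a)) p)"
      by (cases p) simp
  next
    fix p assume "p \<in> Ob (fdom (act_fun ?a))"
    then show "far (act_fun ?a) (Id (fdom (act_fun ?a)) p) =
        Id (fcod (act_fun ?a)) (fob (act_fun ?a) p)"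
      using functor_betweenD[OF funct] by (cases p) (simp add: map2_id2)
  next
    fix p q assume *: "p \<in> Ar (fdom (act_fun ?a))" "q \<in> Ar (fdom (act_fun ?a))"
      "Cod (fdom (act_fun ?a)) p = Dom (fdom (act_fun ?a)) q"
    obtain \<zeta> f \<xi> g where pq: "p = (\<zeta>, f)" "q = (\<xi>, g)" by (cases p, cases q)
    let ?X = "dom2 L \<zeta>" and ?X' = "dom2 L \<xi>" and ?M' = "Dom ?D g" and ?M'' = "Cod ?D g"
    have \<zeta>: "\<zeta> \<in> C2 L" "src L ?X = A" "trg L ?X = A" and \<xi>: "\<xi> \<in> C2 L" "src L ?X' = A" "trg L ?X' = A"
      and c: "cod2 L \<zeta> = ?X'" "Cod ?D f = ?M'" and f: "f \<in> Ar ?D" "g \<in> Ar ?D"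
      using * by (auto simp: pq)
    \<comment> \<open>Naturality of \<open>map2 G \<zeta>\<close> at \<open>g\<close> exchanges the
      two middle factors of the composite.\<close>
    note nat = nat_between.natural[OF nt[OF \<zeta>] f(2) refl refl, unfolded c]
    have "far (act_fun ?a) q \<odot>\<^bsub>?D\<^esub> far (act_fun ?a) p =
        ncmp (map2 G \<xi>) ?M'' \<odot>\<^bsub>?D\<^esub> (far (map1 G ?X') g \<odot>\<^bsub>?D\<^esub> ncmp (map2 G \<zeta>) ?M') \<odot>\<^bsub>?D\<^esub> far (map1 G ?X) f"
      using \<zeta> \<xi> c f by (simp add: pq D.Cmp_assoc)
    also have "\<dots> = far (act_fun ?a) (\<xi> \<bullet>\<^bsub>L\<^esub> \<zeta>, g \<odot>\<^bsub>?D\<^esub> f)"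
      unfolding nat using \<zeta> \<xi> c f nat_betweenD[OF nt[OF \<zeta>]] by (simp add: D.Cmp_assoc map2_vcomp)
    finally show "far (act_fun ?a) (q \<odot>\<^bsub>fdom (act_fun ?a)\<^esub> p) =
        far (act_fun ?a) q \<odot>\<^bsub>fcod (act_fun ?a)\<^esub> far (act_fun ?a) p"
      by (simp add: pq)
  qed
  show ?thesis
  proof (intro category_action.intro category_action_axioms.intro, goal_cases)
    case 1 show ?case by (rule S.monoidal_category_endo[OF A])
  next
    case 2 show ?case by (rule D.category_axioms)
  next
    case 3 show ?case by (rule cat_fun)
  next
    case 4 show ?case by simp
  next
    case 5 show ?case by simp
  next
    case (6 X Y M)
    then show ?case
      using iso2_CatD[OF pc, of X Y M] pcomp[of X Y] nat_between.ncmp_simps[OF pc, of X Y M]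
        functor_betweenD[OF funct]
      by simp
  next
    case (7 \<zeta> \<xi> f)
    let ?X = "dom2 L \<zeta>" and ?Y = "dom2 L \<xi>" and ?X' = "cod2 L \<zeta>" and ?Y' = "cod2 L \<xi>"
    let ?M = "Dom ?D f" and ?M' = "Cod ?D f"
    have \<zeta>: "\<zeta> \<in> C2 L" "src L ?X = A" "trg L ?X = A" and \<xi>: "\<xi> \<in> C2 L" "src L ?Y = A" "trg L ?Y = A"
      and f: "f \<in> Ar ?D"
      using 7 by auto
    have X: "?X \<in> C1 L" "?Y \<in> C1 L" "?X' \<in> C1 L" "?Y' \<in> C1 L" "src L ?X' = A" "trg L ?X' = A"
      "src L ?Y' = A" "trg L ?Y' = A"
      using \<zeta> \<xi> by simp_all
    note nts = nat_betweenD[OF nt[OF \<zeta>]] nat_betweenD[OF nt[OF \<xi>]] nat_betweenD[OF pc[of ?X ?Y]]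
      nat_betweenD[OF pc[of ?X' ?Y']]
    note pc' = nat_between.ncmp_simps[OF pc]
    \<comment> \<open>\<open>pcomp_natural\<close> accounts for the 1-cells alone. Naturality in
      \<open>f\<close> is added afterwards, from \<open>pcomp G ?Y ?X\<close> being a natural
      transformation.\<close>
    have nat: "ncmp (pcomp G ?Y' ?X') ?M' \<odot>\<^bsub>?D\<^esub>
          (ncmp (map2 G \<xi>) (fob (map1 G ?X') ?M') \<odot>\<^bsub>?D\<^esub> far (map1 G ?Y) (ncmp (map2 G \<zeta>) ?M')) =
        ncmp (map2 G (\<xi> \<star>\<^bsub>L\<^esub> \<zeta>)) ?M' \<odot>\<^bsub>?D\<^esub> ncmp (pcomp G ?Y ?X) ?M'"
      using arg_cong[OF pcomp_natural[OF \<zeta>(1) \<xi>(1)], of "\<lambda>\<theta>. ncmp \<theta> ?M'"] \<zeta> \<xi> X f nts by simp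
    have "ncmp (pcomp G ?Y' ?X') ?M' \<odot>\<^bsub>?D\<^esub> act_ar ?a \<xi> (act_ar ?a \<zeta> f) =
        (ncmp (pcomp G ?Y' ?X') ?M' \<odot>\<^bsub>?D\<^esub>
          (ncmp (map2 G \<xi>) (fob (map1 G ?X') ?M') \<odot>\<^bsub>?D\<^esub> far (map1 G ?Y) (ncmp (map2 G \<zeta>) ?M'))) \<odot>\<^bsub>?D\<^esub>
        far (map1 G ?Y) (far (map1 G ?X) f)"
      using \<zeta> \<xi> X f nts by (simp add: D.Cmp_assoc pc')
    also have "\<dots> = ncmp (map2 G (\<xi> \<star>\<^bsub>L\<^esub> \<zeta>)) ?M' \<odot>\<^bsub>?D\<^esub>
        (ncmp (pcomp G ?Y ?X) ?M' \<odot>\<^bsub>?D\<^esub> far (comp_fun (map1 G ?Y) (map1 G ?X)) f)"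
      unfolding nat using \<zeta> \<xi> X f nts by (simp add: D.Cmp_assoc pc')
    also have "\<dots> = act_ar ?a (\<xi> \<star>\<^bsub>L\<^esub> \<zeta>) f \<odot>\<^bsub>?D\<^esub> ncmp (pcomp G ?Y ?X) ?M"
      using \<zeta> \<xi> X f nts nat_between.natural[OF pc f refl refl, of ?X ?Y, symmetric]
      by (simp add: D.Cmp_assoc pc')
    finally show ?case by simp
  next
    case (8 M)
    then show ?case
      using iso2_CatD[OF pu, of M] punit[OF A] nat_between.ncmp_simps[OF pu, of M] A by simp
  next
    case (9 f)
    then show ?case
      using nat_between.natural[OF pu, of f] nat_betweenD[OF pu] A by (simp add: map2_id2)
  next
    case (10 X Y Z M)
    then have X: "X \<in> C1 L" "src L X = A" "trg L X = A" and Y: "Y \<in> C1 L" "src L Y = A" "trg L Y = A"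
      and Z: "Z \<in> C1 L" "src L Z = A" "trg L Z = A" and M: "M \<in> Ob ?D" by auto
    have ass: "assoc L Z Y X \<in> C2 L" "dom2 L (assoc L Z Y X) = (Z \<cdot>\<^bsub>L\<^esub> Y) \<cdot>\<^bsub>L\<^esub> X"
      "cod2 L (assoc L Z Y X) = Z \<cdot>\<^bsub>L\<^esub> Y \<cdot>\<^bsub>L\<^esub> X"
      using S.assoc[of X Y Z] X Y Z by (auto simp: cell2_def)
    note nts = nat_betweenD[OF pc[OF X Y]] nat_betweenD[OF pc[OF Y Z]]
      nat_betweenD[OF pc[OF _ _ _ Z, of "Y \<cdot>\<^bsub>L\<^esub> X"]] nat_betweenD[OF pc[OF X, of "Z \<cdot>\<^bsub>L\<^esub> Y"]]
      functor_betweenD[OF funct[OF X]] functor_betweenD[OF funct[OF Y]] functor_betweenD[OF funct[OF Z]]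
    note pc' = nat_between.ncmp_simps[OF pc] nat_between.ncmp_simps[OF nt[OF ass(1)], unfolded ass]
    show ?case
      using arg_cong[OF pcomp_assoc[of X Y Z], of "\<lambda>\<theta>. ncmp \<theta> M"] X Y Z M nts ass
      by (simp add: map2_id2 pc')
  next
    case (11 X M)
    then have X: "X \<in> C1 L" "src L X = A" "trg L X = A" and M: "M \<in> Ob ?D" by auto
    have lu: "lunit L X \<in> C2 L" "dom2 L (lunit L X) = id1 L A \<cdot>\<^bsub>L\<^esub> X" "cod2 L (lunit L X) = X"
      using S.lunit[of X] X by (auto simp: cell2_def)
    note nts = nat_betweenD[OF pc[OF X, of "id1 L A"]] functor_betweenD[OF funct[OF X]]
      nat_betweenD[OF pu]
    note pc' = nat_between.ncmp_simps[OF pc] nat_between.ncmp_simps[OF pu]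
      nat_between.ncmp_simps[OF nt[OF lu(1)], unfolded lu]
    show ?case
      using arg_cong[OF pcomp_lunit[of X], of "\<lambda>\<theta>. ncmp \<theta> M"] X M A nts lu
      by (simp add: pc')
  next
    case (12 X M)
    then have X: "X \<in> C1 L" "src L X = A" "trg L X = A" and M: "M \<in> Ob ?D" by auto
    have ru: "runit L X \<in> C2 L" "dom2 L (runit L X) = X \<cdot>\<^bsub>L\<^esub> id1 L A" "cod2 L (runit L X) = X"
      using S.runit[of X] X by (auto simp: cell2_def)
    note nts = nat_betweenD[OF pc[OF _ _ _ X, of "id1 L A"]] functor_betweenD[OF funct[OF X]]
      nat_betweenD[OF pu]
    note pc' = nat_between.ncmp_simps[OF pc] nat_between.ncmp_simps[OF pu]
      nat_between.ncmp_simps[OF nt[OF ru(1)], unfolded ru]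
    show ?case
      using arg_cong[OF pcomp_runit[of X], of "\<lambda>\<theta>. ncmp \<theta> M"] X M A nts ru
      by (simp add: pc' map2_id2)
  qed
qed

end

section \<open>2-cells of the Eilenberg-Moore 2-category acting on modules\<close>

text \<open>Only the target \<open>P\<close> is an argument, since the source 1-cell is the domain
  of \<open>\<rho>\<close>. At the regular module this is the extension of \<open>\<rho>\<close>
  along the unit to a map W B -> P B, as for arrows of a Kleisli category.\<close>

definition em_act :: "('o, 'm, 'c) bicat \<Rightarrow> 'm \<Rightarrow> 'c \<Rightarrow> ('m, 'c) lmod \<Rightarrow> 'c" where
  "em_act K P \<rho> M = (P \<rhd>\<^bsub>K\<^esub> lact M) \<bullet>\<^bsub>K\<^esub> (\<rho> \<lhd>\<^bsub>K\<^esub> lcar M)"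

lemma regular_mod_simps [simp]:
  "lcar (regular_mod B) = mcar B" "lact (regular_mod B) = mmul B"
  by (simp_all add: regular_mod_def)

lemma (in monad_in) regular_module [simp]: "left_module K B (regular_mod B)"
  using mcar mmul mmul_assoc mmul_mone by unfold_locales simp_all

text \<open>Only the shape W -> P B is recorded. Compatibility with the structure cells of
  \<open>W\<close> and \<open>P\<close> is a separate matter: it governs left linearity of the
  action and enters in \<open>em_act_linear\<close>, while naturality and composition are
  formal.\<close>

locale em_cell = two_category K + B: monad_in K B
  for K :: "('o, 'm, 'c) bicat" (structure) and B +
  fixes W P \<rho>
  assumes cells [simp]: "W \<in> C1 K" "src K W = mobj B" "P \<in> C1 K" "src K P = mobj B"
    and trg_W: "trg K W = trg K P"
    and rho [simp]: "\<rho> \<in> C2 K" "dom2 K \<rho> = W" "cod2 K \<rho> = P \<cdot> mcar B"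
begin

text \<open>Not a global simplification rule: for \<open>W = P\<close> it would rewrite a term to itself.\<close>

context notes trg_W [simp]
begin

lemma em_act_simps [simp]:
  assumes "left_module K B M"
  shows "em_act K P \<rho> M \<in> C2 K" "dom2 K (em_act K P \<rho> M) = W \<cdot> lcar M"
    "cod2 K (em_act K P \<rho> M) = P \<cdot> lcar M"
proof -
  interpret M: left_module K B M by fact
  show "em_act K P \<rho> M \<in> C2 K" "dom2 K (em_act K P \<rho> M) = W \<cdot> lcar M"
    "cod2 K (em_act K P \<rho> M) = P \<cdot> lcar M"
    by (simp_all add: em_act_def)
qed

text \<open>The unit moves past \<open>\<rho>\<close> by exchange and is then cancelled by the
  multiplication. Consequently an Eilenberg-Moore 2-cell is determined by its action on the regular
  module.\<close>

lemma em_act_regular: "em_act K P \<rho> (regular_mod B) \<bullet> (W \<rhd> mone B) = \<rho>"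
proof -
  have 1: "(\<rho> \<lhd> mcar B) \<bullet> (W \<rhd> mone B) = ((P \<cdot> mcar B) \<rhd> mone B) \<bullet> \<rho>"
    using exchange[of "mone B" \<rho>] by simp
  have 2: "(P \<rhd> mmul B) \<bullet> ((P \<cdot> mcar B) \<rhd> mone B) = id2 K (P \<cdot> mcar B)"
    using arg_cong[OF B.mmul_mone(2), of "\<lambda>z. P \<rhd> z"] by (simp add: lwhisker_vcomp)
  show ?thesis
    using vcomp_extend[OF 2, of \<rho>] by (simp add: em_act_def vcomp_assoc 1)
qed

text \<open>Exchange moves the action of \<open>M\<close> past \<open>\<rho>\<close>, and
  associativity of \<open>M\<close> replaces two actions by a multiplication. For the regular module
  this is right linearity over \<open>B\<close>; in general it relates the action on
  \<open>M\<close> to the one on \<open>B\<close>.\<close>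

lemma em_act_lact:
  assumes "left_module K B M"
  shows "em_act K P \<rho> M \<bullet> (W \<rhd> lact M) = (P \<rhd> lact M) \<bullet> (em_act K P \<rho> (regular_mod B) \<lhd> lcar M)"
proof -
  interpret M: left_module K B M by fact
  have 1: "(\<rho> \<lhd> lcar M) \<bullet> (W \<rhd> lact M) = ((P \<cdot> mcar B) \<rhd> lact M) \<bullet> (\<rho> \<lhd> (mcar B \<cdot> lcar M))"
    using exchange[of "lact M" \<rho>] by simp
  have 2: "(P \<rhd> lact M) \<bullet> ((P \<cdot> mcar B) \<rhd> lact M) = (P \<rhd> lact M) \<bullet> (P \<rhd> (mmul B \<lhd> lcar M))"
    using arg_cong[OF M.lact_mmul, of "\<lambda>z. P \<rhd> z"] by (simp add: lwhisker_vcomp)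
  show ?thesis
    by (simp add: em_act_def norm 1 vcomp_cong3[OF 2])
qed

text \<open>Exchange moves \<open>lund f\<close> past \<open>\<rho>\<close>, and linearity moves it
  past the action. This is the source of naturality in the module for families induced by
  cocycles.\<close>

lemma em_act_natural:
  assumes "left_linear K B f"
  shows "em_act K P \<rho> (lcod f) \<bullet> (W \<rhd> lund f) = (P \<rhd> lund f) \<bullet> em_act K P \<rho> (ldom f)"
proof -
  interpret f: left_linear K B f by fact
  interpret M: left_module K B "ldom f" by (rule f.modules)
  interpret N: left_module K B "lcod f" by (rule f.modules)
  have 1: "(\<rho> \<lhd> lcar (lcod f)) \<bullet> (W \<rhd> lund f) = ((P \<cdot> mcar B) \<rhd> lund f) \<bullet> (\<rho> \<lhd> lcar (ldom f))"
    using exchange[of "lund f" \<rho>] by simp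
  have 2: "(P \<rhd> lact (lcod f)) \<bullet> ((P \<cdot> mcar B) \<rhd> lund f) = (P \<rhd> lund f) \<bullet> (P \<rhd> lact (ldom f))"
    using arg_cong[OF f.linear, of "\<lambda>z. P \<rhd> z"] by (simp add: lwhisker_vcomp)
  show ?thesis
    by (simp add: em_act_def norm 1 vcomp_cong3[OF 2])
qed

text \<open>The cell acting on the left-hand side is the Eilenberg-Moore composite of
  \<open>\<sigma>\<close> and \<open>\<rho>\<close>, by \<open>em_comp_eq\<close>, so this is
  functoriality of the action. It rests on \<open>em_act_lact\<close> for
  \<open>\<sigma>\<close>.\<close>

lemma em_act_comp:
  assumes "em_cell K B P Q \<sigma>" "left_module K B M"
  shows "em_act K Q (em_act K Q \<sigma> (regular_mod B) \<bullet> \<rho>) M = em_act K Q \<sigma> M \<bullet> em_act K P \<rho> M"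
proof -
  interpret s: em_cell K B P Q \<sigma> by fact
  note [simp] = s.trg_W
  interpret M: left_module K B M by fact
  note 1 = vcomp_cong3[OF s.em_act_lact[OF assms(2)], of "\<rho> \<lhd> lcar M"]
  show ?thesis
    using 1 by (simp add: em_act_def[of K P] em_act_def[of K Q "_ \<bullet> \<rho>"] rwhisker_vcomp assms(2))
qed

text \<open>With \<open>\<theta>\<close> and \<open>\<theta>'\<close> the image of a horizontal
  composite from \<open>L\<close>, this carries naturality of a cocycle in its 1-cells over to the
  induced family.\<close>

lemma em_act_whisker:
  assumes "em_cell K B W' P' \<rho>'" "\<theta> \<in> cell2 K W W'" "\<theta>' \<in> cell2 K P P'"
    and "\<rho>' \<bullet> \<theta> = (\<theta>' \<lhd> mcar B) \<bullet> \<rho>" "left_module K B M"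
  shows "em_act K P' \<rho>' M \<bullet> (\<theta> \<lhd> lcar M) = (\<theta>' \<lhd> lcar M) \<bullet> em_act K P \<rho> M"
proof -
  interpret r: em_cell K B W' P' \<rho>' by fact
  note [simp] = r.trg_W
  interpret M: left_module K B M by fact
  have [simp]: "\<theta> \<in> C2 K" "dom2 K \<theta> = W" "cod2 K \<theta> = W'" "\<theta>' \<in> C2 K" "dom2 K \<theta>' = P" "cod2 K \<theta>' = P'"
    using assms(2,3) by (auto simp: cell2_def)
  have [simp]: "trg K P' = trg K P"
    using dom_cod[of \<theta>'] by simp
  have 1: "(\<rho>' \<lhd> lcar M) \<bullet> (\<theta> \<lhd> lcar M) = (\<theta>' \<lhd> (mcar B \<cdot> lcar M)) \<bullet> (\<rho> \<lhd> lcar M)"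
    using arg_cong[OF assms(4), of "\<lambda>z. z \<lhd> lcar M"] by (simp add: rwhisker_vcomp)
  have 2: "(P' \<rhd> lact M) \<bullet> (\<theta>' \<lhd> (mcar B \<cdot> lcar M)) = (\<theta>' \<lhd> lcar M) \<bullet> (P \<rhd> lact M)"
    using exchange[of "lact M" \<theta>'] by simp
  show ?thesis
    by (simp add: em_act_def vcomp_assoc 1 vcomp_cong3[OF 2])
qed

text \<open>A converse to \<open>em_act_whisker\<close>: precomposing with the unit undoes the
  passage from a 2-cell to its action, and the unit moves past \<open>\<theta>\<close> by exchange.
  It suffices to know the equation on the regular module.\<close>

lemma em_whisker_of_act:
  assumes "em_cell K B W' P' \<rho>'" "\<theta> \<in> cell2 K W W'" "\<theta>' \<in> cell2 K P P'"
    and "em_act K P' \<rho>' (regular_mod B) \<bullet> (\<theta> \<lhd> mcar B) =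
      (\<theta>' \<lhd> mcar B) \<bullet> em_act K P \<rho> (regular_mod B)"
  shows "\<rho>' \<bullet> \<theta> = (\<theta>' \<lhd> mcar B) \<bullet> \<rho>"
proof -
  interpret r: em_cell K B W' P' \<rho>' by fact
  note [simp] = r.trg_W
  have [simp]: "\<theta> \<in> C2 K" "dom2 K \<theta> = W" "cod2 K \<theta> = W'" "\<theta>' \<in> C2 K" "dom2 K \<theta>' = P" "cod2 K \<theta>' = P'"
    using assms(2,3) by (auto simp: cell2_def)
  have [simp]: "trg K P' = trg K P"
    using dom_cod[of \<theta>'] by simp
  have 1: "(\<theta> \<lhd> mcar B) \<bullet> (W \<rhd> mone B) = (W' \<rhd> mone B) \<bullet> \<theta>"
    using exchange[of "mone B" \<theta>] by simp
  have "\<rho>' \<bullet> \<theta> = em_act K P' \<rho>' (regular_mod B) \<bullet> (W' \<rhd> mone B) \<bullet> \<theta>"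
    using vcomp_extend[OF r.em_act_regular, of \<theta>] by simp
  also have "\<dots> = (\<theta>' \<lhd> mcar B) \<bullet> em_act K P \<rho> (regular_mod B) \<bullet> (W \<rhd> mone B)"
    by (simp add: vcomp_cong3[OF assms(4)] flip: 1)
  finally show ?thesis
    by (simp add: em_act_regular)
qed

end

end

section \<open>Left linear maps and Eilenberg-Moore 2-cells\<close>

context two_category
begin

text \<open>The Eilenberg-Moore identity acts trivially by the unit law of \<open>M\<close>;
  together with \<open>em_act_comp\<close> this makes inverse 2-cells act by inverse maps.\<close>

lemma em_act_one:
  assumes "monad_in K B" "left_module K B M" "P \<in> C1 K" "src K P = mobj B"
  shows "em_act K P (P \<rhd> mone B) M = id2 K (P \<cdot> lcar M)"
proof -
  interpret B: monad_in K B by fact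
  interpret M: left_module K B M by fact
  show ?thesis
    using arg_cong[OF M.lact_mone, of "\<lambda>z. P \<rhd> z"] assms by (simp add: em_act_def lwhisker_vcomp)
qed

lemma em_cellI:
  assumes "monad_1cell K X" "monad_1cell K Y" "m1src X = B" "m1src Y = B" "m1trg X = m1trg Y"
    and "\<rho> \<in> cell2 K (und1 X) (und1 Y \<cdot> mcar B)"
  shows "em_cell K B (und1 X) (und1 Y) \<rho>"
proof -
  interpret X: monad_1cell K X by fact
  interpret Y: monad_1cell K Y by fact
  interpret B: monad_in K B using X.monads assms by simp
  show ?thesis
    using assms by unfold_locales (auto simp: cell2_def)
qed

text \<open>\<open>em_act_lact\<close> reduces linearity on \<open>M\<close> to the
  \<open>em_2cell\<close> equation whiskered with the carrier of \<open>M\<close>; associativity of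
  \<open>M\<close> and exchange with \<open>str Y\<close> then rearrange the other side.\<close>

lemma em_act_linear:
  assumes "monad_1cell K X" "monad_1cell K Y" "m1src X = B" "m1src Y = B" "m1trg X = m1trg Y"
    and "em_2cell K X Y \<rho>" "left_module K B M"
  shows "left_linear K (m1trg Y) \<lparr>ldom = tmod K X M, lcod = tmod K Y M, lund = em_act K (und1 Y) \<rho> M\<rparr>"
proof -
  interpret X: monad_1cell K X by fact
  interpret Y: monad_1cell K Y by fact
  interpret B: monad_in K B using X.monads assms by simp
  interpret B': monad_in K "m1trg Y" by (rule Y.monads)
  interpret M: left_module K B M by fact
  interpret em_cell K B "und1 X" "und1 Y" \<rho>
    by (rule em_cellI) (use assms in \<open>simp_all add: em_2cell_def Let_def\<close>)
  note [simp] = assms(3-5)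
  let ?\<psi> = "str X" and ?\<psi>' = "str Y" and ?M = "lcar M" and ?B' = "mcar (m1trg Y)"
  have "em_act K (und1 Y) \<rho> (regular_mod B) \<bullet> ?\<psi> =
      (und1 Y \<rhd> mmul B) \<bullet> (?\<psi>' \<lhd> mcar B) \<bullet> (?B' \<rhd> \<rho>)"
    using assms(6) by (simp add: em_2cell_def Let_def em_act_def vcomp_assoc)
  from arg_cong[OF this, of "\<lambda>z. z \<lhd> ?M"]
  have 1: "(em_act K (und1 Y) \<rho> (regular_mod B) \<lhd> ?M) \<bullet> (?\<psi> \<lhd> ?M) =
      (und1 Y \<rhd> (mmul B \<lhd> ?M)) \<bullet> (?\<psi>' \<lhd> (mcar B \<cdot> ?M)) \<bullet> (?B' \<rhd> (\<rho> \<lhd> ?M))"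
    by (simp add: rwhisker_vcomp)
  have 2: "(und1 Y \<rhd> lact M) \<bullet> (und1 Y \<rhd> (mmul B \<lhd> ?M)) =
      (und1 Y \<rhd> lact M) \<bullet> ((und1 Y \<cdot> mcar B) \<rhd> lact M)"
    using arg_cong[OF M.lact_mmul, of "\<lambda>z. und1 Y \<rhd> z"] by (simp add: lwhisker_vcomp)
  have 3: "((und1 Y \<cdot> mcar B) \<rhd> lact M) \<bullet> (?\<psi>' \<lhd> (mcar B \<cdot> ?M)) =
      (?\<psi>' \<lhd> ?M) \<bullet> ((?B' \<cdot> und1 Y) \<rhd> lact M)"
    using exchange[of "lact M" ?\<psi>'] by simp
  have "em_act K (und1 Y) \<rho> M \<bullet> lact (tmod K X M) =
      (und1 Y \<rhd> lact M) \<bullet> (em_act K (und1 Y) \<rho> (regular_mod B) \<lhd> ?M) \<bullet> (?\<psi> \<lhd> ?M)"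
    using vcomp_cong3[OF em_act_lact[OF assms(7)], of "?\<psi> \<lhd> ?M"] by (simp add: assms(7))
  also have "\<dots> = lact (tmod K Y M) \<bullet> (?B' \<rhd> em_act K (und1 Y) \<rho> M)"
    unfolding 1 by (simp add: vcomp_cong3[OF 2] vcomp_cong3[OF 3] em_act_def norm)
  finally show ?thesis
    using tmod_module[OF assms(1)] tmod_module[OF assms(2)]
    by (intro left_linear.intro) (simp_all add: assms(7) cell2_def)
qed

text \<open>A converse to \<open>em_act_linear\<close> at the regular module, obtained by
  restricting the linearity equation along the unit. The last hypothesis says that \<open>h\<close>
  is the extension of its own restriction, which is how right linearity enters.\<close>

lemma em_2cell_of_linear:
  assumes "monad_1cell K X" "monad_1cell K Y" "m1src X = B" "m1src Y = B" "m1trg X = m1trg Y"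
    and "left_linear K (m1trg Y)
      \<lparr>ldom = tmod K X (regular_mod B), lcod = tmod K Y (regular_mod B), lund = h\<rparr>"
    and "h = em_act K (und1 Y) (h \<bullet> (und1 X \<rhd> mone B)) (regular_mod B)"
  shows "em_2cell K X Y (h \<bullet> (und1 X \<rhd> mone B))"
proof -
  interpret X: monad_1cell K X by fact
  interpret Y: monad_1cell K Y by fact
  interpret B: monad_in K B using X.monads assms by simp
  interpret B': monad_in K "m1trg Y" by (rule Y.monads)
  interpret h: left_linear K "m1trg Y"
    "\<lparr>ldom = tmod K X (regular_mod B), lcod = tmod K Y (regular_mod B), lund = h\<rparr>" by fact
  note [simp] = assms(3-5)
  have h [simp]: "h \<in> C2 K" "dom2 K h = und1 X \<cdot> mcar B" "cod2 K h = und1 Y \<cdot> mcar B"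
    using h.lin_simps by simp_all
  let ?\<rho> = "h \<bullet> (und1 X \<rhd> mone B)" and ?B' = "mcar (m1trg Y)"
  have lin: "h \<bullet> (und1 X \<rhd> mmul B) \<bullet> (str X \<lhd> mcar B) =
      (und1 Y \<rhd> mmul B) \<bullet> (str Y \<lhd> mcar B) \<bullet> (?B' \<rhd> h)"
    using h.linear by (simp add: vcomp_assoc)
  have 1: "(str X \<lhd> mcar B) \<bullet> ((?B' \<cdot> und1 X) \<rhd> mone B) = ((und1 X \<cdot> mcar B) \<rhd> mone B) \<bullet> str X"
    using exchange[of "mone B" "str X"] by simp
  have 2: "(und1 X \<rhd> mmul B) \<bullet> ((und1 X \<cdot> mcar B) \<rhd> mone B) = id2 K (und1 X \<cdot> mcar B)"
    using arg_cong[OF B.mmul_mone(2), of "\<lambda>z. und1 X \<rhd> z"] by (simp add: lwhisker_vcomp)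
  have "(und1 Y \<rhd> mmul B) \<bullet> (str Y \<lhd> mcar B) \<bullet> (?B' \<rhd> ?\<rho>) =
      (h \<bullet> (und1 X \<rhd> mmul B) \<bullet> (str X \<lhd> mcar B)) \<bullet> ((?B' \<cdot> und1 X) \<rhd> mone B)"
    unfolding lin by (simp add: norm)
  \<comment> \<open>This is the common value of the two sides of the \<open>em_2cell\<close>
    equation: left linearity of \<open>h\<close> leads to it from one side, the hypothesis that
    \<open>h\<close> is an extension from the other.\<close>
  also have "\<dots> = h \<bullet> str X"
    by (simp add: vcomp_assoc 1 vcomp_extend[OF 2])
  also have "\<dots> = (und1 Y \<rhd> mmul B) \<bullet> (?\<rho> \<lhd> mcar B) \<bullet> str X"
    by (subst assms(7)) (simp add: em_act_def vcomp_assoc rwhisker_vcomp)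
  finally show ?thesis
    by (simp add: em_2cell_def Let_def cell2_def)
qed

end

section \<open>Restriction to the endomorphisms of a 0-cell\<close>

lemma endo_moncat_endo_part [simp]: "endo_moncat (endo_part L A) A = endo_moncat L A"
  by (simp add: endo_moncat_def)

lemma T_pseudo_endo_part [simp]: "T_pseudo K (endo_part L A) F s = T_pseudo K L F s"
  by (simp add: T_pseudo_def s_mor_def)

lemma induced_action_endo_part [simp]: "induced_action (endo_part L A) G A = induced_action L G A"
  by (simp add: induced_action_def)

lemma s_mor_endo_part [simp]: "s_mor K (endo_part L A) F s = s_mor K L F s"
  by (intro ext) (simp add: s_mor_def)

context quasi_over_monads
begin

lemma quasi_endo_part:
  assumes A: "A \<in> C0 L"
  shows "quasi_over_monads K (endo_part L A) F"
proof (intro quasi_over_monads.intro quasi_over_monads_axioms.intro)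
  show "two_category K" by (rule two_category_axioms)
  show "bicategory (endo_part L A)" by (rule L.bicategory_endo_part[OF A])
  show "quasi_2functor (endo_part L A) (Mnd K) F"
    using A F.map1_id1[OF A]
    by (intro quasi_2functor.intro quasi_2functor_axioms.intro locally_functorial.intro)
      (auto simp: F.map2 F.map2_vcomp F.map2_hcomp F.map1_comp1 simp del: Mnd_simps(8))
  show "unit_strict (endo_part L A)"
    using strict_units by (simp add: unit_strict_def)
qed

text \<open>The two-step arrow part of the induced action collapses to one horizontal composite by
  \<open>hcomp_rl\<close>. It is the same for every family \<open>t\<close>, so it can be computed
  before anything is known about \<open>t\<close>.\<close>

lemma act_ar_T:
  assumes "\<zeta> \<in> C2 L" "src L (dom2 L \<zeta>) = A" "trg L (dom2 L \<zeta>) = A" "left_linear K (map0 F A) f"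
  shows "act_ar (induced_action L (T_pseudo K L F t) A) \<zeta> f =
      \<lparr>ldom = tmod K (map1 F (dom2 L \<zeta>)) (ldom f), lcod = tmod K (map1 F (cod2 L \<zeta>)) (lcod f),
       lund = und2 (map2 F \<zeta>) \<star> lund f\<rparr>"
    and "left_linear K (map0 F A)
      \<lparr>ldom = tmod K (map1 F (dom2 L \<zeta>)) (ldom f), lcod = tmod K (map1 F (cod2 L \<zeta>)) (lcod f),
       lund = und2 (map2 F \<zeta>) \<star> lund f\<rparr>"
proof -
  interpret f: left_linear K "map0 F A" f by fact
  interpret M: left_module K "map0 F A" "ldom f" by (rule f.modules)
  interpret N: left_module K "map0 F A" "lcod f" by (rule f.modules)
  have A: "A \<in> C0 L" using assms(1,2) by auto
  have 1: "(und2 (map2 F \<zeta>) \<lhd> lcar (lcod f)) \<bullet> (und1 (map1 F (dom2 L \<zeta>)) \<rhd> lund f) =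
      und2 (map2 F \<zeta>) \<star> lund f"
    using hcomp_rl[of "lund f" "und2 (map2 F \<zeta>)"] assms by simp
  then show "act_ar (induced_action L (T_pseudo K L F t) A) \<zeta> f =
      \<lparr>ldom = tmod K (map1 F (dom2 L \<zeta>)) (ldom f), lcod = tmod K (map1 F (cod2 L \<zeta>)) (lcod f),
       lund = und2 (map2 F \<zeta>) \<star> lund f\<rparr>"
    using assms by simp
  show "left_linear K (map0 F A)
      \<lparr>ldom = tmod K (map1 F (dom2 L \<zeta>)) (ldom f), lcod = tmod K (map1 F (cod2 L \<zeta>)) (lcod f),
       lund = und2 (map2 F \<zeta>) \<star> lund f\<rparr>"
    using left_linear_comp[of "map0 F A"
        "\<lparr>ldom = tmod K (map1 F (dom2 L \<zeta>)) (ldom f), lcod = tmod K (map1 F (dom2 L \<zeta>)) (lcod f),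
          lund = und1 (map1 F (dom2 L \<zeta>)) \<rhd> lund f\<rparr>"
        "\<lparr>ldom = tmod K (map1 F (dom2 L \<zeta>)) (lcod f), lcod = tmod K (map1 F (cod2 L \<zeta>)) (lcod f),
          lund = und2 (map2 F \<zeta>) \<lhd> lcar (lcod f)\<rparr>"]
      left_linear_T_nt[of "map2 F \<zeta>" "lcod f"] left_linear_whisker[of "map1 F (dom2 L \<zeta>)" f]
      assms A 1 by simp
qed

text \<open>Taking underlying 2-cells turns the axioms of an action into coherence conditions on
  \<open>t\<close>. The joint naturality axiom is specialized twice, once with identities of 1-cells
  and once with an identity of a module.\<close>

lemma coherent_of_action:
  assumes A: "A \<in> C0 L"
    and act: "category_action (endo_moncat L A) (Mod K (map0 F A))
      (induced_action L (T_pseudo K L F t) A)"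
  shows "coherent_assoc_family K (endo_part L A) F t"
proof -
  let ?a = "induced_action L (T_pseudo K L F t) A"
  interpret category_action "endo_moncat L A" "Mod K (map0 F A)" ?a by fact
  have id: "left_linear K (map0 F A) \<lparr>ldom = M, lcod = M, lund = id2 K (lcar M)\<rparr>"
    if "left_module K (map0 F A) M" for M
    using left_linear_id[of "map0 F A" M] A that by simp
  have s: "left_linear K (map0 F A) (s_mor K L F t Y X M)" 
    if "X \<in> C1 L" "src L X = A" "trg L X = A" "Y \<in> C1 L" "src L Y = A" "trg L Y = A"
      "left_module K (map0 F A) M" for X Y M
    using act_assoc[of X Y M] that by simp
  show ?thesis
  proof (rule coherent_assoc_family.intro, goal_cases)
    case (1 X Y M)
    then show ?case using act_assoc[of X Y M] by simp
  next
    case (2 X Y f)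
    then have X: "X \<in> C1 L" "src L X = A" "trg L X = A" and Y: "Y \<in> C1 L" "src L Y = A" "trg L Y = A"
      and f: "left_linear K (map0 F A) f" by auto
    interpret f: left_linear K "map0 F A" f by fact
    interpret M: left_module K "map0 F A" "ldom f" by (rule f.modules)
    interpret N: left_module K "map0 F A" "lcod f" by (rule f.modules)
    note ar = act_ar_T(1)[OF _ _ _ f, of "id2 L X"] act_ar_T(2)[OF _ _ _ f, of "id2 L X"]
      act_ar_T(1)[OF _ _ _ act_ar_T(2)[OF _ _ _ f], of "id2 L Y" "id2 L X"]
      act_ar_T(1)[OF _ _ _ f, of "id2 L (Y \<cdot>\<^bsub>L\<^esub> X)"]
    \<comment> \<open>Identity 2-cells in the monoidal variable isolate naturality in the
      module.\<close>
    from arg_cong[OF act_assoc_natural[of "id2 L X" "id2 L Y" f], of lund] show ?case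
      using X Y f ar by (simp add: L.hcomp_id2)
  next
    case (3 \<zeta> \<xi> M)
    then have \<zeta>: "\<zeta> \<in> C2 L" "src L (dom2 L \<zeta>) = A" "trg L (dom2 L \<zeta>) = A"
      and \<xi>: "\<xi> \<in> C2 L" "src L (dom2 L \<xi>) = A" "trg L (dom2 L \<xi>) = A"
      and M: "left_module K (map0 F A) M" by auto
    interpret M: left_module K "map0 F A" M by fact
    note ar = act_ar_T(1)[OF _ _ _ id[OF M], of \<zeta>] act_ar_T(2)[OF _ _ _ id[OF M], of \<zeta>]
      act_ar_T(1)[OF _ _ _ act_ar_T(2)[OF _ _ _ id[OF M]], of \<xi> \<zeta>]
      act_ar_T(1)[OF _ _ _ id[OF M], of "\<xi> \<star>\<^bsub>L\<^esub> \<zeta>"]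
    \<comment> \<open>An identity in the module variable isolates naturality in the 1-cells.\<close>
    from arg_cong[OF act_assoc_natural[of \<zeta> \<xi> "\<lparr>ldom = M, lcod = M, lund = id2 K (lcar M)\<rparr>"], of lund]
    show ?case
      using \<zeta> \<xi> M id[OF M] ar by simp
  next
    case (4 X Y Z M)
    then have X: "X \<in> C1 L" "src L X = A" "trg L X = A" and Y: "Y \<in> C1 L" "src L Y = A" "trg L Y = A"
      and Z: "Z \<in> C1 L" "src L Z = A" "trg L Z = A" and M: "left_module K (map0 F A) M" by auto
    interpret M: left_module K "map0 F A" M by fact
    have 1: "t Y X M \<in> C2 K"
      "dom2 K (t Y X M) = und1 (map1 F Y) \<cdot> und1 (map1 F X) \<cdot> lcar M"
      using left_linear.lin_simps[OF s[OF X Y M]] X Y M by (simp_all del: tmod_comp_F)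
    note ar = act_ar_T(1)[OF _ _ _ id[OF M], of "assoc L Z Y X"]
      act_ar_T(1)[OF _ _ _ s[OF X Y M], of "id2 L Z"]
    from arg_cong[OF act_pentagon[of X Y Z M], of lund] show ?case
      using X Y Z M ar 1 by simp
  next
    case (5 X M)
    then have X: "X \<in> C1 L" "src L X = A" "trg L X = A" and M: "left_module K (map0 F A) M" by auto
    interpret M: left_module K "map0 F A" M by fact
    have I: "id1 L A \<in> C1 L" "src L (id1 L A) = A" "trg L (id1 L A) = A"
      using A by simp_all
    have 1: "t (id1 L A) X M \<in> C2 K"
      "dom2 K (t (id1 L A) X M) = und1 (map1 F X) \<cdot> lcar M"
      "cod2 K (t (id1 L A) X M) = und1 (map1 F X) \<cdot> lcar M"
      using left_linear.lin_simps[OF s[OF X I M]] X A M by (simp_all del: tmod_comp_F F_comp)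
    have 2: "t X (id1 L A) M \<in> C2 K"
      "dom2 K (t X (id1 L A) M) = und1 (map1 F X) \<cdot> lcar M"
      "cod2 K (t X (id1 L A) M) = und1 (map1 F X) \<cdot> lcar M"
      using left_linear.lin_simps[OF s[OF I X M]] X A M by (simp_all del: tmod_comp_F F_comp)
    note ar = act_ar_T(1)[OF _ _ _ id[OF M], of "id2 L X"]
    \<comment> \<open>The unit constraints and the unit isomorphism are identities, so each unit
      axiom says that one component of \<open>t\<close> is an identity.\<close>
    from arg_cong[OF act_lunit[of X M], of lund] arg_cong[OF act_runit[of X M], of lund] show ?case
      using X A M ar 1 2 by simp
  qed
qed

end

context coherent_over_monads
begin

lemma category_action_T:
  assumes "A \<in> C0 L"
  shows "category_action (endo_moncat L A) (Mod K (map0 F A)) (induced_action L (T_pseudo K L F s) A)"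
proof -
  interpret cat_pseudofunctor L "T_pseudo K L F s"
    using pseudofunctor_T by (simp add: cat_pseudofunctor_def)
  show ?thesis using category_action_induced[OF assms] by simp
qed

end

text \<open>From coherence to the action this is the pseudofunctor theorem for
  \<open>endo_part L A\<close>, where conditions on endomorphisms of \<open>A\<close> are all that
  is asked of the family.\<close>

lemma (in quasi_over_monads) category_action_iff_coherent:
  assumes A: "A \<in> C0 L"
  shows "category_action (endo_moncat L A) (Mod K (map0 F A)) (induced_action L (T_pseudo K L F t) A)
    \<longleftrightarrow> coherent_assoc_family K (endo_part L A) F t"
proof
  assume "coherent_assoc_family K (endo_part L A) F t"
  then interpret E: coherent_over_monads K "endo_part L A" F t
    using quasi_endo_part[OF A] by (simp add: coherent_over_monads_def)
  show "category_action (endo_moncat L A) (Mod K (map0 F A)) (induced_action L (T_pseudo K L F t) A)"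
    using E.category_action_T[of A] by simp
qed (rule coherent_of_action[OF A])

section \<open>Cocycles and associativity isomorphisms\<close>

context two_category
begin

text \<open>Linearity of \<open>u\<close> is linearity of \<open>h\<close> conjugated by
  \<open>u\<close>. Hence invertibility of a linear map can be tested on underlying 2-cells.\<close>

lemma left_linear_inverse:
  assumes "monad_in K B" "left_linear K B \<lparr>ldom = M, lcod = N, lund = h\<rparr>"
    and "u \<in> cell2 K (lcar N) (lcar M)" "u \<bullet> h = id2 K (lcar M)" "h \<bullet> u = id2 K (lcar N)"
  shows "left_linear K B \<lparr>ldom = N, lcod = M, lund = u\<rparr>"
proof -
  interpret B: monad_in K B by fact
  interpret h: left_linear K B "\<lparr>ldom = M, lcod = N, lund = h\<rparr>" by fact
  interpret M: left_module K B M using h.modules by simp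
  interpret N: left_module K B N using h.modules by simp
  have [simp]: "u \<in> C2 K" "dom2 K u = lcar N" "cod2 K u = lcar M"
    using assms(3) by (auto simp: cell2_def)
  have [simp]: "h \<in> C2 K" "dom2 K h = lcar M" "cod2 K h = lcar N"
    using h.lin_simps by simp_all
  have 1: "(mcar B \<rhd> h) \<bullet> (mcar B \<rhd> u) = id2 K (mcar B \<cdot> lcar N)"
    using arg_cong[OF assms(5), of "\<lambda>z. mcar B \<rhd> z"] by (simp add: lwhisker_vcomp)
  have "u \<bullet> lact N = u \<bullet> lact N \<bullet> (mcar B \<rhd> h) \<bullet> (mcar B \<rhd> u)"
    by (simp add: 1)
  also have "\<dots> = u \<bullet> h \<bullet> lact M \<bullet> (mcar B \<rhd> u)"
    using vcomp_cong3[OF h.linear, of "mcar B \<rhd> u"] by simp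
  also have "\<dots> = lact M \<bullet> (mcar B \<rhd> u)"
    by (simp add: vcomp_extend[OF assms(4)])
  finally show ?thesis
    using h.modules assms(3) by (intro left_linear.intro) simp_all
qed

text \<open>Composition in the Eilenberg-Moore 2-category extends the second cell along the unit and
  then composes in \<open>K\<close>, as in a Kleisli category. In this form
  \<open>em_act_comp\<close> applies to it.\<close>

lemma em_comp_eq:
  assumes "em_cell K (m1src Y) W P \<rho>" "em_cell K (m1src Y) P (und1 Y) \<sigma>"
  shows "em_comp K Y \<sigma> \<rho> = em_act K (und1 Y) \<sigma> (regular_mod (m1src Y)) \<bullet> \<rho>"
proof -
  interpret r: em_cell K "m1src Y" W P \<rho> by fact
  interpret s: em_cell K "m1src Y" P "und1 Y" \<sigma> by fact
  show ?thesis by (simp add: em_comp_def em_act_def vcomp_assoc)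
qed

text \<open>The action of a cocycle on the regular module is right \<open>B\<close>-linear, hence so is its inverse;
  this is why the inverse comes from an Eilenberg-Moore 2-cell again.\<close>

lemma em_act_inverse:
  assumes "em_cell K B P P \<rho>" "u \<in> cell2 K (P \<cdot> mcar B) (P \<cdot> mcar B)"
    and "u \<bullet> em_act K P \<rho> (regular_mod B) = id2 K (P \<cdot> mcar B)"
      "em_act K P \<rho> (regular_mod B) \<bullet> u = id2 K (P \<cdot> mcar B)"
  shows "em_cell K B P P (u \<bullet> (P \<rhd> mone B))"
    and "em_act K P (u \<bullet> (P \<rhd> mone B)) (regular_mod B) = u"
proof -
  interpret r: em_cell K B P P \<rho> by fact
  have [simp]: "u \<in> C2 K" "dom2 K u = P \<cdot> mcar B" "cod2 K u = P \<cdot> mcar B"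
    using assms(2) by (auto simp: cell2_def)
  show "em_cell K B P P (u \<bullet> (P \<rhd> mone B))"
    by unfold_locales simp_all
  let ?h = "em_act K P \<rho> (regular_mod B)"
  have [simp]: "?h \<in> C2 K" "dom2 K ?h = P \<cdot> mcar B" "cod2 K ?h = P \<cdot> mcar B"
    using r.em_act_simps[OF r.B.regular_module] by simp_all
  have 1: "(?h \<lhd> mcar B) \<bullet> (u \<lhd> mcar B) = id2 K (P \<cdot> mcar B \<cdot> mcar B)"
    using arg_cong[OF assms(4), of "\<lambda>z. z \<lhd> mcar B"] by (simp add: rwhisker_vcomp)
  have 2: "?h \<bullet> (P \<rhd> mmul B) = (P \<rhd> mmul B) \<bullet> (?h \<lhd> mcar B)"
    using r.em_act_lact[OF r.B.regular_module] by simp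
  have "u \<bullet> (P \<rhd> mmul B) = u \<bullet> (P \<rhd> mmul B) \<bullet> (?h \<lhd> mcar B) \<bullet> (u \<lhd> mcar B)"
    by (simp add: 1)
  also have "\<dots> = u \<bullet> ?h \<bullet> (P \<rhd> mmul B) \<bullet> (u \<lhd> mcar B)"
    using vcomp_cong3[OF 2, of "u \<lhd> mcar B"] by simp
  also have "\<dots> = (P \<rhd> mmul B) \<bullet> (u \<lhd> mcar B)"
    by (simp add: vcomp_extend[OF assms(3)])
  finally have 3: "(P \<rhd> mmul B) \<bullet> (u \<lhd> mcar B) = u \<bullet> (P \<rhd> mmul B)" ..
  have 4: "(P \<rhd> mmul B) \<bullet> (P \<rhd> (mone B \<lhd> mcar B)) = id2 K (P \<cdot> mcar B)"
    using arg_cong[OF r.B.mmul_mone(1), of "\<lambda>z. P \<rhd> z"] by (simp add: lwhisker_vcomp)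
  \<comment> \<open>By the right linearity in \<open>3\<close>, \<open>u\<close> is the extension of
    its restriction along the unit.\<close>
  show "em_act K P (u \<bullet> (P \<rhd> mone B)) (regular_mod B) = u"
    by (simp add: em_act_def rwhisker_vcomp vcomp_cong3[OF 3] 4)
qed

end

section \<open>Passing between cocycles and coherent families\<close>

context quasi_over_monads
begin

lemma F1_comp [simp]:
  assumes "X \<in> C1 L" "Y \<in> C1 L" "trg L X = src L Y"
  shows "monad_1cell K (mnd_comp1 K (map1 F Y) (map1 F X))"
  using F1(1)[of "Y \<cdot>\<^bsub>L\<^esub> X"] assms by simp

text \<open>The two sides of the cocycle condition act on a module as the two sides of the coherence
  condition for \<open>s\<close>.\<close>

lemma cocycle_sides:
  fixes A defines "B \<equiv> map0 F A"
  assumes A: "A \<in> C0 L"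
    and X: "X \<in> C1 L" "src L X = A" "trg L X = A" and Y: "Y \<in> C1 L" "src L Y = A" "trg L Y = A"
    and Z: "Z \<in> C1 L" "src L Z = A" "trg L Z = A"
    and \<rho>: "\<forall>X \<in> Ob (hom_cat L A A). \<forall>Y \<in> Ob (hom_cat L A A).
      em_cell K B (und1 (map1 F X) \<cdot> und1 (map1 F Y)) (und1 (map1 F X) \<cdot> und1 (map1 F Y)) (\<rho> X Y)"
  defines "P \<equiv> und1 (map1 F X) \<cdot> und1 (map1 F Y) \<cdot> und1 (map1 F Z)"
    and "c1 \<equiv> (und2 (map2 F (assoc L X Y Z)) \<star> mmul B) \<bullet> (\<rho> (X \<cdot>\<^bsub>L\<^esub> Y) Z \<lhd> mcar B) \<bullet>
      ((und1 (map1 F X) \<cdot> und1 (map1 F Y)) \<rhd> str (map1 F Z)) \<bullet> (\<rho> X Y \<lhd> und1 (map1 F Z))"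
    and "c2 \<equiv> ((und1 (map1 F X) \<cdot> und1 (map1 F Y) \<cdot> und1 (map1 F Z)) \<rhd> mmul B) \<bullet>
      (\<rho> X (Y \<cdot>\<^bsub>L\<^esub> Z) \<lhd> mcar B) \<bullet> (und1 (map1 F X) \<rhd> \<rho> Y Z)"
  shows "em_cell K B P P c1" "em_cell K B P P c2"
    and "left_module K B M \<Longrightarrow> (und2 (map2 F (assoc L X Y Z)) \<lhd> lcar M) \<bullet>
      em_act K P (\<rho> (X \<cdot>\<^bsub>L\<^esub> Y) Z) M \<bullet>
      em_act K (und1 (map1 F X) \<cdot> und1 (map1 F Y)) (\<rho> X Y) (tmod K (map1 F Z) M) = em_act K P c1 M"
    and "left_module K B M \<Longrightarrow> em_act K P (\<rho> X (Y \<cdot>\<^bsub>L\<^esub> Z)) M \<bullet>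
      (und1 (map1 F X) \<rhd> em_act K (und1 (map1 F Y) \<cdot> und1 (map1 F Z)) (\<rho> Y Z) M) = em_act K P c2 M"
proof -
  let ?X = "und1 (map1 F X)" and ?Y = "und1 (map1 F Y)" and ?Z = "und1 (map1 F Z)"
  let ?\<alpha> = "und2 (map2 F (assoc L X Y Z))" and ?b = "mcar B" and ?\<psi> = "str (map1 F Z)"
  let ?r = "\<rho> (X \<cdot>\<^bsub>L\<^esub> Y) Z" and ?r' = "\<rho> X (Y \<cdot>\<^bsub>L\<^esub> Z)"
  interpret B: monad_in K B using A by (simp add: B_def)
  note [simp] = X Y Z B_def[symmetric]
  note rho = em_cell.rho[OF \<rho>[rule_format]]
  have \<alpha> [simp]: "?\<alpha> \<in> C2 K" "dom2 K ?\<alpha> = ?X \<cdot> ?Y \<cdot> ?Z" "cod2 K ?\<alpha> = ?X \<cdot> ?Y \<cdot> ?Z"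
    by simp_all
  have r [simp]: "?r \<in> C2 K" "dom2 K ?r = ?X \<cdot> ?Y \<cdot> ?Z" "cod2 K ?r = ?X \<cdot> ?Y \<cdot> ?Z \<cdot> ?b"
    "?r' \<in> C2 K" "dom2 K ?r' = ?X \<cdot> ?Y \<cdot> ?Z" "cod2 K ?r' = ?X \<cdot> ?Y \<cdot> ?Z \<cdot> ?b"
    "\<rho> X Y \<in> C2 K" "dom2 K (\<rho> X Y) = ?X \<cdot> ?Y" "cod2 K (\<rho> X Y) = ?X \<cdot> ?Y \<cdot> ?b"
    "\<rho> Y Z \<in> C2 K" "dom2 K (\<rho> Y Z) = ?Y \<cdot> ?Z" "cod2 K (\<rho> Y Z) = ?Y \<cdot> ?Z \<cdot> ?b"
    using rho[of "X \<cdot>\<^bsub>L\<^esub> Y" Z] rho[of X "Y \<cdot>\<^bsub>L\<^esub> Z"] rho[of X Y] rho[of Y Z] by simp_all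
  show c1: "em_cell K B P P c1"
    by unfold_locales (simp_all add: c1_def P_def)
  show c2: "em_cell K B P P c2"
    by unfold_locales (simp_all add: c2_def P_def)
  \<comment> \<open>The action on \<open>tmod K (map1 F Z) M\<close> contains
    \<open>str (map1 F Z)\<close>. This is where the structure cell in the cocycle condition comes
    from.\<close>
  show "(?\<alpha> \<lhd> lcar M) \<bullet> em_act K P ?r M \<bullet> em_act K (?X \<cdot> ?Y) (\<rho> X Y) (tmod K (map1 F Z) M) =
      em_act K P c1 M" if "left_module K B M"
  proof -
    interpret M: left_module K B M by fact
    let ?M = "lcar M" and ?\<nu> = "lact M"
    \<comment> \<open>The constraint is separated from the multiplication so that it can be moved to
      the outside, where the coherence condition has it.\<close>
    have 1: "?\<alpha> \<star> mmul B = (?\<alpha> \<lhd> ?b) \<bullet> (P \<rhd> mmul B)"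
      using hcomp_rl[of "mmul B" ?\<alpha>] by (simp add: P_def)
    have 2: "(P \<rhd> ?\<nu>) \<bullet> (?\<alpha> \<lhd> (?b \<cdot> ?M)) = (?\<alpha> \<lhd> ?M) \<bullet> (P \<rhd> ?\<nu>)"
      using exchange[of ?\<nu> ?\<alpha>] by (simp add: P_def)
    have 3: "(P \<rhd> ?\<nu>) \<bullet> (P \<rhd> (mmul B \<lhd> ?M)) = (P \<rhd> ?\<nu>) \<bullet> ((?X \<cdot> ?Y \<cdot> ?Z \<cdot> ?b) \<rhd> ?\<nu>)"
      using arg_cong[OF M.lact_mmul, of "\<lambda>z. P \<rhd> z"] by (simp add: lwhisker_vcomp P_def)
    have 4: "((?X \<cdot> ?Y \<cdot> ?Z \<cdot> ?b) \<rhd> ?\<nu>) \<bullet> (?r \<lhd> (?b \<cdot> ?M)) = (?r \<lhd> ?M) \<bullet> (P \<rhd> ?\<nu>)"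
      using exchange[of ?\<nu> ?r] by (simp add: P_def)
    show ?thesis
      unfolding c1_def 1
      by (simp add: em_act_def norm P_def vcomp_cong3[OF 2[unfolded P_def]]
        vcomp_cong3[OF 3[unfolded P_def]] vcomp_cong3[OF 4[unfolded P_def]])
  qed
  show "em_act K P ?r' M \<bullet> (?X \<rhd> em_act K (?Y \<cdot> ?Z) (\<rho> Y Z) M) = em_act K P c2 M"
    if "left_module K B M"
  proof -
    interpret M: left_module K B M by fact
    let ?M = "lcar M" and ?\<nu> = "lact M"
    have 3: "(P \<rhd> ?\<nu>) \<bullet> (P \<rhd> (mmul B \<lhd> ?M)) = (P \<rhd> ?\<nu>) \<bullet> ((?X \<cdot> ?Y \<cdot> ?Z \<cdot> ?b) \<rhd> ?\<nu>)"
      using arg_cong[OF M.lact_mmul, of "\<lambda>z. P \<rhd> z"] by (simp add: lwhisker_vcomp P_def)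
    have 4: "((?X \<cdot> ?Y \<cdot> ?Z \<cdot> ?b) \<rhd> ?\<nu>) \<bullet> (?r' \<lhd> (?b \<cdot> ?M)) = (?r' \<lhd> ?M) \<bullet> (P \<rhd> ?\<nu>)"
      using exchange[of ?\<nu> ?r'] by (simp add: P_def)
    show ?thesis
      unfolding c2_def
      by (simp add: em_act_def norm P_def
        vcomp_cong3[OF 3[unfolded P_def]] vcomp_cong3[OF 4[unfolded P_def]])
  qed
qed

text \<open>Letting the cocycle act on modules turns its naturality, cocycle equation and
  normalization into the matching conditions on \<open>t\<close>. Naturality in the module holds for
  every action of this kind, and invertibility uses that composites act by composites.\<close>

lemma coherent_of_cocycle:
  assumes A: "A \<in> C0 L" and "em_cocycle K L F A \<rho>" "induced_by_cocycle K L F A t \<rho>"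
  shows "coherent_assoc_family K (endo_part L A) F t" "determined_at_regular K L F A t"
proof -
  interpret em_cocycle K L F A \<rho> by fact
  let ?B = "map0 F A"
  let ?u = "\<lambda>X. und1 (map1 F X)"
  interpret B: monad_in K ?B using A by simp
  have t: "t X Y M = em_act K (?u X \<cdot> ?u Y) (\<rho> X Y) M"
    if "X \<in> C1 L" "src L X = A" "trg L X = A" "Y \<in> C1 L" "src L Y = A" "trg L Y = A"
      "left_module K ?B M" for X Y M
    using assms(3) that by (simp add: induced_by_cocycle_def em_act_def)
  have cell: "em_cell K ?B (?u X \<cdot> ?u Y) (?u X \<cdot> ?u Y) (\<rho> X Y)"
    if "X \<in> C1 L" "src L X = A" "trg L X = A" "Y \<in> C1 L" "src L Y = A" "trg L Y = A" for X Y
    using em_cellI[of "mnd_comp1 K (map1 F X) (map1 F Y)" "mnd_comp1 K (map1 F X) (map1 F Y)" ?B "\<rho> X Y"]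
      rho_2cell[of X Y] that by (simp add: em_2cell_def Let_def)
  have linear: "left_linear K ?B (s_mor K L F t X Y M)"
    if X: "X \<in> C1 L" "src L X = A" "trg L X = A" and Y: "Y \<in> C1 L" "src L Y = A" "trg L Y = A"
      and M: "left_module K ?B M" for X Y M
    using em_act_linear[of "mnd_comp1 K (map1 F X) (map1 F Y)" "mnd_comp1 K (map1 F X) (map1 F Y)"
        ?B "\<rho> X Y" M] rho_2cell[of X Y] X Y M t[OF X Y M] by (simp add: s_mor_def)
  show "determined_at_regular K L F A t"
    unfolding determined_at_regular_def
  proof (intro ballI)
    fix X Y M assume *: "X \<in> Ob (hom_cat L A A)" "Y \<in> Ob (hom_cat L A A)" "M \<in> Ob (Mod K ?B)"
    interpret em_cell K ?B "?u Y \<cdot> ?u X" "?u Y \<cdot> ?u X" "\<rho> Y X" using * by (intro cell) auto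
    interpret M: left_module K ?B M using * by simp
    \<comment> \<open>\<open>em_act_regular\<close> replaces \<open>\<rho> Y X\<close> by its action
      on the regular module restricted along the unit, which is \<open>t Y X\<close> at the regular
      module preceded by the unit.\<close>
    have "t Y X M = em_act K (?u Y \<cdot> ?u X)
        (em_act K (?u Y \<cdot> ?u X) (\<rho> Y X) (regular_mod ?B) \<bullet> ((?u Y \<cdot> ?u X) \<rhd> mone ?B)) M"
      unfolding em_act_regular using * t[of Y X M] by simp
    with * em_act_simps[OF B.regular_module] t[of Y X "regular_mod ?B"]
    show "t Y X M = ((?u Y \<cdot> ?u X) \<rhd> lact M) \<bullet> (t Y X (regular_mod ?B) \<lhd> lcar M) \<bullet>
        (((?u Y \<cdot> ?u X) \<rhd> mone ?B) \<lhd> lcar M)"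
      by (simp add: em_act_def[of K _ _ M] rwhisker_vcomp)
  qed
  show "coherent_assoc_family K (endo_part L A) F t"
  proof (rule coherent_assoc_family.intro, goal_cases)
    case (1 X Y M)
    then have X: "X \<in> C1 L" "src L X = A" "trg L X = A" and Y: "Y \<in> C1 L" "src L Y = A" "trg L Y = A"
      and M: "left_module K ?B M" by auto
    let ?P = "?u Y \<cdot> ?u X" and ?PX = "mnd_comp1 K (map1 F Y) (map1 F X)"
    interpret r: em_cell K ?B ?P ?P "\<rho> Y X" by (rule cell[OF Y X])
    interpret M: left_module K ?B M by fact
    obtain \<sigma> where \<sigma>: "\<sigma> \<in> cell2 K ?P (?P \<cdot> mcar ?B)"
      and inv: "em_comp K ?PX \<sigma> (\<rho> Y X) = em_id K ?PX" "em_comp K ?PX (\<rho> Y X) \<sigma> = em_id K ?PX"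
      using rho_invertible[of Y X] X Y by auto
    have "em_cell K ?B ?P ?P \<sigma>"
      using em_cellI[of ?PX ?PX ?B \<sigma>] X Y \<sigma> by simp
    then interpret s: em_cell K ?B ?P ?P \<sigma> .
    have "em_act K ?P \<sigma> (regular_mod ?B) \<bullet> \<rho> Y X = ?P \<rhd> mone ?B"
      "em_act K ?P (\<rho> Y X) (regular_mod ?B) \<bullet> \<sigma> = ?P \<rhd> mone ?B"
      using inv em_comp_eq[of ?PX ?P ?P "\<rho> Y X" \<sigma>] em_comp_eq[of ?PX ?P ?P \<sigma> "\<rho> Y X"]
        r.em_cell_axioms s.em_cell_axioms X Y by (simp_all add: em_id_def)
    then have *: "em_act K ?P \<sigma> M \<bullet> em_act K ?P (\<rho> Y X) M = id2 K (?P \<cdot> lcar M)"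
      "em_act K ?P (\<rho> Y X) M \<bullet> em_act K ?P \<sigma> M = id2 K (?P \<cdot> lcar M)"
      using r.em_act_comp[OF s.em_cell_axioms M] s.em_act_comp[OF r.em_cell_axioms M]
        em_act_one[OF B.monad_in_axioms M, of ?P] by simp_all
    let ?g = "\<lparr>ldom = tmod K (map1 F (Y \<cdot>\<^bsub>L\<^esub> X)) M, lcod = tmod K (map1 F Y) (tmod K (map1 F X) M),
      lund = em_act K ?P \<sigma> M\<rparr>"
    have h: "left_linear K ?B (s_mor K L F t Y X M)" by (rule linear[OF Y X M])
    \<comment> \<open>Nothing is known about \<open>\<sigma>\<close> and the structure cells, so
      linearity of its action is deduced from its being inverse to a linear map.\<close>
    have g: "left_linear K ?B ?g"
      by (rule left_linear_inverse[OF B.monad_in_axioms h[unfolded s_mor_def]])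
        (use X Y M * t[OF Y X M] in \<open>simp_all add: cell2_def\<close>)
    show ?case
      using A X Y M h g * t[OF Y X M]
      by (intro category.is_isoI[OF category_Mod, of _ _ ?g]) simp_all
  next
    case (2 X Y f)
    then have X: "X \<in> C1 L" "src L X = A" "trg L X = A" and Y: "Y \<in> C1 L" "src L Y = A" "trg L Y = A"
      and f: "left_linear K ?B f" by auto
    interpret f: left_linear K ?B f by fact
    interpret M: left_module K ?B "ldom f" by (rule f.modules)
    interpret N: left_module K ?B "lcod f" by (rule f.modules)
    show ?case
      using em_cell.em_act_natural[OF cell[OF Y X] f] t[OF Y X] X Y f by simp
  next
    case (3 \<zeta> \<xi> M)
    then have \<zeta>: "\<zeta> \<in> C2 L" "src L (dom2 L \<zeta>) = A" "trg L (dom2 L \<zeta>) = A"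
      and \<xi>: "\<xi> \<in> C2 L" "src L (dom2 L \<xi>) = A" "trg L (dom2 L \<xi>) = A"
      and M: "left_module K ?B M" by auto
    interpret M: left_module K ?B M by fact
    let ?\<theta> = "und2 (map2 F \<xi>) \<star> und2 (map2 F \<zeta>)"
    have "em_act K (?u (cod2 L \<xi>) \<cdot> ?u (cod2 L \<zeta>)) (\<rho> (cod2 L \<xi>) (cod2 L \<zeta>)) M \<bullet> (?\<theta> \<lhd> lcar M) =
        (?\<theta> \<lhd> lcar M) \<bullet> em_act K (?u (dom2 L \<xi>) \<cdot> ?u (dom2 L \<zeta>)) (\<rho> (dom2 L \<xi>) (dom2 L \<zeta>)) M"
      by (rule em_cell.em_act_whisker[OF cell cell _ _ rho_natural M])
        (use \<zeta> \<xi> in \<open>simp_all add: cell2_def\<close>)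
    then show ?case using \<zeta> \<xi> M t by simp
  next
    case (4 X Y Z M)
    then have X: "X \<in> C1 L" "src L X = A" "trg L X = A" and Y: "Y \<in> C1 L" "src L Y = A" "trg L Y = A"
      and Z: "Z \<in> C1 L" "src L Z = A" "trg L Z = A" and M: "left_module K ?B M" by auto
    have ZY: "Z \<cdot>\<^bsub>L\<^esub> Y \<in> C1 L" "src L (Z \<cdot>\<^bsub>L\<^esub> Y) = A" "trg L (Z \<cdot>\<^bsub>L\<^esub> Y) = A"
      and YX: "Y \<cdot>\<^bsub>L\<^esub> X \<in> C1 L" "src L (Y \<cdot>\<^bsub>L\<^esub> X) = A" "trg L (Y \<cdot>\<^bsub>L\<^esub> X) = A"
      using X Y Z by simp_all
    have XM: "left_module K ?B (tmod K (map1 F X) M)" using X M by simp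
    have "\<forall>X \<in> Ob (hom_cat L A A). \<forall>Y \<in> Ob (hom_cat L A A).
        em_cell K ?B (?u X \<cdot> ?u Y) (?u X \<cdot> ?u Y) (\<rho> X Y)"
      using cell by simp
    \<comment> \<open>The 1-cells occur in reverse order: \<open>Z\<close> is outermost in the
      coherence condition and is therefore the first argument of the cocycle condition.\<close>
    note sides = cocycle_sides(3,4)[OF A Z Y X this M]
    have hom: "X \<in> Ob (hom_cat L A A)" "Y \<in> Ob (hom_cat L A A)" "Z \<in> Ob (hom_cat L A A)"
      using X Y Z by simp_all
    show ?case
      using trans[OF sides(1)[unfolded rho_cocycle[OF hom(3,2,1)]] sides(2)[symmetric]] X Y Z
      by (simp add: t[OF ZY X M] t[OF Z YX M] t[OF Z Y XM] t[OF Y X M])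
  next
    case (5 X M)
    then have X: "X \<in> C1 L" "src L X = A" "trg L X = A" and M: "left_module K ?B M" by auto
    interpret M: left_module K ?B M by fact
    have I: "id1 L A \<in> C1 L" "src L (id1 L A) = A" "trg L (id1 L A) = A"
      using A by simp_all
    show ?case
      using rho_normalized[of X] em_act_one[OF B.monad_in_axioms M, of "?u X"] X A
        t[OF X I M] t[OF I X M] by (simp add: em_id_def)
  qed
qed

text \<open>Once \<open>t\<close> is recognized as the action of \<open>\<rho>\<close>, each cocycle
  equation is tested on the regular module alone, where it is a coherence condition on
  \<open>t\<close>.\<close>

lemma cocycle_of_coherent:
  assumes A: "A \<in> C0 L" and "coherent_assoc_family K (endo_part L A) F t"
    and det: "determined_at_regular K L F A t"
  shows "\<exists>\<rho>. em_cocycle K L F A \<rho> \<and> induced_by_cocycle K L F A t \<rho>"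
proof -
  interpret coherent_assoc_family K "endo_part L A" F t by fact
  have E: "coherent_over_monads K (endo_part L A) F t"
    using quasi_endo_part[OF A] assms(2) by (simp add: coherent_over_monads_def)
  let ?B = "map0 F A"
  let ?R = "regular_mod ?B"
  let ?u = "\<lambda>X. und1 (map1 F X)"
  \<comment> \<open>By \<open>em_act_regular\<close> this is the only 2-cell whose action on the
    regular module can be \<open>t X Y ?R\<close>.\<close>
  define \<rho> where "\<rho> X Y = t X Y ?R \<bullet> ((?u X \<cdot> ?u Y) \<rhd> mone ?B)" for X Y
  interpret B: monad_in K ?B using A by simp
  have tR: "t X Y ?R \<in> C2 K" "dom2 K (t X Y ?R) = ?u X \<cdot> ?u Y \<cdot> mcar ?B"
      "cod2 K (t X Y ?R) = ?u X \<cdot> ?u Y \<cdot> mcar ?B"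
    if "X \<in> C1 L" "src L X = A" "trg L X = A" "Y \<in> C1 L" "src L Y = A" "trg L Y = A" for X Y
    using coherent_over_monads.s_simps[OF E, of Y X ?R] that by simp_all
  have cell: "em_cell K ?B (?u X \<cdot> ?u Y) (?u X \<cdot> ?u Y) (\<rho> X Y)"
    if "X \<in> C1 L" "src L X = A" "trg L X = A" "Y \<in> C1 L" "src L Y = A" "trg L Y = A" for X Y
    using tR[OF that] that by unfold_locales (simp_all add: \<rho>_def)
  \<comment> \<open>The right-hand side of \<open>determined_at_regular\<close> is the action of
    this \<open>\<rho>\<close>.\<close>
  have t: "t X Y M = em_act K (?u X \<cdot> ?u Y) (\<rho> X Y) M"
    if "X \<in> C1 L" "src L X = A" "trg L X = A" "Y \<in> C1 L" "src L Y = A" "trg L Y = A"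
      "left_module K ?B M" for X Y M
  proof -
    interpret M: left_module K ?B M using that by simp
    have "t X Y M = ((?u X \<cdot> ?u Y) \<rhd> lact M) \<bullet> (t X Y ?R \<lhd> lcar M) \<bullet>
        (((?u X \<cdot> ?u Y) \<rhd> mone ?B) \<lhd> lcar M)"
      using det[unfolded determined_at_regular_def, rule_format, of Y X M] that by simp
    also have "\<dots> = em_act K (?u X \<cdot> ?u Y) (\<rho> X Y) M"
      using tR[of X Y] that by (simp add: em_act_def \<rho>_def rwhisker_vcomp)
    finally show ?thesis .
  qed
  have "em_cocycle K L F A \<rho>"
  proof (rule em_cocycle.intro, goal_cases)
    case (1 X Y)
    then have X: "X \<in> C1 L" "src L X = A" "trg L X = A" and Y: "Y \<in> C1 L" "src L Y = A" "trg L Y = A"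
      by auto
    let ?PX = "mnd_comp1 K (map1 F X) (map1 F Y)"
    have "em_2cell K ?PX ?PX (t X Y ?R \<bullet> (und1 ?PX \<rhd> mone ?B))"
    proof (rule em_2cell_of_linear[where B = ?B])
      show "left_linear K (m1trg ?PX)
          \<lparr>ldom = tmod K ?PX ?R, lcod = tmod K ?PX ?R, lund = t X Y ?R\<rparr>"
        using coherent_over_monads.s_linear[OF E, of Y X ?R A] X Y by (simp add: s_mor_def)
      show "t X Y ?R = em_act K (und1 ?PX) (t X Y ?R \<bullet> (und1 ?PX \<rhd> mone ?B)) ?R"
        unfolding mnd_comp1_simps by (rule t[OF X Y B.regular_module, unfolded \<rho>_def])
    qed (use X Y in simp_all)
    then show ?case by (simp add: \<rho>_def)
  next
    case (2 \<zeta> \<xi>)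
    then have \<zeta>: "\<zeta> \<in> C2 L" "src L (dom2 L \<zeta>) = A" "trg L (dom2 L \<zeta>) = A"
      and \<xi>: "\<xi> \<in> C2 L" "src L (dom2 L \<xi>) = A" "trg L (dom2 L \<xi>) = A"
      by auto
    show ?case
      by (rule em_cell.em_whisker_of_act[OF cell cell])
        (use \<zeta> \<xi> s_natural_1cells[of \<xi> \<zeta> ?R] t[OF _ _ _ _ _ _ B.regular_module] in
          \<open>simp_all add: cell2_def\<close>)
  next
    case (3 X Y Z)
    then have X: "X \<in> C1 L" "src L X = A" "trg L X = A" and Y: "Y \<in> C1 L" "src L Y = A" "trg L Y = A"
      and Z: "Z \<in> C1 L" "src L Z = A" "trg L Z = A" by auto
    have "\<forall>X \<in> Ob (hom_cat L A A). \<forall>Y \<in> Ob (hom_cat L A A).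
        em_cell K ?B (?u X \<cdot> ?u Y) (?u X \<cdot> ?u Y) (\<rho> X Y)"
      using cell by simp
    note sides = cocycle_sides[OF A X Y Z this]
    have XY: "X \<cdot>\<^bsub>L\<^esub> Y \<in> C1 L" "src L (X \<cdot>\<^bsub>L\<^esub> Y) = A" "trg L (X \<cdot>\<^bsub>L\<^esub> Y) = A"
      and YZ: "Y \<cdot>\<^bsub>L\<^esub> Z \<in> C1 L" "src L (Y \<cdot>\<^bsub>L\<^esub> Z) = A" "trg L (Y \<cdot>\<^bsub>L\<^esub> Z) = A"
      using X Y Z by simp_all
    have R: "left_module K ?B ?R" by (rule B.regular_module)
    have ZR: "left_module K ?B (tmod K (map1 F Z) ?R)" using Z R by simp
    \<comment> \<open>Two Eilenberg-Moore 2-cells with the same action on the regular module are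
      equal, so \<open>s_assoc\<close> at \<open>?R\<close> is enough.\<close>
    have "em_act K (?u X \<cdot> ?u Y \<cdot> ?u Z) ((und2 (map2 F (assoc L X Y Z)) \<star> mmul ?B) \<bullet>
        (\<rho> (X \<cdot>\<^bsub>L\<^esub> Y) Z \<lhd> mcar ?B) \<bullet> ((?u X \<cdot> ?u Y) \<rhd> str (map1 F Z)) \<bullet> (\<rho> X Y \<lhd> ?u Z)) ?R =
      em_act K (?u X \<cdot> ?u Y \<cdot> ?u Z) (((?u X \<cdot> ?u Y \<cdot> ?u Z) \<rhd> mmul ?B) \<bullet>
        (\<rho> X (Y \<cdot>\<^bsub>L\<^esub> Z) \<lhd> mcar ?B) \<bullet> (?u X \<rhd> \<rho> Y Z)) ?R"
      unfolding sides(3)[OF R, symmetric] sides(4)[OF R, symmetric]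
      using s_assoc[of Z Y X ?R] X Y Z R
      by (simp add: t[OF XY Z R] t[OF X YZ R] t[OF X Y ZR] t[OF Y Z R])
    then show ?case
      using em_cell.em_act_regular[OF sides(1)] em_cell.em_act_regular[OF sides(2)] by metis
  next
    case (4 X Y)
    then have X: "X \<in> C1 L" "src L X = A" "trg L X = A" and Y: "Y \<in> C1 L" "src L Y = A" "trg L Y = A"
      by auto
    let ?P = "?u X \<cdot> ?u Y" and ?PX = "mnd_comp1 K (map1 F X) (map1 F Y)"
    interpret r: em_cell K ?B ?P ?P "\<rho> X Y" by (rule cell[OF X Y])
    obtain g where g: "left_linear K ?B g" "ldom g = tmod K (map1 F (X \<cdot>\<^bsub>L\<^esub> Y)) ?R"
      "lcod g = tmod K (map1 F X) (tmod K (map1 F Y) ?R)"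
      "lund g \<bullet> t X Y ?R = id2 K (?P \<cdot> mcar ?B)" "t X Y ?R \<bullet> lund g = id2 K (?P \<cdot> mcar ?B)"
      using s_iso[of Y X ?R] X Y by (auto simp: is_iso_def)
    have u: "lund g \<in> cell2 K (?P \<cdot> mcar ?B) (?P \<cdot> mcar ?B)"
      using left_linear.lund[OF g(1)] g(2,3) X Y by simp
    \<comment> \<open>The inverse cell is the inverse of \<open>t X Y ?R\<close> restricted along
      the unit; \<open>em_act_inverse\<close> guarantees that extending it gives that inverse back,
      so nothing is lost in the restriction.\<close>
    let ?h = "em_act K ?P (\<rho> X Y) ?R" and ?\<sigma> = "lund g \<bullet> (?P \<rhd> mone ?B)"
    have h: "lund g \<bullet> ?h = id2 K (?P \<cdot> mcar ?B)" "?h \<bullet> lund g = id2 K (?P \<cdot> mcar ?B)"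
      using g(4,5) t[OF X Y B.regular_module] by simp_all
    note \<sigma> = em_act_inverse[OF r.em_cell_axioms u h]
    have [simp]: "lund g \<in> C2 K" "dom2 K (lund g) = ?P \<cdot> mcar ?B" "cod2 K (lund g) = ?P \<cdot> mcar ?B"
      using u by (auto simp: cell2_def)
    note h_simps = r.em_act_simps[OF B.regular_module]
    have "em_comp K ?PX ?\<sigma> (\<rho> X Y) = lund g \<bullet> ?h \<bullet> (?P \<rhd> mone ?B)"
      using em_comp_eq[of ?PX ?P ?P "\<rho> X Y" ?\<sigma>] r.em_cell_axioms \<sigma> r.em_act_regular X Y by simp
    also have "\<dots> = em_id K ?PX"
      using vcomp_extend[OF h(1), of "?P \<rhd> mone ?B"] X Y h_simps by (simp add: em_id_def)
    finally have 1: "em_comp K ?PX ?\<sigma> (\<rho> X Y) = em_id K ?PX" .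
    have "em_comp K ?PX (\<rho> X Y) ?\<sigma> = ?h \<bullet> lund g \<bullet> (?P \<rhd> mone ?B)"
      using em_comp_eq[of ?PX ?P ?P ?\<sigma> "\<rho> X Y"] r.em_cell_axioms \<sigma> X Y h_simps
      by (simp add: vcomp_assoc)
    also have "\<dots> = em_id K ?PX"
      using vcomp_extend[OF h(2), of "?P \<rhd> mone ?B"] X Y h_simps by (simp add: em_id_def)
    finally show ?case
      using 1 em_cell.rho[OF \<sigma>(1)] by (intro bexI[of _ ?\<sigma>]) (simp_all add: cell2_def)
  next
    case (5 X)
    then have X: "X \<in> C1 L" "src L X = A" "trg L X = A" by auto
    show ?case
      using s_unit[of X ?R] X A by (simp add: em_id_def \<rho>_def)
  qed
  moreover have "induced_by_cocycle K L F A t \<rho>"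
    using t by (simp add: induced_by_cocycle_def em_act_def)
  ultimately show ?thesis by blast
qed

text \<open>A cocycle yields coherence and determination at once. Conversely an action is first read
  as a coherent family over \<open>endo_part L A\<close>, from which the cocycle is
  extracted.\<close>

lemma action_determined_iff_cocycle:
  assumes A: "A \<in> C0 L"
  shows "category_action (endo_moncat L A) (Mod K (map0 F A)) (induced_action L (T_pseudo K L F t) A) \<and>
      determined_at_regular K L F A t \<longleftrightarrow>
    (\<exists>\<rho>. em_cocycle K L F A \<rho> \<and> induced_by_cocycle K L F A t \<rho>)"
  using coherent_of_cocycle[OF A] cocycle_of_coherent[OF A] category_action_iff_coherent[OF A] by blast

end

theorem theorem8p2:
  fixes K :: "('o, 'm, 'c) bicat" and L :: "('p, 'n, 'd) bicat"
    and U F :: "('o, 'm, 'c, 'p, 'n, 'd) to_mnd" and s :: "('m, 'c, 'n) assoc_family"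
  assumes "two_category K"
    and "bicategory_over_monads K L U F"
    and "coherent_assoc_family K L F s"
  shows "pseudofunctor L Cat (T_pseudo K L F s) \<and>
    (\<forall>A \<in> C0 L.
      let V = endo_moncat L A; D = Mod K (map0 F A);
          action_by = (\<lambda>t. induced_action L (T_pseudo K L F t) A)
      in category_action V D (action_by s) \<and>
         (\<forall>X \<in> Ob (mon_cat V). \<forall>M \<in> Ob D. act_ob (action_by s) X M = tmod K (map1 F X) M) \<and>
         (\<forall>X \<in> Ob (mon_cat V). \<forall>Y \<in> Ob (mon_cat V). \<forall>M \<in> Ob D.
            act_assoc (action_by s) Y X M = s_mor K L F s Y X M) \<and>
         (\<forall>M \<in> Ob D. act_unit (action_by s) M = Id D M) \<and>
         (determined_at_regular K L F A s \<longrightarrow>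
            (\<exists>\<rho>. em_cocycle K L F A \<rho> \<and> induced_by_cocycle K L F A s \<rho>)) \<and>
         (\<forall>t. category_action V D (action_by t) \<and> determined_at_regular K L F A t \<longleftrightarrow>
            (\<exists>\<rho>. em_cocycle K L F A \<rho> \<and> induced_by_cocycle K L F A t \<rho>)))"
proof -
  interpret over: bicategory_over_monads K L U F by fact
  interpret coherent_over_monads K L F s
    using assms(1,3) over.L.bicategory_axioms over.F.quasi_2functor_axioms over.unit_constraints
    by (simp add: coherent_over_monads_def quasi_over_monads_def quasi_over_monads_axioms_def)
  have "act_ob (induced_action L (T_pseudo K L F s) A) X M = tmod K (map1 F X) M"
    "act_unit (induced_action L (T_pseudo K L F s) A) M = Id (Mod K (map0 F A)) M"
    if "A \<in> C0 L" "X \<in> Ob (hom_cat L A A)" "M \<in> Ob (Mod K (map0 F A))" for A X M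
    using that by simp_all
  \<comment> \<open>The pseudofunctor provides the action for \<open>s\<close>, so the equivalence
    for arbitrary families specializes to it.\<close>
  moreover have "\<exists>\<rho>. em_cocycle K L F A \<rho> \<and> induced_by_cocycle K L F A s \<rho>"
    if "A \<in> C0 L" "determined_at_regular K L F A s" for A
    using that category_action_T action_determined_iff_cocycle by blast
  ultimately show ?thesis
    using pseudofunctor_T category_action_T action_determined_iff_cocycle by (simp add: Let_def)
qed

end
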